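(* For all $a,b,k\in\mathbb N_0$, the set $S^{\le k}_{a,b}$ is a basis of $\mathrm{Hom}_{\mathrm{sVW}}(a,b)^{\le k}$; consequently $S^\bullet_{a,b}$ is a basis of $\mathrm{Hom}_{\mathrm{sVW}}(a,b)$.
   Context: Work over $\mathbb C$; in a monoidal supercategory the super interchange law $(f\otimes g)\circ(h\otimes k)=(-1)^{\bar g\bar h}(f\circ h)\otimes(g\circ k)$ holds. The affine VW supercategory $\mathrm{sVW}$ is the $\mathbb C$-linear strict monoidal supercategory generated by one object $\star$ and morphisms $s:\star\otimes\star\to\star\otimes\star$ (even), $b:\star\otimes\star\to\mathbb 1$ (odd), $b^*:\mathbb 1\to\star\otimes\star$ (odd), $y:\star\to\star$ (even), subject to: (R1) $s\circ s=1$, $(s\otimes 1)(1\otimes s)(s\otimes 1)=(1\otimes s)(s\otimes1)(1\otimes s)$; (R2) $(b\otimes 1_\star)\circ(1_\star\otimes b^* )=-1_\star$, $(1_\star\otimes b)\circ(b^*\otimes 1_\star)=1_\star$; (R3) $(1_\star\otimes s)\circ(b^*\otimes 1_\star)=(s\otimes 1_\star)\circ(1_\star\otimes b^* )$, $s\circ b^*=-b^*$; (R4) $1_\star\otimes y=s\circ(y\otimes 1_\star)\circ s+s+b^*\circ b$ and $b\circ(1_\star\otimes y)=b\circ(y\otimes 1_\star)+b$. Objects are identified with $a\in\mathbb N_0$. A (dotted) diagram is a morphism obtained as a finite composite of tensor products of generators and identities; it is drawn (bottom to top) with $s$ a crossing, $b$ a cap, $b^*$ a cup, $y$ a dot on a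 strand. Strings are classified as cups (both ends on top), caps (both ends at bottom), through strings, or loops. $\mathrm{Hom}_{\mathrm{sVW}}(a,b)^{\le k}$ is the span of dotted diagrams with at most $k$ dots (occurrences of $y$). For an undotted loop-free diagram, its connector is the perfect matching of the $a+b$ endpoints given by its strings; $\mathrm{Conn}(a,b)$ is the set of perfect matchings of the $a+b$ points. An undotted diagram is normal if: any two strings intersect at most once; no string intersects itself; no two cups or caps are at the same height; all cups are above all caps; heights of caps decrease left to right (by left ends); heights of cups increase left to right (by left ends). For each $c\in\mathrm{Conn}(a,b)$ fix a normal undotted diagram $d_c$ with connector $c$. $S^\bullet_{a,b}$ is the set of dotted diagrams obtained from the $d_c$ by placing an arbitrary number of dots on each string, with dots on cups and caps placed at their leftmost end and dots on through strings placed at their bottom; $S^{\le k}_{a,b}$ consists of those with at most $k$ dots in total. *)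

theory Defs
  imports Complex_Main
begin

text \<open>GS = crossing s (2 -> 2, even), GB = cap b (2 -> 0, odd),
  GBs = cup b* (0 -> 2, odd), GY = dot y (1 -> 1, even).\<close>

datatype gen = GS | GB | GBs | GY

fun gsrc :: "gen \<Rightarrow> nat" where
  "gsrc GS = 2" | "gsrc GB = 2" | "gsrc GBs = 0" | "gsrc GY = 1"

fun gtgt :: "gen \<Rightarrow> nat" where
  "gtgt GS = 2" | "gtgt GB = 0" | "gtgt GBs = 2" | "gtgt GY = 1"

fun gpar :: "gen \<Rightarrow> nat" where
  "gpar GS = 0" | "gpar GB = 1" | "gpar GBs = 1" | "gpar GY = 0"

text \<open>A layer (p, g, q) is the morphism 1_p \<otimes> g \<otimes> 1_q.  A word (a, [l1,...,ln]) with
  source object a is the composite ln \<circ> ... \<circ> l1 (read bottom to top).  Every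
  morphism of the free monoidal supercategory is a linear combination of such words.\<close>

type_synonym layer = "nat \<times> gen \<times> nat"
type_synonym word = "nat \<times> layer list"

fun lsrc :: "layer \<Rightarrow> nat" where "lsrc (p, g, q) = p + gsrc g + q"
fun ltgt :: "layer \<Rightarrow> nat" where "ltgt (p, g, q) = p + gtgt g + q"
fun gen_of :: "layer \<Rightarrow> gen" where "gen_of (p, g, q) = g"
fun lpos :: "layer \<Rightarrow> nat" where "lpos (p, g, q) = p"

fun valid_from :: "nat \<Rightarrow> layer list \<Rightarrow> bool" where
  "valid_from n [] = True"
| "valid_from n (l # ls) = (lsrc l = n \<and> valid_from (ltgt l) ls)"

fun end_obj :: "nat \<Rightarrow> layer list \<Rightarrow> nat" where
  "end_obj n [] = n"
| "end_obj n (l # ls) = end_obj (ltgt l) ls"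

definition hom_words :: "nat \<Rightarrow> nat \<Rightarrow> word set" where
  "hom_words a b = {w. fst w = a \<and> valid_from a (snd w) \<and> end_obj a (snd w) = b}"

definition num_dots :: "word \<Rightarrow> nat" where
  "num_dots w = length (filter (\<lambda>l. gen_of l = GY) (snd w))"

definition shift_layers :: "nat \<Rightarrow> nat \<Rightarrow> layer list \<Rightarrow> layer list" where
  "shift_layers p q ls = map (\<lambda>(p0, g, q0). (p + p0, g, q0 + q)) ls"

text \<open>Each defining relation is written as a list of (coefficient, word) pairs whose
  linear combination is 0.\<close>

definition sVW_relations :: "(complex \<times> layer list) list list" where
  "sVW_relations =
   [ \<comment> \<open>R1: s s = 1\<close>
     [(1, [(0, GS, 0), (0, GS, 0)]), (-1, [])],
     \<comment> \<open>R1: braid relation\<close>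
     [(1, [(0, GS, 1), (1, GS, 0), (0, GS, 1)]), (-1, [(1, GS, 0), (0, GS, 1), (1, GS, 0)])],
     \<comment> \<open>R2: (b \<otimes> 1)(1 \<otimes> b*) = -1\<close>
     [(1, [(1, GBs, 0), (0, GB, 1)]), (1, [])],
     \<comment> \<open>R2: (1 \<otimes> b)(b* \<otimes> 1) = 1\<close>
     [(1, [(0, GBs, 1), (1, GB, 0)]), (-1, [])],
     \<comment> \<open>R3: (1 \<otimes> s)(b* \<otimes> 1) = (s \<otimes> 1)(1 \<otimes> b*)\<close>
     [(1, [(0, GBs, 1), (1, GS, 0)]), (-1, [(1, GBs, 0), (0, GS, 1)])],
     \<comment> \<open>R3: s b* = - b*\<close>
     [(1, [(0, GBs, 0), (0, GS, 0)]), (1, [(0, GBs, 0)])],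
     \<comment> \<open>R4: 1 \<otimes> y = s (y \<otimes> 1) s + s + b* b\<close>
     [(1, [(1, GY, 0)]), (-1, [(0, GS, 0), (0, GY, 1), (0, GS, 0)]), (-1, [(0, GS, 0)]),
      (-1, [(0, GB, 0), (0, GBs, 0)])],
     \<comment> \<open>R4: b (1 \<otimes> y) = b (y \<otimes> 1) + b\<close>
     [(1, [(1, GY, 0), (0, GB, 0)]), (-1, [(0, GY, 1), (0, GB, 0)]), (-1, [(0, GB, 0)])]
   ]"

type_synonym lin = "word \<Rightarrow> complex"

definition basis_vec :: "word \<Rightarrow> lin" where
  "basis_vec w = (\<lambda>x. if x = w then 1 else 0)"

definition rel_instance ::
  "nat \<Rightarrow> layer list \<Rightarrow> nat \<Rightarrow> nat \<Rightarrow> (complex \<times> layer list) list \<Rightarrow> layer list \<Rightarrow> lin" where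
  "rel_instance a u p q ts v =
     (\<lambda>x. sum_list (map (\<lambda>(c, w). if x = (a, u @ shift_layers p q w @ v) then c else 0) ts))"

definition relation_gens :: "nat \<Rightarrow> nat \<Rightarrow> lin set" where
  "relation_gens a b =
    {rel_instance a u p q ts v | u p q ts v. ts \<in> set sVW_relations \<and>
        (\<forall>t\<in>set ts. (a, u @ shift_layers p q (snd t) @ v) \<in> hom_words a b)}"

text \<open>Super interchange law for two generators f (left) and g (right) separated by r strands:
  (1 \<otimes> g)(f \<otimes> 1) = (-1)^(|f||g|) (f \<otimes> 1)(1 \<otimes> g).\<close>
definition interchange_gens :: "nat \<Rightarrow> nat \<Rightarrow> lin set" where
  "interchange_gens a b =
    {(\<lambda>x. basis_vec (a, u @ [(P, f, r + gsrc g + Q), (P + gtgt f + r, g, Q)] @ v) x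
          - (-1::complex) ^ (gpar f * gpar g) *
            basis_vec (a, u @ [(P + gsrc f + r, g, Q), (P, f, r + gtgt g + Q)] @ v) x)
     | u v P Q r f g.
        (a, u @ [(P, f, r + gsrc g + Q), (P + gtgt f + r, g, Q)] @ v) \<in> hom_words a b \<and>
        (a, u @ [(P + gsrc f + r, g, Q), (P, f, r + gtgt g + Q)] @ v) \<in> hom_words a b}"

inductive_set lspan :: "('w \<Rightarrow> complex) set \<Rightarrow> ('w \<Rightarrow> complex) set" for G where
  lspan_zero: "(\<lambda>_. 0) \<in> lspan G"
| lspan_step: "g \<in> G \<Longrightarrow> x \<in> lspan G \<Longrightarrow> (\<lambda>w. c * g w + x w) \<in> lspan G"

text \<open>The relation subspace R(a,b); Hom_sVW(a,b) = span(hom_words a b) / R(a,b).\<close>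
definition rel_space :: "nat \<Rightarrow> nat \<Rightarrow> lin set" where
  "rel_space a b = lspan (relation_gens a b \<union> interchange_gens a b)"

definition lin_indep_mod :: "lin set \<Rightarrow> word set \<Rightarrow> bool" where
  "lin_indep_mod R S \<longleftrightarrow>
    (\<forall>F u. finite F \<and> F \<subseteq> S \<and> (\<lambda>x. \<Sum>w\<in>F. u w * basis_vec w x) \<in> R \<longrightarrow> (\<forall>w\<in>F. u w = 0))"

text \<open>The classes of S modulo R form a basis of the subspace of the quotient spanned
  by the classes of H.\<close>
definition quotient_basis :: "lin set \<Rightarrow> word set \<Rightarrow> word set \<Rightarrow> bool" where
  "quotient_basis R S H \<longleftrightarrow>
     S \<subseteq> H \<and> lin_indep_mod R S \<and> (\<forall>w\<in>H. basis_vec w \<in> lspan (basis_vec ` S \<union> R))"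

definition Hom_le_words :: "nat \<Rightarrow> nat \<Rightarrow> nat \<Rightarrow> word set" where
  "Hom_le_words a b k = {w \<in> hom_words a b. num_dots w \<le> k}"

text \<open>Points of the diagram: (level, position); level i lies between layers i-1 and i,
  level 0 is the bottom boundary and level (length ls) the top boundary.\<close>
definition adj :: "layer list \<Rightarrow> nat \<times> nat \<Rightarrow> nat \<times> nat \<Rightarrow> bool" where
  "adj ls x y \<longleftrightarrow> (\<exists>i < length ls. \<exists>p g q. ls ! i = (p, g, q) \<and>
      ((\<exists>j. j < p \<and> x = (i, j) \<and> y = (Suc i, j))
     \<or> (\<exists>j. j < q \<and> x = (i, p + gsrc g + j) \<and> y = (Suc i, p + gtgt g + j))
     \<or> (g = GS \<and> (x = (i, p) \<and> y = (Suc i, Suc p) \<or> x = (i, Suc p) \<and> y = (Suc i, p)))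
     \<or> (g = GY \<and> x = (i, p) \<and> y = (Suc i, p))
     \<or> (g = GB \<and> x = (i, p) \<and> y = (i, Suc p))
     \<or> (g = GBs \<and> x = (Suc i, p) \<and> y = (Suc i, Suc p))))"

definition str_conn :: "layer list \<Rightarrow> nat \<times> nat \<Rightarrow> nat \<times> nat \<Rightarrow> bool" where
  "str_conn ls = (\<lambda>x y. adj ls x y \<or> adj ls y x)\<^sup>*\<^sup>*"

datatype endpt = Bot nat | Top nat

definition endpts :: "nat \<Rightarrow> nat \<Rightarrow> endpt set" where
  "endpts a b = Bot ` {..<a} \<union> Top ` {..<b}"

text \<open>Perfect matchings of the a+b boundary points (as fixed-point-free involutions).\<close>
definition Conn :: "nat \<Rightarrow> nat \<Rightarrow> (endpt \<Rightarrow> endpt) set" where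
  "Conn a b = {c. (\<forall>x\<in>endpts a b. c x \<in> endpts a b \<and> c x \<noteq> x \<and> c (c x) = x) \<and>
                  (\<forall>x. x \<notin> endpts a b \<longrightarrow> c x = x)}"

fun vert :: "layer list \<Rightarrow> endpt \<Rightarrow> nat \<times> nat" where
  "vert ls (Bot j) = (0, j)"
| "vert ls (Top j) = (length ls, j)"

definition width_at :: "nat \<Rightarrow> layer list \<Rightarrow> nat \<Rightarrow> nat" where
  "width_at a ls i = (if i = 0 then a else ltgt (ls ! (i - 1)))"

definition vertices :: "nat \<Rightarrow> layer list \<Rightarrow> (nat \<times> nat) set" where
  "vertices a ls = {(i, j). i \<le> length ls \<and> j < width_at a ls i}"

definition has_connector :: "nat \<Rightarrow> nat \<Rightarrow> layer list \<Rightarrow> (endpt \<Rightarrow> endpt) \<Rightarrow> bool" where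
  "has_connector a b ls c \<longleftrightarrow>
     (\<forall>x\<in>endpts a b. \<forall>y\<in>endpts a b.
        c x = y \<longleftrightarrow> x \<noteq> y \<and> str_conn ls (vert ls x) (vert ls y))"

definition loop_free :: "nat \<Rightarrow> nat \<Rightarrow> layer list \<Rightarrow> bool" where
  "loop_free a b ls \<longleftrightarrow> (\<forall>v\<in>vertices a ls. \<exists>x\<in>endpts a b. str_conn ls v (vert ls x))"

definition undotted :: "layer list \<Rightarrow> bool" where
  "undotted ls \<longleftrightarrow> (\<forall>l\<in>set ls. gen_of l \<noteq> GY)"

definition cap_left :: "layer list \<Rightarrow> nat \<Rightarrow> nat" where
  "cap_left ls i = (LEAST j. str_conn ls (0, j) (i, lpos (ls ! i)))"

definition cup_left :: "layer list \<Rightarrow> nat \<Rightarrow> nat" where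
  "cup_left ls i = (LEAST j. str_conn ls (length ls, j) (Suc i, lpos (ls ! i)))"

text \<open>Heights are layer indices (higher index = higher in the picture); different
  cups/caps automatically sit at different heights.\<close>
definition normal_diagram :: "nat \<Rightarrow> nat \<Rightarrow> layer list \<Rightarrow> bool" where
  "normal_diagram a b ls \<longleftrightarrow>
     (a, ls) \<in> hom_words a b \<and> undotted ls \<and> loop_free a b ls \<and>
     \<comment> \<open>no string intersects itself\<close>
     (\<forall>i < length ls. gen_of (ls ! i) = GS \<longrightarrow>
        \<not> str_conn ls (i, lpos (ls ! i)) (i, Suc (lpos (ls ! i)))) \<and>
     \<comment> \<open>two strings intersect at most once\<close>
     (\<forall>i i'. i < i' \<and> i' < length ls \<and> gen_of (ls ! i) = GS \<and> gen_of (ls ! i') = GS \<longrightarrow>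
        (let p = lpos (ls ! i); p' = lpos (ls ! i') in
          \<not> ((str_conn ls (i, p) (i', p') \<and> str_conn ls (i, Suc p) (i', Suc p')) \<or>
             (str_conn ls (i, p) (i', Suc p') \<and> str_conn ls (i, Suc p) (i', p'))))) \<and>
     \<comment> \<open>all cups above all caps\<close>
     (\<forall>i < length ls. \<forall>i' < length ls. gen_of (ls ! i) = GB \<and> gen_of (ls ! i') = GBs \<longrightarrow> i < i') \<and>
     \<comment> \<open>heights of caps decrease from left to right\<close>
     (\<forall>i < length ls. \<forall>i' < length ls. gen_of (ls ! i) = GB \<and> gen_of (ls ! i') = GB \<and>
        cap_left ls i < cap_left ls i' \<longrightarrow> i' < i) \<and>
     \<comment> \<open>heights of cups increase from left to right\<close>
     (\<forall>i < length ls. \<forall>i' < length ls. gen_of (ls ! i) = GBs \<and> gen_of (ls ! i') = GBs \<and>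
        cup_left ls i < cup_left ls i' \<longrightarrow> i < i')"

text \<open>Endpoints carrying the dots of a string: bottom end of a through string, left
  end of a cap, left end of a cup.\<close>
definition dot_site :: "(endpt \<Rightarrow> endpt) \<Rightarrow> nat \<Rightarrow> nat \<Rightarrow> endpt \<Rightarrow> bool" where
  "dot_site c a b x \<longleftrightarrow> x \<in> endpts a b \<and>
     (case x of
        Bot i \<Rightarrow> (case c x of Top _ \<Rightarrow> True | Bot i' \<Rightarrow> i < i')
      | Top j \<Rightarrow> (case c x of Top j' \<Rightarrow> j < j' | Bot _ \<Rightarrow> False))"

definition dotted_word ::
  "nat \<Rightarrow> nat \<Rightarrow> (endpt \<Rightarrow> endpt) \<Rightarrow> layer list \<Rightarrow> (endpt \<Rightarrow> nat) \<Rightarrow> word" where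
  "dotted_word a b c ls f =
    (a, concat (map (\<lambda>i. if dot_site c a b (Bot i) then replicate (f (Bot i)) (i, GY, a - Suc i) else [])
                    [0..<a])
        @ ls @
        concat (map (\<lambda>j. if dot_site c a b (Top j) then replicate (f (Top j)) (j, GY, b - Suc j) else [])
                    [0..<b]))"

definition S_bullet :: "((endpt \<Rightarrow> endpt) \<Rightarrow> layer list) \<Rightarrow> nat \<Rightarrow> nat \<Rightarrow> word set" where
  "S_bullet d a b = {dotted_word a b c (d c) f | c f. c \<in> Conn a b}"

definition S_le :: "((endpt \<Rightarrow> endpt) \<Rightarrow> layer list) \<Rightarrow> nat \<Rightarrow> nat \<Rightarrow> nat \<Rightarrow> word set" where
  "S_le d a b k = {w \<in> S_bullet d a b. num_dots w \<le> k}"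

end

theory Submission
  imports Defs "HOL-Library.Function_Algebras" "HOL-Library.Nat_Bijection"
begin

text \<open>Spanning: modulo diagrams with fewer dots, every defining relation equates two diagrams up to a sign.
  Bending all bottom endpoints to the top reduces to morphisms with source 0, and there every diagram is,
  up to a sign, zero or a normal form obtained by inserting dotted cups one after the other.

  Independence: sVW acts on tensor powers of a superspace with an odd bilinear form, where \<open>N\<close> auxiliary
  strands are added on the left and a dot acts by the Jucys-Murphy element of its strand.  Choose \<open>N\<close>
  to be the number of dots of a given basis diagram and consider a matrix coefficient in which the label of
  every auxiliary strand has to change.  Each dot changes at most one auxiliary label, so all dots are used,
  and distinct labels along the strings force a diagram with nonzero coefficient to have the given
  connector and the given numbers of dots; for the given diagram exactly one summand survives.

  Finally, the chosen diagrams are as numerous as the normal forms, so they span as well.\<close>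

section \<open>Words modulo the relations and words with fewer dots\<close>

text \<open>The chosen diagrams are arbitrary normal ones, so rewriting a word directly into the
  chosen diagram would require a comparison of any two normal diagrams with the same connector.
  Counting replaces this geometric argument: basis words with \<open>k\<close> dots are independent
  modulo fewer dots, hence inject into the codes of normal forms, and these codes inject into
  matchings with dot numbers. All sets involved are finite, so both injections are bijections.
  Equivalences carry a factor 1 or -1. A word equivalent to its own negative vanishes, and this is
  how closed loops disappear: a cap absorbs a crossing with sign 1, a cup with sign -1. In the
  representation a dot on the very first strand acts as zero. The auxiliary strands supply the
  partners with which a dot exchanges labels; they are needed to make the numbers of dots visible.
  The finite label set is chosen anew for each marked diagram, with separate labels for every string
  and every number of dots passed on it, so that matrix coefficients of diagrams reduce to counting
  label changes.\<close>

text \<open>A layer of a valid word is determined by its position and its generator, since the width is known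
  from the source object.\<close>

type_synonym pword = "(nat \<times> gen) list"

fun fin :: "nat \<Rightarrow> pword \<Rightarrow> nat" where
  "fin n [] = n"
| "fin n ((p, g) # u) = fin (n - gsrc g + gtgt g) u"

fun ok :: "nat \<Rightarrow> pword \<Rightarrow> bool" where
  "ok n [] = True"
| "ok n ((p, g) # u) = (p + gsrc g \<le> n \<and> ok (n - gsrc g + gtgt g) u)"

fun lay :: "nat \<Rightarrow> pword \<Rightarrow> layer list" where
  "lay n [] = []"
| "lay n ((p, g) # u) = (p, g, n - p - gsrc g) # lay (n - gsrc g + gtgt g) u"

definition sh :: "nat \<Rightarrow> pword \<Rightarrow> pword" where
  "sh p u = map (\<lambda>(i, g). (p + i, g)) u"

definition dots :: "pword \<Rightarrow> nat" where
  "dots u = length (filter (\<lambda>l. snd l = GY) u)"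

lemma fin_append [simp]: "fin n (u @ v) = fin (fin n u) v"
  by (induction n u rule: fin.induct) auto

lemma ok_append [simp]: "ok n (u @ v) = (ok n u \<and> ok (fin n u) v)"
  by (induction n u rule: fin.induct) auto

lemma lay_append [simp]: "lay n (u @ v) = lay n u @ lay (fin n u) v"
  by (induction n u rule: fin.induct) auto

lemma sh_simps [simp]: "sh p [] = []" "sh p ((i, g) # u) = (p + i, g) # sh p u"
  "sh p (u @ v) = sh p u @ sh p v"
  by (auto simp: sh_def)

lemma sh_sh [simp]: "sh p (sh q u) = sh (p + q) u"
  by (auto simp: sh_def)

lemma sh_0 [simp]: "sh 0 u = u"
  by (auto simp: sh_def)

lemma sh_replicate [simp]: "sh p (replicate m (i, g)) = replicate m (p + i, g)"
  by (auto simp: sh_def)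

lemma dots_simps [simp]: "dots [] = 0" "dots (l # u) = (if snd l = GY then 1 else 0) + dots u"
  "dots (u @ v) = dots u + dots v"
  by (auto simp: dots_def)

lemma dots_sh [simp]: "dots (sh p u) = dots u"
  by (induction u) (auto simp: sh_def)

lemma dots_replicate [simp]: "dots (replicate m l) = (if snd l = GY then m else 0)"
  by (induction m) auto

lemma fin_ok: "ok n u \<Longrightarrow> p + n \<le> m \<Longrightarrow>
    ok m (sh p u) \<and> fin m (sh p u) = m - n + fin n u \<and>
    lay m (sh p u) = shift_layers p (m - p - n) (lay n u)"
proof (induction n u arbitrary: m rule: fin.induct)
  case (2 n i g u)
  obtain r where n: "n = i + gsrc g + r" using 2(2) by (auto simp: le_iff_add)
  obtain k where m: "m = p + n + k" using 2(3) le_Suc_ex by blast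
  have "ok (m - gsrc g + gtgt g) (sh p u) \<and>
      fin (m - gsrc g + gtgt g) (sh p u) = m - gsrc g + gtgt g - (n - gsrc g + gtgt g) + fin (n - gsrc g + gtgt g) u \<and>
      lay (m - gsrc g + gtgt g) (sh p u) = shift_layers p (m - gsrc g + gtgt g - p - (n - gsrc g + gtgt g)) (lay (n - gsrc g + gtgt g) u)"
    using 2(2) m n by (intro 2(1)) auto
  moreover have "m - gsrc g + gtgt g - (n - gsrc g + gtgt g) = m - n"
    "m - gsrc g + gtgt g - p - (n - gsrc g + gtgt g) = m - p - n"
    "m - (p + i) - gsrc g = n - i - gsrc g + (m - p - n)" "p + i + gsrc g \<le> m"
    using m n by auto
  ultimately show ?case by (simp only: sh_simps ok.simps fin.simps lay.simps) (simp add: shift_layers_def)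
qed (auto simp: shift_layers_def)

lemma ok_sh: "ok n u \<Longrightarrow> p + n \<le> m \<Longrightarrow> ok m (sh p u)"
  and fin_sh: "ok n u \<Longrightarrow> p + n \<le> m \<Longrightarrow> fin m (sh p u) = m - n + fin n u"
  and lay_sh: "ok n u \<Longrightarrow> p + n \<le> m \<Longrightarrow> lay m (sh p u) = shift_layers p (m - p - n) (lay n u)"
  using fin_ok by blast+

lemma lay_hom_words: "ok n u \<Longrightarrow> (n, lay n u) \<in> hom_words n (fin n u)"
proof -
  have "ok n u \<Longrightarrow> valid_from n (lay n u) \<and> end_obj n (lay n u) = fin n u"
    by (induction n u rule: fin.induct) (auto simp: algebra_simps)
  then show "ok n u \<Longrightarrow> ?thesis" by (simp add: hom_words_def)
qed

lemma hom_words_lay: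
  assumes "w \<in> hom_words n b"
  obtains u where "ok n u" "fin n u = b" "w = (n, lay n u)"
proof -
  have "valid_from n ls \<Longrightarrow> \<exists>u. ok n u \<and> ls = lay n u \<and> fin n u = end_obj n ls" for ls
  proof (induction ls arbitrary: n)
    case Nil
    then show ?case by (intro exI[of _ "[]"]) auto
  next
    case (Cons l ls)
    obtain p g q where l: "l = (p, g, q)" by (cases l) auto
    with Cons obtain u where u: "ok (ltgt l) u \<and> ls = lay (ltgt l) u \<and> fin (ltgt l) u = end_obj (ltgt l) ls"
      by auto
    have "n - gsrc g + gtgt g = ltgt l" "n - p - gsrc g = q" "p + gsrc g \<le> n" using Cons.prems l by auto
    then show ?case using u l by (intro exI[of _ "(p, g) # u"]) (simp only: ok.simps fin.simps lay.simps end_obj.simps simp_thms)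
  qed
  then show ?thesis using assms that by (cases w) (auto simp: hom_words_def)
qed

lemma num_dots_lay [simp]: "num_dots (n, lay n u) = dots u"
  by (induction n u rule: fin.induct) (auto simp: num_dots_def)

section \<open>Linear spans in the free vector space on words\<close>

lemma lspan_add: "x \<in> lspan G \<Longrightarrow> y \<in> lspan G \<Longrightarrow> (\<lambda>w. x w + y w) \<in> lspan G"
proof (induction rule: lspan.induct)
  case (lspan_step g x c)
  then have "(\<lambda>w. c * g w + (x w + y w)) \<in> lspan G" by (intro lspan.lspan_step) auto
  then show ?case by (simp add: add.assoc)
qed auto

lemma lspan_scale: "x \<in> lspan G \<Longrightarrow> (\<lambda>w. c * x w) \<in> lspan G"
proof (induction rule: lspan.induct)
  case lspan_zero
  then show ?case by (auto intro: lspan.lspan_zero)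
next
  case (lspan_step g x c')
  then have "(\<lambda>w. (c * c') * g w + c * x w) \<in> lspan G" by (intro lspan.lspan_step) auto
  then show ?case by (simp add: algebra_simps)
qed

lemma lspan_base: "g \<in> G \<Longrightarrow> g \<in> lspan G"
  using lspan.lspan_step[OF _ lspan.lspan_zero, of g G 1] by simp

lemma lspan_diff: "x \<in> lspan G \<Longrightarrow> y \<in> lspan G \<Longrightarrow> (\<lambda>w. x w - y w) \<in> lspan G"
  using lspan_add[of x G "\<lambda>w. (-1) * y w"] lspan_scale[of y G "-1"] by simp

lemma lspan_subset: "x \<in> lspan G \<Longrightarrow> G \<subseteq> lspan H \<Longrightarrow> x \<in> lspan H"
proof (induction rule: lspan.induct)
  case (lspan_step g x c)
  then show ?case using lspan_add[OF lspan_scale[of g H c], of x] by auto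
qed (auto intro: lspan.lspan_zero)

text \<open>In \<open>rel w e l r\<close> the words \<open>l\<close> and \<open>r\<close> start at the object \<open>w\<close>, and \<open>l = e r\<close> holds up to
  words with fewer dots; all defining relations become binomial in this associated graded sense.\<close>

inductive rel :: "nat \<Rightarrow> int \<Rightarrow> pword \<Rightarrow> pword \<Rightarrow> bool" where
  rel_ss: "rel 2 1 [(0, GS), (0, GS)] []"
| rel_braid: "rel 3 1 [(0, GS), (1, GS), (0, GS)] [(1, GS), (0, GS), (1, GS)]"
| rel_snake1: "rel 1 (-1) [(1, GBs), (0, GB)] []"
| rel_snake2: "rel 1 1 [(0, GBs), (1, GB)] []"
| rel_cup: "rel 1 1 [(0, GBs), (1, GS)] [(1, GBs), (0, GS)]"
| rel_scup: "rel 0 (-1) [(0, GBs), (0, GS)] [(0, GBs)]"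
| rel_ys: "rel 2 1 [(1, GY)] [(0, GS), (0, GY), (0, GS)]"
| rel_by: "rel 2 1 [(1, GY), (0, GB)] [(0, GY), (0, GB)]"
| rel_ic: "rel (gsrc f + r + gsrc g) ((-1) ^ (gpar f * gpar g))
     [(0, f), (gtgt f + r, g)] [(gsrc f + r, g), (0, f)]"

text \<open>Congruence modulo this subspace is equality of morphisms up to those expressible with
  fewer than \<open>k\<close> dots. Staying inside the free vector space avoids a quotient
  type.\<close>

definition lower :: "nat \<Rightarrow> nat \<Rightarrow> nat \<Rightarrow> lin set" where
  "lower a b k = lspan (rel_space a b \<union> basis_vec ` {w \<in> hom_words a b. num_dots w < k})"

lemma rel_ok: "rel w e l r \<Longrightarrow> ok w l \<and> ok w r \<and> fin w l = fin w r \<and> dots l = dots r \<and> (e = 1 \<or> e = -1)"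
  by (induction rule: rel.induct) (auto simp: minus_one_power_iff)

text \<open>\<open>E n (-1) u u\<close> expresses that \<open>u\<close> vanishes up to words with fewer dots.\<close>

inductive E :: "nat \<Rightarrow> int \<Rightarrow> pword \<Rightarrow> pword \<Rightarrow> bool" for n where
  E_base: "rel w e l r \<Longrightarrow> ok n u \<Longrightarrow> p + w \<le> fin n u \<Longrightarrow> ok (fin n u - w + fin w l) v \<Longrightarrow>
     E n e (u @ sh p l @ v) (u @ sh p r @ v)"
| E_refl: "ok n u \<Longrightarrow> E n 1 u u"
| E_sym: "E n e u v \<Longrightarrow> E n e v u"
| E_trans: "E n e u v \<Longrightarrow> E n e' v w \<Longrightarrow> E n (e * e') u w"

lemma E_ok: "E n e u v \<Longrightarrow> ok n u \<and> ok n v \<and> fin n u = fin n v \<and> dots u = dots v \<and> (e = 1 \<or> e = -1)"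
proof (induction rule: E.induct)
  case (E_base w e l r u p v)
  then show ?case using rel_ok[OF E_base(1)] by (auto simp: ok_sh fin_sh)
qed auto

lemma rel_instance_eq:
  "rel_instance n u p q ts v = (\<lambda>x. \<Sum>(c, l)\<leftarrow>ts. c * basis_vec (n, u @ shift_layers p q l @ v) x)"
  unfolding rel_instance_def
  by (intro ext arg_cong[of _ _ sum_list]) (auto simp: basis_vec_def)

lemma relation_instance_mem:
  assumes ts: "map (\<lambda>(c, l). (c, lay w l)) ps \<in> set sVW_relations" and u: "ok n u" and p: "p + w \<le> fin n u"
    and ok: "\<forall>t \<in> set ps. ok w (snd t) \<and> fin w (snd t) = d"
    and v: "ok (fin n u - w + d) v"
  shows "(\<lambda>x. \<Sum>(c, l)\<leftarrow>ps. c * basis_vec (n, lay n (u @ sh p l @ v)) x)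
    \<in> rel_space n (fin (fin n u - w + d) v)" (is "_ \<in> rel_space n ?b")
proof -
  let ?q = "fin n u - p - w" and ?v = "lay (fin n u - w + d) v"
  let ?ts = "map (\<lambda>(c, l). (c, lay w l)) ps"
  have eq: "lay n (u @ sh p (snd t) @ v) = lay n u @ shift_layers p ?q (lay w (snd t)) @ ?v"
    and hom: "(n, lay n (u @ sh p (snd t) @ v)) \<in> hom_words n ?b" if "t \<in> set ps" for t
  proof -
    have o: "ok w (snd t)" "fin w (snd t) = d" using ok that by auto
    show "lay n (u @ sh p (snd t) @ v) = lay n u @ shift_layers p ?q (lay w (snd t)) @ ?v"
      using o p by (simp add: lay_sh fin_sh)
    have "ok n (u @ sh p (snd t) @ v)" "fin n (u @ sh p (snd t) @ v) = ?b"
      using o p u v by (auto simp: ok_sh fin_sh)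
    then show "(n, lay n (u @ sh p (snd t) @ v)) \<in> hom_words n ?b" using lay_hom_words by metis
  qed
  have "\<forall>t\<in>set ?ts. (n, lay n u @ shift_layers p ?q (snd t) @ ?v) \<in> hom_words n ?b"
    using hom eq by (auto simp del: lay_append)
  then have "rel_instance n (lay n u) p ?q ?ts ?v \<in> relation_gens n ?b"
    unfolding relation_gens_def using ts by blast
  moreover have "rel_instance n (lay n u) p ?q ?ts ?v =
      (\<lambda>x. \<Sum>(c, l)\<leftarrow>ps. c * basis_vec (n, lay n (u @ sh p l @ v)) x)"
    unfolding rel_instance_eq map_map
    by (intro ext arg_cong[of _ _ sum_list] map_cong refl) (use eq in \<open>auto simp del: lay_append\<close>)
  ultimately have "(\<lambda>x. \<Sum>(c, l)\<leftarrow>ps. c * basis_vec (n, lay n (u @ sh p l @ v)) x) \<in> relation_gens n ?b"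
    by (simp only:)
  then show ?thesis unfolding rel_space_def by (intro lspan_base UnI1)
qed

lemma interchange_mem:
  assumes u: "ok n u" and p: "p + (gsrc f + r + gsrc g) \<le> fin n u"
    and v: "ok (fin n u - (gsrc f + r + gsrc g) + (gtgt f + r + gtgt g)) v"
  shows "(\<lambda>x. basis_vec (n, lay n (u @ sh p [(0, f), (gtgt f + r, g)] @ v)) x -
      of_int ((-1) ^ (gpar f * gpar g)) * basis_vec (n, lay n (u @ sh p [(gsrc f + r, g), (0, f)] @ v)) x)
    \<in> rel_space n (fin (fin n u - (gsrc f + r + gsrc g) + (gtgt f + r + gtgt g)) v)" (is "_ \<in> rel_space n ?b")
proof -
  obtain Q where Q: "fin n u = p + (gsrc f + r + gsrc g) + Q" using p le_Suc_ex by blast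
  let ?U = "lay n u" and ?V = "lay (p + gtgt f + r + gtgt g + Q) v"
  have 1: "lay n (u @ sh p [(0, f), (gtgt f + r, g)] @ v) =
      ?U @ [(p, f, r + gsrc g + Q), (p + gtgt f + r, g, Q)] @ ?V"
    using Q by (simp add: algebra_simps)
  have 2: "lay n (u @ sh p [(gsrc f + r, g), (0, f)] @ v) =
      ?U @ [(p + gsrc f + r, g, Q), (p, f, r + gtgt g + Q)] @ ?V"
    using Q by (simp add: algebra_simps)
  have "ok n (u @ sh p [(0, f), (gtgt f + r, g)] @ v)" "ok n (u @ sh p [(gsrc f + r, g), (0, f)] @ v)"
    "fin n (u @ sh p [(0, f), (gtgt f + r, g)] @ v) = ?b" "fin n (u @ sh p [(gsrc f + r, g), (0, f)] @ v) = ?b"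
    using u v Q by (auto simp: algebra_simps)
  then have "(n, ?U @ [(p, f, r + gsrc g + Q), (p + gtgt f + r, g, Q)] @ ?V) \<in> hom_words n ?b"
    "(n, ?U @ [(p + gsrc f + r, g, Q), (p, f, r + gtgt g + Q)] @ ?V) \<in> hom_words n ?b"
    using lay_hom_words[of n "u @ sh p [(0, f), (gtgt f + r, g)] @ v"]
      lay_hom_words[of n "u @ sh p [(gsrc f + r, g), (0, f)] @ v"] unfolding 1 2 by (simp_all only:)
  then have "(\<lambda>x. basis_vec (n, ?U @ [(p, f, r + gsrc g + Q), (p + gtgt f + r, g, Q)] @ ?V) x -
      (-1) ^ (gpar f * gpar g) * basis_vec (n, ?U @ [(p + gsrc f + r, g, Q), (p, f, r + gtgt g + Q)] @ ?V) x)
      \<in> interchange_gens n ?b"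
    unfolding interchange_gens_def by blast
  then show ?thesis unfolding 1 2 rel_space_def of_int_power of_int_minus of_int_1
    by (intro lspan_base UnI2)
qed

text \<open>The two sides differ from a defining relation only by terms with fewer dots: the
  crossing and cup-cap terms of R4, and the undotted cap. These lie in \<open>lower\<close> in any
  surrounding context.\<close>

lemma rel_sound:
  assumes "rel w e l r" and u: "ok n u" and p: "p + w \<le> fin n u" and v: "ok (fin n u - w + fin w l) v"
  shows "(\<lambda>x. basis_vec (n, lay n (u @ sh p l @ v)) x - of_int e * basis_vec (n, lay n (u @ sh p r @ v)) x)
    \<in> lower n (fin (fin n u - w + fin w l) v) (dots (u @ l @ v))" (is "?z \<in> lower n ?b ?k")
proof -
  have R: "x \<in> lower n ?b ?k" if "x \<in> rel_space n ?b" for x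
    using that unfolding lower_def by (auto intro: lspan_base)
  have L: "basis_vec (n, lay n (u @ sh p t @ v)) \<in> lower n ?b ?k"
    if "ok w t" "fin w t = fin w l" "dots t < dots l" for t
  proof -
    have "ok n (u @ sh p t @ v)" "fin n (u @ sh p t @ v) = ?b" using u v p that by (auto simp: ok_sh fin_sh)
    then have "(n, lay n (u @ sh p t @ v)) \<in> hom_words n ?b" using lay_hom_words by metis
    moreover have "num_dots (n, lay n (u @ sh p t @ v)) < ?k" using that by (simp del: lay_append)
    ultimately show ?thesis unfolding lower_def by (intro lspan_base) blast
  qed
  let ?B = "\<lambda>t. basis_vec (n, lay n (u @ sh p t @ v))"
  have I: "(\<lambda>x. \<Sum>(c, t)\<leftarrow>ps. c * ?B t x) \<in> lower n ?b ?k"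
    if "map (\<lambda>(c, l). (c, lay w l)) ps \<in> set sVW_relations"
      "\<forall>t \<in> set ps. ok w (snd t) \<and> fin w (snd t) = fin w l" for ps
    using R[OF relation_instance_mem[OF that(1) u p that(2) v]] .
  from assms(1) show ?thesis
  proof cases
    case rel_ss
    then show ?thesis using I[of "[(1, l), (-1, [])]"] by (simp add: sVW_relations_def)
  next
    case rel_braid
    then show ?thesis using I[of "[(1, l), (-1, r)]"] by (simp add: sVW_relations_def)
  next
    case rel_snake1
    then show ?thesis using I[of "[(1, l), (1, r)]"] by (simp add: sVW_relations_def)
  next
    case rel_snake2
    then show ?thesis using I[of "[(1, l), (-1, r)]"] by (simp add: sVW_relations_def)
  next
    case rel_cup
    then show ?thesis using I[of "[(1, l), (-1, r)]"] by (simp add: sVW_relations_def)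
  next
    case rel_scup
    then show ?thesis using I[of "[(1, l), (1, r)]"] by (simp add: sVW_relations_def)
  next
    case rel_ys
    have "(\<lambda>x. \<Sum>(c, t)\<leftarrow>[(1, l), (-1, r), (-1, [(0, GS)]), (-1, [(0, GB), (0, GBs)])]. c * ?B t x) \<in> lower n ?b ?k"
      using rel_ys by (intro I) (auto simp: sVW_relations_def)
    moreover have "?B [(0, GS)] \<in> lower n ?b ?k" "?B [(0, GB), (0, GBs)] \<in> lower n ?b ?k"
      using rel_ys L[of "[(0, GS)]"] L[of "[(0, GB), (0, GBs)]"] by (simp_all del: lay_append sh_simps)
    \<comment> \<open>Adding back the two undotted terms of R4 leaves the binomial
      \<open>l - r\<close>.\<close>
    ultimately have "(\<lambda>x. (\<Sum>(c, t)\<leftarrow>[(1, l), (-1, r), (-1, [(0, GS)]), (-1, [(0, GB), (0, GBs)])]. c * ?B t x)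
       + (?B [(0, GS)] x + ?B [(0, GB), (0, GBs)] x)) \<in> lower n ?b ?k"
      unfolding lower_def by (intro lspan_add)
    then show ?thesis using rel_ys by (simp del: lay_append sh_simps)
  next
    case rel_by
    have "(\<lambda>x. \<Sum>(c, t)\<leftarrow>[(1, l), (-1, r), (-1, [(0, GB)])]. c * ?B t x) \<in> lower n ?b ?k"
      using rel_by by (intro I) (auto simp: sVW_relations_def)
    moreover have "?B [(0, GB)] \<in> lower n ?b ?k"
      using rel_by L[of "[(0, GB)]"] by (simp_all del: lay_append sh_simps)
    ultimately have "(\<lambda>x. (\<Sum>(c, t)\<leftarrow>[(1, l), (-1, r), (-1, [(0, GB)])]. c * ?B t x)
       + ?B [(0, GB)] x) \<in> lower n ?b ?k"
      unfolding lower_def by (intro lspan_add)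
    then show ?thesis using rel_by by (simp del: lay_append sh_simps)
  next
    case (rel_ic f rr g)
    have *: "fin w l = gtgt f + rr + gtgt g" using rel_ic by simp
    show ?thesis using R interchange_mem[OF u p[unfolded rel_ic(1)]] v rel_ic(1-4) unfolding * by (simp only:)
  qed
qed

lemma E_sound: "E n e u v \<Longrightarrow>
  (\<lambda>x. basis_vec (n, lay n u) x - of_int e * basis_vec (n, lay n v) x) \<in> lower n (fin n u) (dots u)"
proof (induction rule: E.induct)
  case (E_base w e l r u p v)
  have "fin n (u @ sh p l @ v) = fin (fin n u - w + fin w l) v" "dots (u @ sh p l @ v) = dots (u @ l @ v)"
    using E_base rel_ok[OF E_base(1)] by (auto simp: fin_sh)
  then show ?case using rel_sound[OF E_base(1-4)] by metis
next
  case (E_refl u)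
  then show ?case by (simp add: lower_def lspan.lspan_zero)
next
  case (E_sym e u v)
  \<comment> \<open>Scaling by \<open>- e\<close> exchanges the two words because \<open>e\<close>
    squares to 1.\<close>
  then have "(\<lambda>x. - of_int e * (basis_vec (n, lay n u) x - of_int e * basis_vec (n, lay n v) x)) \<in> lower n (fin n u) (dots u)"
    unfolding lower_def by (intro lspan_scale)
  moreover have "e = 1 \<or> e = -1" "fin n u = fin n v" "dots u = dots v" using E_ok[OF E_sym(1)] by auto
  ultimately show ?case by (elim disjE) (auto simp: add.commute)
next
  case (E_trans e u v e' w)
  have *: "fin n u = fin n v" "dots u = dots v" using E_ok[OF E_trans(1)] by auto
  have "(\<lambda>x. (basis_vec (n, lay n u) x - of_int e * basis_vec (n, lay n v) x) +
      of_int e * (basis_vec (n, lay n v) x - of_int e' * basis_vec (n, lay n w) x)) \<in> lower n (fin n u) (dots u)"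
    using E_trans unfolding lower_def * by (intro lspan_add lspan_scale)
  then show ?case by (simp add: algebra_simps)
qed

lemma E_app: "E n e u v \<Longrightarrow> ok (fin n u) w \<Longrightarrow> E n e (u @ w) (v @ w)"
proof (induction rule: E.induct)
  case (E_base w' e l r u p v)
  have "fin n (u @ sh p l @ v) = fin (fin n u - w' + fin w' l) v"
    using fin_sh[of w' l p "fin n u"] E_base(3) rel_ok[OF E_base(1)] by simp
  then show ?case using E.E_base[OF E_base(1-3), of "v @ w"] E_base by simp
next
  case (E_sym e u v)
  then show ?case using E_ok[OF E_sym(1)] by (auto intro: E.E_sym)
next
  case (E_trans e u v e' w')
  then show ?case using E_ok[OF E_trans(1)] by (auto intro: E.E_trans)
qed (auto intro: E.E_refl)

lemma E_pre: "E m e u v \<Longrightarrow> ok n w \<Longrightarrow> fin n w = m \<Longrightarrow> E n e (w @ u) (w @ v)"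
proof (induction rule: E.induct)
  case (E_base w' e l r u p v)
  then show ?case using E.E_base[OF E_base(1), of n "w @ u" p v] by simp
qed (auto intro: E.E_refl E.E_sym E.E_trans)

lemma E_sh: "E m e u v \<Longrightarrow> p + m \<le> n \<Longrightarrow> E n e (sh p u) (sh p v)"
proof (induction rule: E.induct)
  case (E_base w e l r u q v)
  have f: "fin n (sh p u) = n - m + fin m u" using E_base by (simp add: fin_sh)
  have "ok (fin n (sh p u) - w + fin w l) (sh p v)"
    using E_base f by (intro ok_sh[OF E_base(4)]) auto
  then show ?case using E.E_base[OF E_base(1), of n "sh p u" "p + q" "sh p v"] E_base f
    by (simp add: ok_sh)
qed (auto intro: E.E_refl E.E_sym E.E_trans ok_sh)

text \<open>The contexts are given by equations for \<open>A\<close> and \<open>B\<close>, so that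
  concrete words can be matched by simplification even if their list structure does not show the
  redex.\<close>

lemma E_ctx:
  assumes "E m e l r" "A = u @ sh p l @ v" "B = u @ sh p r @ v" "ok n A" "p + m \<le> fin n u"
  shows "E n e A B"
proof -
  have "E (fin n u) e (sh p l) (sh p r)" using assms by (intro E_sh) auto
  then have "E (fin n u) e (sh p l @ v) (sh p r @ v)" using assms by (intro E_app) auto
  then show ?thesis using assms E_pre[of "fin n u" e _ _ n u] by auto
qed

lemmas E_rel = E_base[where u = "[]" and p = 0 and v = "[]", simplified]

text \<open>Only the vanishing of closed loops depends on an explicit sign; for all other reductions
  in the spanning argument a sign may be forgotten.\<close>

definition eqv :: "nat \<Rightarrow> pword \<Rightarrow> pword \<Rightarrow> bool" where
  "eqv n u v \<longleftrightarrow> (\<exists>e. E n e u v)"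

lemma eqvI: "E n e u v \<Longrightarrow> eqv n u v" by (auto simp: eqv_def)
lemma eqv_refl: "ok n u \<Longrightarrow> eqv n u u" by (auto simp: eqv_def intro: E_refl)
lemma eqv_sym: "eqv n u v \<Longrightarrow> eqv n v u" by (auto simp: eqv_def intro: E_sym)
lemma eqv_trans [trans]: "eqv n u v \<Longrightarrow> eqv n v w \<Longrightarrow> eqv n u w"
  by (auto simp: eqv_def intro: E_trans)
lemma eqv_ok: "eqv n u v \<Longrightarrow> ok n u \<and> ok n v \<and> fin n u = fin n v \<and> dots u = dots v"
  by (auto simp: eqv_def dest: E_ok)
lemma eqv_app: "eqv n u v \<Longrightarrow> ok (fin n u) w \<Longrightarrow> eqv n (u @ w) (v @ w)"
  by (auto simp: eqv_def intro: E_app)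
lemma eqv_pre: "eqv m u v \<Longrightarrow> ok n w \<Longrightarrow> fin n w = m \<Longrightarrow> eqv n (w @ u) (w @ v)"
  by (auto simp: eqv_def intro: E_pre)
lemma eqv_sh: "eqv m u v \<Longrightarrow> p + m \<le> n \<Longrightarrow> eqv n (sh p u) (sh p v)"
  by (auto simp: eqv_def intro: E_sh)
lemma eqv_ctx: "eqv m l r \<Longrightarrow> A = u @ sh p l @ v \<Longrightarrow> B = u @ sh p r @ v \<Longrightarrow> ok n A \<Longrightarrow> p + m \<le> fin n u \<Longrightarrow> eqv n A B"
  unfolding eqv_def using E_ctx by blast

lemma E_trans1 [trans]: "E n e u v \<Longrightarrow> E n 1 v w \<Longrightarrow> E n e u w"
  using E_trans[of n e u v 1 w] by simp
lemma E_trans2: "E n (-1) u v \<Longrightarrow> E n (-1) v w \<Longrightarrow> E n 1 u w"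
  using E_trans[of n "-1" u v "-1" w] by simp

section \<open>Local relations derived from the generating ones\<close>

lemmas crossing_sq = E_rel[OF rel_ss, of 2, simplified]
lemmas braid = E_rel[OF rel_braid, of 3, simplified]
lemmas snake1 = E_rel[OF rel_snake1, of 1, simplified]
lemmas snake2 = E_rel[OF rel_snake2, of 1, simplified]
lemmas cup_slide = E_rel[OF rel_cup, of 1, simplified]
lemmas cup_twist = E_rel[OF rel_scup, of 0, simplified]
lemmas crossing_dot = E_rel[OF rel_ys, of 2, simplified]
lemmas cap_dot = E_rel[OF rel_by, of 2, simplified]

lemma interchange: "E (gsrc f + r + gsrc g) ((-1) ^ (gpar f * gpar g))
     [(0, f), (gtgt f + r, g)] [(gsrc f + r, g), (0, f)]"
  using E_rel[OF rel_ic[of f r g]] rel_ok[OF rel_ic[of f r g]] by simp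

lemma interchange_sign: "e = (-1) ^ (gpar f * gpar g) \<Longrightarrow> E (gsrc f + r + gsrc g) e
     [(0, f), (gtgt f + r, g)] [(gsrc f + r, g), (0, f)]"
  using interchange by simp

text \<open>The cup slide of R3, rotated: a zigzag is inserted into the leftmost strand, the cup
  slide is applied to its cup, and the second zigzag is straightened. The sign of the first zigzag
  cancels against that of exchanging two odd caps.\<close>

lemma cap_slide: "E 3 1 [(0, GS), (1, GB)] [(1, GS), (0, GB)]"
proof -
  have "E 3 (-1) [(0, GS), (1, GB)] [(1, GBs), (0, GB), (0, GS), (1, GB)]"
    by (rule E_ctx[OF snake1[THEN E_sym], where u = "[]" and p = 0 and v = "[(0, GS), (1, GB)]"]) simp_all
  also have "E 3 1 \<dots> [(1, GBs), (2, GS), (0, GB), (1, GB)]"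
    by (rule E_ctx[OF interchange_sign[where f = GB and r = 0 and g = GS], where u = "[(1, GBs)]" and p = 0 and v = "[(1, GB)]"]) simp_all
  finally have 1: "E 3 (-1) [(0, GS), (1, GB)] [(1, GBs), (2, GS), (0, GB), (1, GB)]" .
  have "E 3 (-1) [(1, GBs), (2, GS), (0, GB), (1, GB)] [(1, GBs), (2, GS), (3, GB), (0, GB)]"
    by (rule E_ctx[OF interchange_sign[where f = GB and r = 1 and g = GB], where u = "[(1, GBs), (2, GS)]" and p = 0 and v = "[]"]) simp_all
  also have "E 3 1 \<dots> [(2, GBs), (1, GS), (3, GB), (0, GB)]"
    by (rule E_ctx[OF cup_slide, where u = "[]" and p = 1 and v = "[(3, GB), (0, GB)]"]) (simp_all add: numeral_eq_Suc)
  also have "E 3 1 \<dots> [(2, GBs), (3, GB), (1, GS), (0, GB)]"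
    by (rule E_ctx[OF interchange_sign[where f = GS and r = 0 and g = GB], where u = "[(2, GBs)]" and p = 1 and v = "[(0, GB)]"]) simp_all
  also have "E 3 1 \<dots> [(1, GS), (0, GB)]"
    by (rule E_ctx[OF snake2, where u = "[]" and p = 2 and v = "[(1, GS), (0, GB)]"]) simp_all
  finally show ?thesis using 1 E_trans2 by blast
qed

text \<open>Four signs cancel: two zigzags, one exchange of odd caps and one twisted cup. Thus a cap
  absorbs a crossing with sign 1 while a cup absorbs it with sign -1.\<close>

lemma cap_twist: "E 2 1 [(0, GS), (0, GB)] [(0, GB)]"
proof -
  have "E 2 (-1) [(0, GS), (0, GB)] [(1, GBs), (0, GB), (0, GS), (0, GB)]"
    by (rule E_ctx[OF snake1[THEN E_sym], where u = "[]" and p = 0 and v = "[(0, GS), (0, GB)]"]) simp_all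
  also have "E 2 1 \<dots> [(1, GBs), (2, GS), (0, GB), (0, GB)]"
    by (rule E_ctx[OF interchange_sign[where f = GB and r = 0 and g = GS], where u = "[(1, GBs)]" and p = 0 and v = "[(0, GB)]"]) simp_all
  finally have 1: "E 2 (-1) [(0, GS), (0, GB)] [(1, GBs), (2, GS), (0, GB), (0, GB)]" .
  have "E 2 (-1) [(1, GBs), (2, GS), (0, GB), (0, GB)] [(1, GBs), (2, GS), (2, GB), (0, GB)]"
    by (rule E_ctx[OF interchange_sign[where f = GB and r = 0 and g = GB], where u = "[(1, GBs), (2, GS)]" and p = 0 and v = "[]"]) simp_all
  also have "E 2 1 \<dots> [(2, GBs), (1, GS), (2, GB), (0, GB)]"
    by (rule E_ctx[OF cup_slide, where u = "[]" and p = 1 and v = "[(2, GB), (0, GB)]"]) (simp_all add: numeral_eq_Suc)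
  also have "E 2 1 \<dots> [(2, GBs), (2, GS), (1, GB), (0, GB)]"
    by (rule E_ctx[OF cap_slide, where u = "[(2, GBs)]" and p = 1 and v = "[(0, GB)]"]) (simp_all add: numeral_eq_Suc)
  finally have 2: "E 2 (-1) [(1, GBs), (2, GS), (0, GB), (0, GB)] [(2, GBs), (2, GS), (1, GB), (0, GB)]" .
  have 3: "E 2 (-1) [(2, GBs), (2, GS), (1, GB), (0, GB)] [(2, GBs), (1, GB), (0, GB)]"
    by (rule E_ctx[OF cup_twist, where u = "[]" and p = 2 and v = "[(1, GB), (0, GB)]"]) (simp_all add: numeral_eq_Suc)
  have 4: "E 2 (-1) [(2, GBs), (1, GB), (0, GB)] [(0, GB)]"
    by (rule E_ctx[OF snake1, where u = "[]" and p = 1 and v = "[(0, GB)]"]) (simp_all add: numeral_eq_Suc)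
  show ?thesis using E_trans[OF E_trans2[OF 1 2] E_trans2[OF 3 4]] by simp
qed

lemma dot_slide_right: "E 2 1 [(0, GS), (1, GY)] [(0, GY), (0, GS)]"
proof -
  have "E 2 1 [(0, GS), (1, GY)] [(0, GS), (0, GS), (0, GY), (0, GS)]"
    by (rule E_ctx[OF crossing_dot, where u = "[(0, GS)]" and p = 0 and v = "[]"]) simp_all
  also have "E 2 1 \<dots> [(0, GY), (0, GS)]"
    by (rule E_ctx[OF crossing_sq, where u = "[]" and p = 0 and v = "[(0, GY), (0, GS)]"]) simp_all
  finally show ?thesis .
qed

lemma dot_slide_left: "E 2 1 [(1, GY), (0, GS)] [(0, GS), (0, GY)]"
proof -
  have "E 2 1 [(1, GY), (0, GS)] [(0, GS), (0, GY), (0, GS), (0, GS)]"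
    by (rule E_ctx[OF crossing_dot, where u = "[]" and p = 0 and v = "[(0, GS)]"]) simp_all
  also have "E 2 1 \<dots> [(0, GS), (0, GY)]"
    by (rule E_ctx[OF crossing_sq, where u = "[(0, GS), (0, GY)]" and p = 0 and v = "[]"]) simp_all
  finally show ?thesis .
qed

text \<open>R4 moves dots along caps only. A zigzag on the dotted leg supplies a cap for the dot to
  pass, and after the heights of the two cups are exchanged the other zigzag is
  straightened.\<close>

lemma cup_dot: "eqv 0 [(0, GBs), (0, GY)] [(0, GBs), (1, GY)]"
proof -
  have "eqv 0 [(0, GBs), (0, GY)] [(0, GBs), (0, GY), (0, GBs), (1, GB)]"
    by (rule eqv_ctx[OF snake2[THEN E_sym, THEN eqvI], where u = "[(0, GBs), (0, GY)]" and p = 0 and v = "[]"]) simp_all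
  also have "eqv 0 \<dots> [(0, GBs), (0, GBs), (2, GY), (1, GB)]"
    by (rule eqv_ctx[OF interchange[of GBs 0 GY, THEN E_sym, THEN eqvI], where u = "[(0, GBs)]" and p = 0 and v = "[(1, GB)]"]) simp_all
  also have "eqv 0 \<dots> [(0, GBs), (0, GBs), (1, GY), (1, GB)]"
    by (rule eqv_ctx[OF cap_dot[THEN eqvI], where u = "[(0, GBs), (0, GBs)]" and p = 1 and v = "[]"]) simp_all
  also have "eqv 0 \<dots> [(0, GBs), (2, GBs), (1, GY), (1, GB)]"
    by (rule eqv_ctx[OF interchange[of GBs 0 GBs, THEN E_sym, THEN eqvI], where u = "[]" and p = 0 and v = "[(1, GY), (1, GB)]"]) simp_all
  also have "eqv 0 \<dots> [(0, GBs), (1, GY), (2, GBs), (1, GB)]"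
    by (rule eqv_ctx[OF interchange[of GY 0 GBs, THEN E_sym, THEN eqvI], where u = "[(0, GBs)]" and p = 1 and v = "[(1, GB)]"]) simp_all
  also have "eqv 0 \<dots> [(0, GBs), (1, GY)]"
    by (rule eqv_ctx[OF snake1[THEN eqvI], where u = "[(0, GBs), (1, GY)]" and p = 1 and v = "[]"]) simp_all
  finally show ?thesis .
qed

lemma E_pow: "E n 1 ((p, GY) # xs) (xs @ [(q, GY)]) \<Longrightarrow> E n 1 (replicate m (p, GY) @ xs) (xs @ replicate m (q, GY))"
proof (induction m)
  case 0
  then show ?case using E_ok[OF 0] by (auto intro!: E_refl)
next
  case (Suc m)
  have k: "p + 1 \<le> n" "ok n xs" "ok (fin n xs) [(q, GY)]" using E_ok[OF Suc(2)] by auto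
  have "E n 1 ([(p, GY)] @ replicate m (p, GY) @ xs) ([(p, GY)] @ xs @ replicate m (q, GY))"
    using Suc k by (intro E_pre[where m = n]) auto
  also have "E n 1 ([(p, GY)] @ xs @ replicate m (q, GY)) ((xs @ [(q, GY)]) @ replicate m (q, GY))"
  proof -
    have "ok j [(q, GY)] \<Longrightarrow> ok j (replicate m (q, GY))" for j by (induction m) auto
    then show ?thesis using E_app[OF Suc(2), of "replicate m (q, GY)"] k by simp
  qed
  finally show ?case by (simp add: replicate_app_Cons_same)
qed

section \<open>Commuting distant words\<close>

lemma word_comm1: "ok k w \<Longrightarrow> eqv (gsrc f + k) ((0, f) # sh (gtgt f) w) (sh (gsrc f) w @ [(0, f)])"
proof (induction w arbitrary: k)
  case Nil
  then show ?case by (auto intro: eqv_refl)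
next
  case (Cons l w)
  obtain r g where l: "l = (r, g)" by force
  obtain s where k: "k = r + gsrc g + s" using Cons.prems l le_Suc_ex by auto
  have w: "ok (r + gtgt g + s) w" using Cons.prems l k by (simp add: add.commute add.left_commute)
  have 1: "eqv (gsrc f + k) ((0, f) # sh (gtgt f) (l # w)) ([(gsrc f + r, g)] @ ((0, f) # sh (gtgt f) w))"
    by (rule eqv_ctx[OF interchange[of f r g, THEN eqvI], where u = "[]" and p = 0 and v = "sh (gtgt f) w"])
      (use l k w in \<open>auto intro!: ok_sh[OF w]\<close>)
  also have "eqv (gsrc f + k) \<dots> ([(gsrc f + r, g)] @ (sh (gsrc f) w @ [(0, f)]))"
    by (rule eqv_pre[OF Cons.IH[OF w]]) (use k in auto)
  finally show ?case using l by simp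
qed

lemma word_comm: "ok k u \<Longrightarrow> ok l v \<Longrightarrow> eqv (k + l) (u @ sh (fin k u) v) (sh k v @ u)"
proof (induction u arbitrary: k)
  case Nil
  then show ?case by (auto intro!: eqv_refl ok_sh)
next
  case (Cons x u)
  obtain p f where x: "x = (p, f)" by force
  obtain s where k: "k = p + gsrc f + s" using Cons.prems x le_Suc_ex by auto
  have u: "ok (p + gtgt f + s) u" and fu: "fin k (x # u) = fin (p + gtgt f + s) u"
    using Cons.prems x k by (simp_all add: add.commute add.left_commute)
  have "eqv (k + l) ([x] @ (u @ sh (fin k (x # u)) v)) ([x] @ (sh (p + gtgt f + s) v @ u))"
    unfolding fu using x k by (intro eqv_pre[OF Cons.IH[OF u Cons.prems(2)]]) auto
  also have "eqv (k + l) \<dots> ((sh k v @ [x]) @ u)"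
  proof -
    have "ok (s + l) (sh s v)" using Cons.prems(2) by (rule ok_sh) simp
    then have "eqv (gsrc f + (s + l)) ((0, f) # sh (gtgt f) (sh s v)) (sh (gsrc f) (sh s v) @ [(0, f)])"
      by (rule word_comm1)
    then have "eqv (k + l) (sh p ((0, f) # sh (gtgt f) (sh s v))) (sh p (sh (gsrc f) (sh s v) @ [(0, f)]))"
      using k by (intro eqv_sh) auto
    then have *: "eqv (k + l) (x # sh (p + gtgt f + s) v) (sh k v @ [x])"
      using x k by (simp add: add.assoc)
    have "fin (k + l) (x # sh (p + gtgt f + s) v) = p + gtgt f + s + fin l v"
      using x k fin_sh[OF Cons.prems(2), of "p + gtgt f + s" "p + gtgt f + s + l"] by (simp add: algebra_simps)
    moreover have "ok (p + gtgt f + s + fin l v) u" using ok_sh[OF u, of 0] by simp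
    ultimately show ?thesis using eqv_app[OF *, of u] by simp
  qed
  finally show ?case by simp
qed

text \<open>This is the form in which the interchange law is used below: \<open>u\<close> acts on
  \<open>k\<close> strands starting at position \<open>p\<close>, and \<open>v\<close> on the
  \<open>l\<close> strands to their right. Below \<open>u\<close> the position of \<open>v\<close>
  is \<open>p + k\<close>, above it \<open>p + fin k u\<close>.\<close>

lemma comm_ctx:
  assumes "ok k u" "ok l v" "A = x @ sh p u @ sh (p + fin k u) v @ y" "B = x @ sh (p + k) v @ sh p u @ y"
    "ok n A" "p + (k + l) \<le> fin n x"
  shows "eqv n A B"
proof (rule eqv_ctx[OF word_comm[OF assms(1,2)], where u = x and p = p and v = y])
  show "A = x @ sh p (u @ sh (fin k u) v) @ y" "B = x @ sh p (sh k v @ u) @ y"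
    unfolding assms(3,4) by simp_all
qed (rule assms)+

section \<open>Normal forms\<close>

definition smap :: "nat list \<Rightarrow> pword" where "smap xs = map (\<lambda>i. (i, GS)) xs"

text \<open>The crossings at \<open>n - 1\<close>, ..., \<open>j\<close>, read upwards, carry the
  strand at position \<open>n\<close> to position \<open>j\<close> and shift the strands in between
  by one place to the right.\<close>

definition mv :: "nat \<Rightarrow> nat \<Rightarrow> pword" where "mv j n = smap (rev [j..<n])"

text \<open>A new cup whose right leg is the last strand, whose left leg is moved to position \<open>j\<close>, and which
  carries \<open>m\<close> dots.  Composites of these are the normal forms in the Hom spaces with source 0.\<close>

definition U :: "nat \<Rightarrow> nat \<Rightarrow> nat \<Rightarrow> pword" where
  "U n j m = (n, GBs) # replicate m (Suc n, GY) @ mv j n"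

lemma ok_smap: "\<forall>i\<in>set xs. i + 2 \<le> k \<Longrightarrow> ok k (smap xs) \<and> fin k (smap xs) = k"
proof (induction xs)
  case (Cons a xs)
  then obtain k' where "k = Suc (Suc k')" using le_Suc_ex[of 2 k] by auto
  then show ?case using Cons by (simp add: smap_def)
qed (simp add: smap_def)

lemma ok_mv [simp]: "b < k \<Longrightarrow> ok k (mv a b)" "b < k \<Longrightarrow> fin k (mv a b) = k"
  using ok_smap[of "rev [a..<b]" k] by (auto simp: mv_def)

lemma ok_dots [simp]: "p < k \<Longrightarrow> ok k (replicate m (p, GY))" "p < k \<Longrightarrow> fin k (replicate m (p, GY)) = k"
  by (induction m) auto

lemma mv_self [simp]: "mv n n = []" by (simp add: mv_def smap_def)

lemma mv_split: "a \<le> b \<Longrightarrow> b \<le> c \<Longrightarrow> mv a c = mv b c @ mv a b"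
proof -
  assume "a \<le> b" "b \<le> c"
  then have "[a..<c] = [a..<b] @ [b..<c]" using upt_add_eq_append[of a b "c - b"] by simp
  then show ?thesis by (simp add: mv_def smap_def)
qed

lemma mv_snoc: "j < n \<Longrightarrow> mv j n = mv (Suc j) n @ [(j, GS)]"
  using mv_split[of j "Suc j" n] by (simp add: mv_def smap_def)

lemma sh_mv [simp]: "sh p (mv a b) = mv (p + a) (p + b)"
proof -
  have "map ((+) p) (rev [a..<b]) = rev [p + a..<p + b]"
    by (induction b) (auto simp: not_le)
  then show ?thesis
    unfolding mv_def smap_def sh_def by (metis (mono_tags, lifting) map_eq_conv map_map o_apply case_prod_conv)
qed

lemma sh_U [simp]: "sh p (U n j m) = U (p + n) (p + j) m"
  by (simp add: U_def)

lemma ok_U [simp]: "n \<le> k \<Longrightarrow> ok k (U n j m)" "n \<le> k \<Longrightarrow> fin k (U n j m) = Suc (Suc k)"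
  by (auto simp: U_def)

lemma U_split: "j \<le> i \<Longrightarrow> i \<le> n \<Longrightarrow> U n j m = U n i m @ mv j i"
  by (simp add: U_def mv_split[of j i n])

section \<open>Crossings and dots above the last cup\<close>

lemma U_s_less:
  assumes "Suc p < j" "j \<le> n"
  shows "eqv n (U n j m @ [(p, GS)]) ((p, GS) # U n j m)"
proof -
  have "eqv n ((p, GS) # U n j m) (U n j m @ [(p, GS)])"
    by (rule comm_ctx[where u = "[(0, GS)]" and k = 2 and v = "U (n - p - 2) (j - p - 2) m" and l = "n - p - 2"
          and x = "[]" and y = "[]" and p = p]) (use assms in \<open>auto simp: Suc_diff_Suc numeral_2_eq_2\<close>)
  then show ?thesis by (rule eqv_sym)
qed

lemma U_s_pred: "0 < j \<Longrightarrow> j \<le> n \<Longrightarrow> U n j m @ [(j - 1, GS)] = U n (j - 1) m"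
  using mv_snoc[of "j - 1" n] by (simp add: U_def)

lemma U_s_same:
  assumes "j < n"
  shows "eqv n (U n j m @ [(j, GS)]) (U n (Suc j) m)"
  by (rule eqv_ctx[OF crossing_sq[THEN eqvI], where u = "U n (Suc j) m" and p = j and v = "[]"])
    (use assms in \<open>auto simp: U_def mv_snoc[of j n]\<close>)

text \<open>The braid relation pushes the crossing through the moving left leg. Its index drops by
  one because the leg at position \<open>j\<close>, to its left, does not exist below the
  cup.\<close>

lemma U_s_greater:
  assumes "j < p" "p < n"
  shows "eqv n (U n j m @ [(p, GS)]) ((p - 1, GS) # U n j m)"
proof -
  obtain q where q: "p = Suc q" using assms by (cases p) auto
  have U: "U n j m = U n (Suc p) m @ [(p, GS), (q, GS)] @ mv j q"
    using assms q mv_snoc[of p n] mv_snoc[of q n] mv_split[of j q n] by (simp add: U_def)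
  have "eqv n (U n j m @ [(p, GS)]) (U n (Suc p) m @ [(p, GS), (q, GS), (p, GS)] @ mv j q)"
    by (rule comm_ctx[where u = "mv j q" and k = p and v = "[(0, GS)]" and l = 2
          and x = "U n (Suc p) m @ [(p, GS), (q, GS)]" and y = "[]" and p = 0]) (use assms q U in auto)
  also have "eqv n \<dots> (U n (Suc p) m @ [(q, GS), (p, GS), (q, GS)] @ mv j q)"
    by (rule eqv_ctx[OF braid[THEN E_sym, THEN eqvI], where u = "U n (Suc p) m" and p = q and v = "mv j q"])
      (use assms q in auto)
  also have "eqv n \<dots> ([(q, GS)] @ U n (Suc p) m @ [(p, GS), (q, GS)] @ mv j q)"
    by (rule eqv_sym, rule comm_ctx[where u = "[(0, GS)]" and k = 2 and v = "U (n - p - 1) 0 m" and l = "n - p - 1"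
          and x = "[]" and y = "[(p, GS), (q, GS)] @ mv j q" and p = q])
      (use assms q in \<open>auto simp: Suc_diff_Suc numeral_2_eq_2\<close>)
  finally show ?thesis using U q by simp
qed

lemma cup_dots: "eqv 0 ((0, GBs) # replicate m (0, GY)) ((0, GBs) # replicate m (1, GY))"
proof (induction m)
  case (Suc m)
  have "eqv 0 ((0, GBs) # (0, GY) # replicate m (0, GY)) ((0, GBs) # (1, GY) # replicate m (0, GY))"
    by (rule eqv_ctx[OF cup_dot, where u = "[]" and p = 0 and v = "replicate m (0, GY)"]) auto
  also have "eqv 0 \<dots> ((0, GBs) # replicate m (0, GY) @ [(1, GY)])"
    by (rule eqv_sym, rule comm_ctx[where u = "replicate m (0, GY)" and k = 1 and v = "[(0, GY)]" and l = 1
          and x = "[(0, GBs)]" and y = "[]" and p = 0]) auto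
  also have "eqv 0 \<dots> ((0, GBs) # replicate m (1, GY) @ [(1, GY)])"
    using eqv_app[OF Suc, of "[(1, GY)]"] by simp
  finally show ?case by (simp flip: replicate_append_same)
qed (auto intro: eqv_refl)

text \<open>Both strands of the crossing belong to the same cup: the dots slide through it, the cup
  absorbs it up to sign, and the dots return to the right leg.\<close>

lemma U_s_last0: "eqv 0 (U 0 0 m @ [(0, GS)]) (U 0 0 m)"
proof -
  have "eqv 0 (U 0 0 m @ [(0, GS)]) ((0, GBs) # (0, GS) # replicate m (0, GY))"
    by (rule eqv_ctx[OF E_pow[of 2 1 "[(0, GS)]" 0 m, OF _, THEN eqvI], where u = "[(0, GBs)]" and p = 0 and v = "[]"])
      (use dot_slide_left in \<open>auto simp: U_def\<close>)
  also have "eqv 0 \<dots> ((0, GBs) # replicate m (0, GY))"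
    by (rule eqv_ctx[OF cup_twist[THEN eqvI], where u = "[]" and p = 0 and v = "replicate m (0, GY)"]) auto
  also have "eqv 0 \<dots> (U 0 0 m)" using cup_dots by (simp add: U_def)
  finally show ?thesis .
qed

lemma U_s_last: "eqv n (U n n m @ [(n, GS)]) (U n n m)"
  using eqv_sh[OF U_s_last0[of m], of n n] by simp

text \<open>Here and in \<open>nest2\<close> a dotted cup is pulled across one strand, from the
  right and from the left respectively. Both results are the cup created directly at its final
  place, which makes the two ways comparable.\<close>

lemma nest1: "eqv 2 ((2, GBs) # replicate m (3, GY) @ [(1, GS), (2, GS)]) ((1, GBs) # replicate m (2, GY))"
proof -
  have "eqv 2 ((2, GBs) # replicate m (3, GY) @ [(1, GS), (2, GS)]) ((2, GBs) # (1, GS) # replicate m (3, GY) @ [(2, GS)])"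
    by (rule eqv_sym, rule comm_ctx[where u = "[(0, GS)]" and k = 2 and v = "replicate m (0, GY)" and l = 1
          and x = "[(2, GBs)]" and y = "[(2, GS)]" and p = 1]) auto
  also have "eqv 2 \<dots> ((2, GBs) # (1, GS) # (2, GS) # replicate m (2, GY))"
    by (rule eqv_ctx[OF E_pow[of 2 1 "[(0, GS)]" 0 m, OF _, THEN eqvI], where u = "[(2, GBs), (1, GS)]" and p = 2 and v = "[]"])
      (use dot_slide_left in auto)
  also have "eqv 2 \<dots> ((1, GBs) # (2, GS) # (2, GS) # replicate m (2, GY))"
    by (rule eqv_ctx[OF cup_slide[THEN E_sym, THEN eqvI], where u = "[]" and p = 1 and v = "(2, GS) # replicate m (2, GY)"])
      (auto simp: numeral_eq_Suc)
  also have "eqv 2 \<dots> ((1, GBs) # replicate m (2, GY))"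
    by (rule eqv_ctx[OF crossing_sq[THEN eqvI], where u = "[(1, GBs)]" and p = 2 and v = "replicate m (2, GY)"]) auto
  finally show ?thesis .
qed

lemma nest2: "eqv 1 ((0, GBs) # replicate m (1, GY) @ [(1, GS), (0, GS)]) ((1, GBs) # replicate m (2, GY))"
proof -
  have "eqv 1 ((0, GBs) # replicate m (1, GY) @ [(1, GS), (0, GS)]) ((0, GBs) # (1, GS) # replicate m (2, GY) @ [(0, GS)])"
    by (rule eqv_ctx[OF E_pow[of 2 0 "[(0, GS)]" 1 m, OF _, THEN eqvI], where u = "[(0, GBs)]" and p = 1 and v = "[(0, GS)]"])
      (use dot_slide_right[THEN E_sym] in \<open>auto simp: numeral_eq_Suc\<close>)
  also have "eqv 1 \<dots> ((0, GBs) # (1, GS) # (0, GS) # replicate m (2, GY))"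
    by (rule eqv_sym, rule comm_ctx[where u = "[(0, GS)]" and k = 2 and v = "replicate m (0, GY)" and l = 1
          and x = "[(0, GBs), (1, GS)]" and y = "[]" and p = 0]) auto
  also have "eqv 1 \<dots> ((1, GBs) # (0, GS) # (0, GS) # replicate m (2, GY))"
    by (rule eqv_ctx[OF cup_slide[THEN eqvI], where u = "[]" and p = 0 and v = "(0, GS) # replicate m (2, GY)"])
      (auto simp: numeral_eq_Suc)
  also have "eqv 1 \<dots> ((1, GBs) # replicate m (2, GY))"
    by (rule eqv_ctx[OF crossing_sq[THEN eqvI], where u = "[(1, GBs)]" and p = 0 and v = "replicate m (2, GY)"]) auto
  finally show ?thesis .
qed

text \<open>Crossing the right legs of two interlaced cups nests them. The cup that now ends at the
  last strand was created first, so the creation order has to be reversed to restore the normal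
  form.\<close>

lemma U_exchange0: "eqv 0 (U 0 0 m' @ U 2 1 m @ [(2, GS)]) (U 0 0 m @ U 2 0 m')"
proof -
  have mv: "mv 1 2 = [(1, GS)]" "mv 0 2 = [(1, GS), (0, GS)]"
    by (auto simp: mv_def smap_def numeral_eq_Suc upt_rec)
  have "eqv 0 (U 0 0 m' @ U 2 1 m @ [(2, GS)]) (U 0 0 m' @ (1, GBs) # replicate m (2, GY))"
    by (rule eqv_ctx[OF nest1[of m], where u = "U 0 0 m'" and p = 0 and v = "[]"])
      (auto simp: U_def[of 2] mv[simplified])
  also have "eqv 0 \<dots> (U 0 0 m' @ U 0 0 m @ [(1, GS), (0, GS)])"
    by (rule eqv_sym, rule eqv_ctx[OF nest2[of m], where u = "U 0 0 m'" and p = 0 and v = "[]"])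
      (auto simp: U_def[of 0] numeral_eq_Suc)
  also have "eqv 0 \<dots> (U 0 0 m @ U 2 0 m')"
    by (rule eqv_sym, rule comm_ctx[where u = "U 0 0 m" and k = 0 and v = "U 0 0 m'" and l = 0
          and x = "[]" and y = "[(1, GS), (0, GS)]" and p = 0])
      (auto simp: U_def mv mv[unfolded numeral_2_eq_2] numeral_eq_Suc)
  finally show ?thesis .
qed

text \<open>The point of the right-hand side is that all remaining crossings have index at most
  \<open>l\<close>. None of them meets the last strand, so the crossing that was hard to reduce has
  been traded for easy ones.\<close>

lemma U_exchange:
  assumes "j' \<le> l" "j \<le> Suc l"
  shows "eqv l (U l j' m' @ U (l + 2) j m @ [(l + 2, GS)])
    (U l l m @ U (l + 2) l m' @ mv j' l @ mv j (Suc l))"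
proof -
  have 1: "U (l + 2) j m = U (l + 2) (Suc l) m @ mv j (Suc l)" "U l j' m' = U l l m' @ mv j' l"
    by (rule U_split; use assms in simp)+
  have "eqv l (U l j' m' @ U (l + 2) j m @ [(l + 2, GS)])
      (U l l m' @ mv j' l @ U (l + 2) (Suc l) m @ [(l + 2, GS)] @ mv j (Suc l))"
    by (rule comm_ctx[where u = "mv j (Suc l)" and k = "l + 2" and v = "[(0, GS)]" and l = 2
          and x = "U l l m' @ mv j' l @ U (l + 2) (Suc l) m" and y = "[]" and p = 0]) (auto simp: 1[simplified])
  also have "eqv l \<dots> (U l l m' @ (U (l + 2) (Suc l) m @ [(l + 2, GS)]) @ mv j' l @ mv j (Suc l))"
    by (rule comm_ctx[where u = "mv j' l" and k = "Suc l" and v = "U 1 0 m @ [(1, GS)]" and l = 1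
          and x = "U l l m'" and y = "mv j (Suc l)" and p = 0]) auto
  also have "eqv l \<dots> (U l l m @ U (l + 2) l m' @ mv j' l @ mv j (Suc l))"
    by (rule eqv_ctx[OF U_exchange0[of m' m], where u = "[]" and p = l and v = "mv j' l @ mv j (Suc l)"]) auto
  finally show ?thesis .
qed

lemma U_y_last:
  "eqv n (U n j m @ [(Suc n, GY)]) (U n j (Suc m))"
  by (rule comm_ctx[where u = "mv j n" and k = "Suc n" and v = "[(0, GY)]" and l = 1
          and x = "(n, GBs) # replicate m (Suc n, GY)" and y = "[]" and p = 0])
     (auto simp: U_def replicate_app_Cons_same)

lemma mv_y: "j \<le> n \<Longrightarrow> eqv (Suc n) (mv j n @ [(j, GY)]) ((n, GY) # mv j n)"
proof (induction j rule: inc_induct)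
  case base
  then show ?case by (auto intro: eqv_refl)
next
  case (step j)
  have "eqv (Suc n) (mv j n @ [(j, GY)]) (mv (Suc j) n @ [(Suc j, GY), (j, GS)])"
    by (rule eqv_ctx[OF dot_slide_left[THEN E_sym, THEN eqvI], where u = "mv (Suc j) n" and p = j and v = "[]"])
      (use step in \<open>auto simp: mv_snoc[of j n]\<close>)
  also have "eqv (Suc n) \<dots> (((n, GY) # mv (Suc j) n) @ [(j, GS)])"
    using eqv_app[OF step.IH, of "[(j, GS)]"] step by simp
  finally show ?case using mv_snoc[of j n] step by simp
qed

text \<open>A dot on the left leg travels down along the leg to the cup and crosses over to the
  right leg, where the dots of a normal form are collected.\<close>

lemma U_y_left:
  assumes "j \<le> n"
  shows "eqv n (U n j m @ [(j, GY)]) (U n j (Suc m))"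
proof -
  have "eqv n (U n j m @ [(j, GY)]) ((n, GBs) # replicate m (Suc n, GY) @ (n, GY) # mv j n)"
    by (rule eqv_ctx[OF mv_y[OF assms], where u = "(n, GBs) # replicate m (Suc n, GY)" and p = 0 and v = "[]"])
      (use assms in \<open>auto simp: U_def\<close>)
  also have "eqv n \<dots> ((n, GBs) # (n, GY) # replicate m (Suc n, GY) @ mv j n)"
    by (rule eqv_sym, rule comm_ctx[where u = "[(0, GY)]" and k = 1 and v = "replicate m (0, GY)" and l = 1
          and x = "[(n, GBs)]" and y = "mv j n" and p = n]) auto
  also have "eqv n \<dots> (U n j (Suc m))"
    by (rule eqv_ctx[OF cup_dot, where u = "[]" and p = n and v = "replicate m (Suc n, GY) @ mv j n"]) (auto simp: U_def)
  finally show ?thesis .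
qed

lemma U_y_less:
  assumes "p < j" "j \<le> n"
  shows "eqv n (U n j m @ [(p, GY)]) ((p, GY) # U n j m)"
proof -
  have "eqv n ((p, GY) # U n j m) (U n j m @ [(p, GY)])"
    by (rule comm_ctx[where u = "[(0, GY)]" and k = 1 and v = "U (n - p - 1) (j - p - 1) m" and l = "n - p - 1"
          and x = "[]" and y = "[]" and p = p]) (use assms in auto)
  then show ?thesis by (rule eqv_sym)
qed

lemma U_y_greater:
  assumes "j < p" "p \<le> n"
  shows "eqv n (U n j m @ [(p, GY)]) ((p - 1, GY) # U n j m)"
proof -
  obtain q where q: "p = Suc q" using assms by (cases p) auto
  have U: "U n j m = U n p m @ [(q, GS)] @ mv j q"
    using assms q mv_snoc[of q n] mv_split[of j q n] by (simp add: U_def)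
  have "eqv n (U n j m @ [(p, GY)]) (U n p m @ [(q, GS), (p, GY)] @ mv j q)"
    by (rule comm_ctx[where u = "mv j q" and k = p and v = "[(0, GY)]" and l = 1
          and x = "U n p m @ [(q, GS)]" and y = "[]" and p = 0]) (use assms q U in auto)
  also have "eqv n \<dots> (U n p m @ [(q, GY), (q, GS)] @ mv j q)"
    by (rule eqv_ctx[OF dot_slide_right[THEN eqvI], where u = "U n p m" and p = q and v = "mv j q"])
      (use assms q in auto)
  also have "eqv n \<dots> ([(q, GY)] @ U n p m @ [(q, GS)] @ mv j q)"
    by (rule eqv_sym, rule comm_ctx[where u = "[(0, GY)]" and k = 1 and v = "U (n - p) 0 m" and l = "n - p"
          and x = "[]" and y = "[(q, GS)] @ mv j q" and p = q]) (use assms q in auto)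
  finally show ?thesis using U q by simp
qed

section \<open>Moving cups and caps to the right, and closing strings\<close>

lemma cup_right: "p < n \<Longrightarrow> eqv n [(p, GBs)] [(Suc p, GBs), (p, GS), (Suc p, GS)]"
proof -
  have "eqv 1 [(0, GBs)] [(0, GBs), (1, GS), (1, GS)]"
    by (rule eqv_ctx[OF crossing_sq[THEN E_sym, THEN eqvI], where u = "[(0, GBs)]" and p = 1 and v = "[]"]) auto
  also have "eqv 1 \<dots> [(1, GBs), (0, GS), (1, GS)]"
    by (rule eqv_ctx[OF cup_slide[THEN eqvI], where u = "[]" and p = 0 and v = "[(1, GS)]"]) (auto simp: numeral_eq_Suc)
  finally show "p < n \<Longrightarrow> ?thesis" using eqv_sh[of 1 _ _ p n] by fastforce
qed

text \<open>Together with \<open>cup_right\<close>, this reduces the treatment of arbitrary cups and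
  caps to those at the right end, at the cost of two crossings per place.\<close>

lemma cap_right: "p + 3 \<le> n \<Longrightarrow> eqv n [(p, GB)] [(Suc p, GS), (p, GS), (Suc p, GB)]"
proof -
  have "eqv 3 [(0, GB)] [(1, GS), (1, GS), (0, GB)]"
    by (rule eqv_ctx[OF crossing_sq[THEN E_sym, THEN eqvI], where u = "[]" and p = 1 and v = "[(0, GB)]"]) auto
  also have "eqv 3 \<dots> [(1, GS), (0, GS), (1, GB)]"
    by (rule eqv_ctx[OF cap_slide[THEN E_sym, THEN eqvI], where u = "[(1, GS)]" and p = 0 and v = "[]"]) (auto simp: numeral_eq_Suc)
  finally show "p + 3 \<le> n \<Longrightarrow> ?thesis" using eqv_sh[of 3 _ _ p n] by fastforce
qed

lemma dots_commute: "E 2 1 ((1, GY) # replicate m (0, GY)) (replicate m (0, GY) @ [(1, GY)])"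
proof -
  have "E 2 1 [(0, GY), (1, GY)] [(1, GY), (0, GY)]"
    using interchange_sign[of 1 GY GY 0] by (simp add: numeral_eq_Suc)
  then show ?thesis using E_pow[of 2 0 "[(1, GY)]" 0 m] by (auto intro: E_sym)
qed

lemma cap_dots: "E 2 1 (replicate m (1, GY) @ [(0, GB)]) (replicate m (0, GY) @ [(0, GB)])"
proof (induction m)
  case 0
  then show ?case by (auto intro: E_refl)
next
  case (Suc m)
  have "E 2 1 (replicate (Suc m) (1, GY) @ [(0, GB)]) ([(1, GY)] @ replicate m (0, GY) @ [(0, GB)])"
    using E_pre[OF Suc, of 2 "[(1, GY)]"] by simp
  also have "E 2 1 \<dots> (replicate m (0, GY) @ [(1, GY), (0, GB)])"
    using E_app[OF dots_commute[of m], of "[(0, GB)]"] by simp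
  also have "E 2 1 \<dots> (replicate m (0, GY) @ [(0, GY), (0, GB)])"
    using E_pre[OF cap_dot, of 2 "replicate m (0, GY)"] by simp
  finally show ?case by (simp add: replicate_app_Cons_same)
qed

text \<open>A crossing is created below the cap with sign 1, the dots slide through it, and the cup
  absorbs it with sign -1. So a loop, with any number of dots, equals its own negative.\<close>

lemma loop_null: "E 0 (-1) (U 0 0 m @ [(0, GB)]) (U 0 0 m @ [(0, GB)])"
proof -
  have "E 0 1 (U 0 0 m @ [(0, GB)]) ((0, GBs) # replicate m (1, GY) @ [(0, GS), (0, GB)])"
    by (rule E_ctx[OF cap_twist[THEN E_sym], where u = "U 0 0 m" and p = 0 and v = "[]"]) (auto simp: U_def)
  also have "E 0 1 \<dots> ((0, GBs) # (0, GS) # replicate m (0, GY) @ [(0, GB)])"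
    by (rule E_ctx[OF E_pow[of 2 1 "[(0, GS)]" 0 m, OF _], where u = "[(0, GBs)]" and p = 0 and v = "[(0, GB)]"])
      (use dot_slide_left in auto)
  finally have 1: "E 0 1 (U 0 0 m @ [(0, GB)]) ((0, GBs) # (0, GS) # replicate m (0, GY) @ [(0, GB)])" .
  have "E 0 (-1) ((0, GBs) # (0, GS) # replicate m (0, GY) @ [(0, GB)]) ((0, GBs) # replicate m (0, GY) @ [(0, GB)])"
    by (rule E_ctx[OF cup_twist, where u = "[]" and p = 0 and v = "replicate m (0, GY) @ [(0, GB)]"]) auto
  also have "E 0 1 \<dots> (U 0 0 m @ [(0, GB)])"
    by (rule E_ctx[OF cap_dots[THEN E_sym], where u = "[(0, GBs)]" and p = 0 and v = "[]"]) (auto simp: U_def)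
  finally show ?thesis using E_trans[OF 1] by fastforce
qed

text \<open>The cap joins the right leg of the cup to the strand that the left leg has crossed.
  Removing the crossing straightens the string, and the dots of the cup end up on it.\<close>

lemma U_cap_snake: "eqv 1 (U 1 0 m @ [(1, GB)]) (replicate m (0, GY))"
proof -
  have mv: "mv 0 (Suc 0) = [(0, GS)]" by (simp add: mv_def smap_def)
  have "eqv 1 (U 1 0 m @ [(1, GB)]) ((1, GBs) # replicate m (2, GY) @ [(1, GS), (0, GB)])"
    by (rule eqv_ctx[OF cap_slide[THEN eqvI], where u = "(1, GBs) # replicate m (2, GY)" and p = 0 and v = "[]"])
      (auto simp: U_def mv numeral_eq_Suc)
  also have "eqv 1 \<dots> ((1, GBs) # (1, GS) # replicate m (1, GY) @ [(0, GB)])"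
    by (rule eqv_ctx[OF E_pow[of 2 1 "[(0, GS)]" 0 m, OF _, THEN eqvI], where u = "[(1, GBs)]" and p = 1 and v = "[(0, GB)]"])
      (use dot_slide_left in \<open>auto simp: numeral_eq_Suc\<close>)
  also have "eqv 1 \<dots> ((1, GBs) # replicate m (1, GY) @ [(0, GB)])"
    by (rule eqv_ctx[OF cup_twist[THEN eqvI], where u = "[]" and p = 1 and v = "replicate m (1, GY) @ [(0, GB)]"]) auto
  also have "eqv 1 \<dots> ((1, GBs) # replicate m (0, GY) @ [(0, GB)])"
    by (rule eqv_ctx[OF cap_dots[THEN eqvI], where u = "[(1, GBs)]" and p = 0 and v = "[]"]) auto
  also have "eqv 1 \<dots> (replicate m (0, GY) @ [(1, GBs), (0, GB)])"
    by (rule eqv_sym, rule comm_ctx[where u = "replicate m (0, GY)" and k = 1 and v = "[(0, GBs)]" and l = 0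
          and x = "[]" and y = "[(0, GB)]" and p = 0]) auto
  also have "eqv 1 \<dots> (replicate m (0, GY))"
    by (rule eqv_ctx[OF snake1[THEN eqvI], where u = "replicate m (0, GY)" and p = 0 and v = "[]"]) auto
  finally show ?thesis .
qed

lemma U_cap:
  assumes "j < l"
  shows "eqv l (U l j m @ [(l, GB)]) (replicate m (l - 1, GY) @ mv j (l - 1))"
proof -
  have "eqv l (U l j m @ [(l, GB)]) (U l (l - 1) m @ [(l, GB)] @ mv j (l - 1))"
    by (rule comm_ctx[where u = "mv j (l - 1)" and k = l and v = "[(0, GB)]" and l = 2
          and x = "U l (l - 1) m" and y = "[]" and p = 0]) (use assms U_split[of j "l - 1" l] in auto)
  also have "eqv l \<dots> (replicate m (l - 1, GY) @ mv j (l - 1))"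
    by (rule eqv_ctx[OF U_cap_snake, where u = "[]" and p = "l - 1" and v = "mv j (l - 1)"]) (use assms in auto)
  finally show ?thesis .
qed

section \<open>Reducing every diagram with source 0\<close>

definition nul :: "pword \<Rightarrow> bool" where "nul x \<longleftrightarrow> E 0 (-1) x x"

text \<open>The head of the list encodes the cup that ends at the last strand.\<close>

fun T :: "(nat \<times> nat) list \<Rightarrow> pword" where
  "T [] = []"
| "T ((j, m) # c) = T c @ U (2 * length c) j m"

text \<open>With \<open>r\<close> earlier cups the left leg may take any of \<open>2 * r + 1\<close>
  positions. This gives the product of the odd numbers as the number of undotted codes, which is the
  number of perfect matchings.\<close>

fun vcode :: "(nat \<times> nat) list \<Rightarrow> bool" where
  "vcode [] = True"
| "vcode ((j, m) # c) = (j \<le> 2 * length c \<and> vcode c)"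

definition red :: "pword \<Rightarrow> bool" where
  "red x \<longleftrightarrow> nul x \<or> (\<exists>c. vcode c \<and> eqv 0 x (T c))"

lemma ok_T [simp]: "ok 0 (T c)" "fin 0 (T c) = 2 * length c"
proof -
  have "ok 0 (T c) \<and> fin 0 (T c) = 2 * length c" by (induction c rule: T.induct) auto
  then show "ok 0 (T c)" "fin 0 (T c) = 2 * length c" by auto
qed

lemma nul_eqv: "nul x \<Longrightarrow> eqv 0 y x \<Longrightarrow> nul y"
proof -
  assume n: "nul x" and "eqv 0 y x"
  then obtain e where e: "E 0 e y x" by (auto simp: eqv_def)
  then have "E 0 (e * (-1) * e) y y" using E_trans[OF E_trans[OF e n[unfolded nul_def]] E_sym[OF e]] by simp
  moreover have "e * (-1) * e = -1" using E_ok[OF e] by auto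
  ultimately show ?thesis by (simp add: nul_def)
qed

lemma nul_app: "nul x \<Longrightarrow> ok (fin 0 x) w \<Longrightarrow> nul (x @ w)"
  unfolding nul_def by (rule E_app)

lemma red_ok: "red x \<Longrightarrow> ok 0 x"
  by (auto simp: red_def nul_def dest: E_ok eqv_ok)

lemma red_eqv: "red x \<Longrightarrow> eqv 0 y x \<Longrightarrow> red y"
  unfolding red_def using nul_eqv eqv_trans by blast

lemma red_eqv_ctx: "red (u @ r) \<Longrightarrow> eqv n l r \<Longrightarrow> ok 0 u \<Longrightarrow> fin 0 u = n \<Longrightarrow> red (u @ l)"
  using red_eqv eqv_pre by blast

lemma red_T: "vcode c \<Longrightarrow> red (T c)"
  unfolding red_def using eqv_refl by auto

text \<open>Reducibility of \<open>x @ w\<close> has to be checked only when \<open>x\<close> is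
  itself a normal form, since a vanishing \<open>x\<close> stays vanishing under any
  continuation.\<close>

lemma red_lift:
  assumes "red x" "ok (fin 0 x) w" "\<And>c. vcode c \<Longrightarrow> 2 * length c = fin 0 x \<Longrightarrow> red (T c @ w)"
  shows "red (x @ w)"
proof (cases "nul x")
  case True
  then show ?thesis using nul_app assms(2) by (auto simp: red_def)
next
  case False
  then obtain c where c: "vcode c" "eqv 0 x (T c)" using assms by (auto simp: red_def)
  then have "2 * length c = fin 0 x" using eqv_ok by fastforce
  then show ?thesis using c assms eqv_app red_eqv by blast
qed

lemma red_U: "red x \<Longrightarrow> fin 0 x = n \<Longrightarrow> j \<le> n \<Longrightarrow> red (x @ U n j m)"
proof (rule red_lift)
  fix c assume "fin 0 x = n" "j \<le> n" "vcode c" "2 * length c = fin 0 x"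
  then show "red (T c @ U n j m)" using red_T[of "(j, m) # c"] by simp
qed auto

definition closed :: "nat \<Rightarrow> bool" where
  "closed r \<longleftrightarrow> (\<forall>c. vcode c \<and> length c = r \<longrightarrow>
     (\<forall>p. p + 2 \<le> 2 * r \<longrightarrow> red (T c @ [(p, GS)])) \<and> (\<forall>p. p < 2 * r \<longrightarrow> red (T c @ [(p, GY)])))"

text \<open>A crossing away from the last strand either only changes the position of the left leg of
  the last cup, or passes below that cup, where \<open>closed r\<close> takes over.\<close>

lemma red_s_nonlast:
  assumes "closed r" "vcode c" "length c = Suc r" "p < 2 * r"
  shows "red (T c @ [(p, GS)])"
proof -
  obtain j m c' where c: "c = (j, m) # c'" using assms by (cases c) auto
  let ?n = "2 * r"
  have v: "vcode c'" "length c' = r" "j \<le> ?n" using assms c by auto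
  have T: "T c = T c' @ U ?n j m" using c v by simp
  note ctx = red_eqv_ctx[where u = "T c'" and n = ?n and l = "U ?n j m @ [(p, GS)]"]
  consider "Suc p < j" | "Suc p = j" | "p = j" | "j < p" by linarith
  then show ?thesis
  proof cases
    case 1
    have "red ((T c' @ [(p, GS)]) @ U ?n j m)"
      using assms(1) v 1 by (intro red_U) (auto simp: closed_def)
    then show ?thesis using ctx[OF _ U_s_less[OF 1 v(3)]] v T by simp
  next
    case 2
    then have "T c @ [(p, GS)] = T ((p, m) # c')" using U_s_pred[of j ?n m] v T by auto
    then show ?thesis using red_T[of "(p, m) # c'"] v 2 by auto
  next
    case 3
    have "red (T c' @ U ?n (Suc j) m)" using red_U[OF red_T[OF v(1)]] v 3 assms(4) by simp
    moreover have "eqv ?n (U ?n j m @ [(p, GS)]) (U ?n (Suc j) m)"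
      using U_s_same[of j ?n m] 3 assms(4) by simp
    ultimately show ?thesis using ctx v T by simp
  next
    case 4
    have "red ((T c' @ [(p - 1, GS)]) @ U ?n j m)"
      using assms v 4 by (intro red_U) (auto simp: closed_def)
    then show ?thesis using ctx[OF _ U_s_greater[OF 4 assms(4)]] v T by simp
  qed
qed

lemma red_smap_nonlast:
  assumes "closed r"
  shows "red x \<Longrightarrow> fin 0 x = 2 * Suc r \<Longrightarrow> \<forall>i\<in>set xs. i < 2 * r \<Longrightarrow> red (x @ smap xs)"
proof (induction xs arbitrary: x)
  case (Cons i xs)
  have "red (x @ [(i, GS)])"
    using Cons.prems by (intro red_lift[of x]) (auto intro!: red_s_nonlast[OF assms])
  then have "red ((x @ [(i, GS)]) @ smap xs)" using Cons.prems by (intro Cons.IH) auto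
  then show ?case by (simp add: smap_def)
qed (simp add: smap_def)

lemma closed_all: "closed r"
proof (induction r)
  case 0
  then show ?case by (simp add: closed_def)
next
  case (Suc r)
  let ?n = "2 * r"
  show ?case unfolding closed_def
  proof (intro allI impI, elim conjE)
    fix c assume "vcode c" "length c = Suc r"
    then obtain j m c' where c: "c = (j, m) # c'" by (cases c) auto
    then have v: "vcode c'" "length c' = r" "j \<le> ?n" using \<open>vcode c\<close> \<open>length c = Suc r\<close> by auto
    have T: "T c = T c' @ U ?n j m" using c v by simp
    have last: "red (T c @ [(?n, GS)])"
    proof (cases "j = ?n")
      case True
      then show ?thesis using red_eqv_ctx[OF _ U_s_last[of ?n m], of "T c'"] red_T[OF \<open>vcode c\<close>] v T by simp
    next
      case False
      \<comment> \<open>Since \<open>j\<close> is not \<open>?n\<close>, a strand separates the two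
        legs of the last cup, so there is an earlier cup with which to exchange.\<close>
      then obtain j' m' d where d: "c' = (j', m') # d" using v by (cases c') auto
      let ?l = "2 * length d"
      have l: "?n = ?l + 2" "j' \<le> ?l" "vcode d" using v d by auto
      \<comment> \<open>The two cups appear in exchanged order, both with their left leg at
        \<open>?l\<close>. All listed crossings have index below \<open>?n\<close>, so closure for
        \<open>r\<close> cups suffices to apply them.\<close>
      have "red (T ((?l, m') # (?l, m) # d) @ smap (rev [j'..<?l] @ rev [j..<Suc ?l]))"
        using l by (intro red_smap_nonlast[OF Suc] red_T) (use v d in auto)
      then have "red (T d @ U ?l ?l m @ U (?l + 2) ?l m' @ mv j' ?l @ mv j (Suc ?l))"
        by (simp add: mv_def smap_def)
      then have "red (T d @ U ?l j' m' @ U (?l + 2) j m @ [(?l + 2, GS)])"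
        using False v l by (intro red_eqv_ctx[OF _ U_exchange]) auto
      then show ?thesis using T d l by simp
    qed
    have S: "red (T c @ [(p, GS)])" if "p + 2 \<le> 2 * Suc r" for p
      using that last red_s_nonlast[OF Suc \<open>vcode c\<close> \<open>length c = Suc r\<close>, of p] by (cases "p = ?n") auto
    have Y: "red (T c @ [(p, GY)])" if p: "p < 2 * Suc r" for p
    proof -
      note ctx = red_eqv_ctx[where u = "T c'" and n = ?n and l = "U ?n j m @ [(p, GY)]"]
      have up: "red (T c' @ U ?n j (Suc m))" using red_T[of "(j, Suc m) # c'"] v by simp
      consider "p = Suc ?n" | "p = j" | "p < j" | "j < p" "p \<le> ?n" using p by fastforce
      then show ?thesis
      proof cases
        case 1
        then have "eqv ?n (U ?n j m @ [(p, GY)]) (U ?n j (Suc m))" using U_y_last[of ?n j m] by simp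
        then show ?thesis using ctx[OF up] v T by simp
      next
        case 2
        then have "eqv ?n (U ?n j m @ [(p, GY)]) (U ?n j (Suc m))" using U_y_left[of j ?n m] v by simp
        then show ?thesis using ctx[OF up] v T by simp
      next
        case 3
        have "red ((T c' @ [(p, GY)]) @ U ?n j m)"
          using Suc v 3 by (intro red_U) (auto simp: closed_def)
        then show ?thesis using ctx[OF _ U_y_less[OF 3 v(3)]] v T by simp
      next
        case 4
        have "red ((T c' @ [(p - 1, GY)]) @ U ?n j m)"
          using Suc v 4 by (intro red_U) (auto simp: closed_def)
        then show ?thesis using ctx[OF _ U_y_greater[OF 4]] v T by simp
      qed
    qed
    show "(\<forall>p. p + 2 \<le> 2 * Suc r \<longrightarrow> red (T c @ [(p, GS)])) \<and> (\<forall>p. p < 2 * Suc r \<longrightarrow> red (T c @ [(p, GY)]))"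
      using S Y by simp
  qed
qed

lemma red_s: "red x \<Longrightarrow> p + 2 \<le> fin 0 x \<Longrightarrow> red (x @ [(p, GS)])"
proof (erule red_lift)
  fix c assume "p + 2 \<le> fin 0 x" "vcode c" "2 * length c = fin 0 x"
  then show "red (T c @ [(p, GS)])" using closed_all[of "length c"] by (simp add: closed_def)
qed simp

lemma red_y: "red x \<Longrightarrow> p < fin 0 x \<Longrightarrow> red (x @ [(p, GY)])"
proof (erule red_lift)
  fix c assume "p < fin 0 x" "vcode c" "2 * length c = fin 0 x"
  then show "red (T c @ [(p, GY)])" using closed_all[of "length c"] by (simp add: closed_def)
qed simp

lemma red_dots: "red x \<Longrightarrow> p < fin 0 x \<Longrightarrow> red (x @ replicate m (p, GY))"
proof (induction m)
  case (Suc m)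
  then have "red ((x @ replicate m (p, GY)) @ [(p, GY)])" by (intro red_y) auto
  then show ?case by (simp add: replicate_append_same)
qed simp

lemma red_smap: "red x \<Longrightarrow> \<forall>i\<in>set xs. i + 2 \<le> fin 0 x \<Longrightarrow> red (x @ smap xs)"
proof (induction xs arbitrary: x)
  case (Cons i xs)
  obtain k where "fin 0 x = Suc (Suc k)" using Cons.prems le_Suc_ex[of 2 "fin 0 x"] by auto
  then have "red ((x @ [(i, GS)]) @ smap xs)" using Cons.prems by (intro Cons.IH red_s) auto
  then show ?case by (simp add: smap_def)
qed (simp add: smap_def)

text \<open>Induction from the right end: a cup on the far right simply extends the code, any other
  one is moved right by crossings, which are already under control.\<close>

lemma red_cup:
  assumes "red x" "p \<le> fin 0 x"
  shows "red (x @ [(p, GBs)])"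
  using assms(2)
proof (induction p rule: inc_induct)
  case base
  show ?case
  proof (rule red_lift[OF assms(1)])
    fix c assume "vcode c" "2 * length c = fin 0 x"
    then show "red (T c @ [(fin 0 x, GBs)])"
      using red_T[of "(fin 0 x, 0) # c"] by (simp add: U_def)
  qed simp
next
  case (step p)
  have "red ((x @ [(Suc p, GBs)]) @ smap [p, Suc p])" using step by (intro red_smap) auto
  then have "red (x @ [(Suc p, GBs), (p, GS), (Suc p, GS)])" by (simp add: smap_def)
  then show ?case by (rule red_eqv_ctx[OF _ cup_right]) (use step red_ok[OF assms(1)] in auto)
qed

text \<open>If both legs of the last cup lie under the cap, a loop is closed and the word vanishes.
  Otherwise a snake removes this cup, leaving dots and crossings above one cup fewer.\<close>

lemma red_cap_last:
  assumes "red x" "fin 0 x = l + 2"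
  shows "red (x @ [(l, GB)])"
proof (rule red_lift[OF assms(1)])
  fix c assume "vcode c" "2 * length c = fin 0 x"
  then obtain j m c' where c: "c = (j, m) # c'" using assms(2) by (cases c) auto
  have v: "vcode c'" "2 * length c' = l" "j \<le> l" using \<open>vcode c\<close> \<open>2 * length c = fin 0 x\<close> assms(2) c by auto
  have T: "T c = T c' @ U l j m" using c v by simp
  show "red (T c @ [(l, GB)])"
  proof (cases "j = l")
    case True
    have "E l (-1) (U l l m @ [(l, GB)]) (U l l m @ [(l, GB)])"
      using E_sh[OF loop_null[of m], of l l] by simp
    then have "nul (T c @ [(l, GB)])"
      using E_pre[of l "-1" _ _ 0 "T c'"] v T True by (simp add: nul_def)
    then show ?thesis by (simp add: red_def)
  next
    case False
    have "red (T c' @ replicate m (l - 1, GY) @ smap (rev [j..<l - 1]))"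
      unfolding append_assoc[symmetric] using v False by (intro red_smap red_dots red_T) auto
    then show ?thesis
      using red_eqv_ctx[OF _ U_cap[of j l m], of "T c'"] T v False by (simp add: mv_def)
  qed
qed (use assms in auto)

lemma red_cap:
  assumes "red x" "p + 2 \<le> fin 0 x"
  shows "red (x @ [(p, GB)])"
proof -
  obtain l where l: "fin 0 x = l + 2" using assms by (metis add.commute le_add_diff_inverse2 le_trans le_add2)
  have "p \<le> l" using l assms by simp
  then show ?thesis using assms(1) l
  proof (induction p arbitrary: x rule: inc_induct)
    case base
    then show ?case using red_cap_last by blast
  next
    case (step p)
    let ?y = "x @ smap [Suc p, p]"
    have "red ?y" by (rule red_smap) (use step in auto)
    moreover have "fin 0 ?y = l + 2" using step by (simp add: smap_def)
    ultimately have "red (?y @ [(Suc p, GB)])" by (rule step.IH)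
    then have "red (x @ [(Suc p, GS), (p, GS), (Suc p, GB)])" by (simp add: smap_def)
    then show ?case by (rule red_eqv_ctx[OF _ cap_right]) (use step red_ok[of x] in auto)
  qed
qed

lemma red_all: "ok 0 w \<Longrightarrow> red w"
proof (induction w rule: rev_induct)
  case Nil
  then show ?case using red_T[of "[]"] by simp
next
  case (snoc l w)
  obtain p g where l: "l = (p, g)" by force
  show ?case using snoc l by (cases g) (auto intro: red_s red_y red_cup red_cap)
qed

section \<open>Bending the bottom endpoints to the top\<close>

definition ncup :: "nat \<Rightarrow> pword" where "ncup a = map (\<lambda>i. (i, GBs)) [0..<a]"
definition ncap :: "nat \<Rightarrow> pword" where "ncap a = map (\<lambda>i. (i, GB)) (rev [0..<a])"
definition unbend :: "nat \<Rightarrow> pword \<Rightarrow> pword" where "unbend a v = sh a v @ ncap a"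

lemma ok_ncup [simp]: "ok k (ncup a)" "fin k (ncup a) = k + 2 * a"
proof -
  have "ok k (ncup a) \<and> fin k (ncup a) = k + 2 * a" by (induction a) (auto simp: ncup_def)
  then show "ok k (ncup a)" "fin k (ncup a) = k + 2 * a" by auto
qed

lemma ok_ncap: "2 * a \<le> k \<Longrightarrow> ok k (ncap a) \<and> fin k (ncap a) = k - 2 * a"
proof (induction a arbitrary: k)
  case (Suc a)
  then obtain k' where "k = Suc (Suc (2 * a + k'))" using le_Suc_ex by (metis add_Suc mult_Suc_right add_2_eq_Suc)
  then show ?case using Suc.IH[of "2 * a + k'"] by (simp add: ncap_def)
qed (simp add: ncap_def)

lemma ncup_Suc: "ncup (Suc a) = (0, GBs) # sh 1 (ncup a)"
  unfolding ncup_def upt_conv_Cons[OF zero_less_Suc] by (simp add: sh_def map_Suc_upt[symmetric] o_def del: upt_Suc)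

lemma ncap_Suc: "ncap (Suc a) = (a, GB) # ncap a"
  by (simp add: ncap_def)

text \<open>After moving below the inner cups, the innermost cap forms a snake with the outermost
  cup; the remaining cups and caps are the same configuration for \<open>a\<close> strands.\<close>

lemma zigzag: "eqv a (sh a (ncup a) @ ncap a) []"
proof (induction a)
  case 0
  then show ?case by (simp add: ncup_def ncap_def eqv_refl)
next
  case (Suc a)
  have "eqv (Suc a) (sh (Suc a) (ncup (Suc a)) @ ncap (Suc a))
      ([(Suc a, GBs)] @ [(a, GB)] @ sh a (ncup a) @ ncap a)"
    by (rule eqv_sym, rule comm_ctx[where u = "[(0, GB)]" and k = 2 and v = "ncup a" and l = 1
          and x = "[(Suc a, GBs)]" and y = "ncap a" and p = a])
      (auto simp: ncup_Suc ncap_Suc ok_ncap fin_sh ok_sh[of 0] fin_sh[of 0])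
  also have "eqv (Suc a) \<dots> (sh a (ncup a) @ ncap a)"
    by (rule eqv_ctx[OF snake1[THEN eqvI], where u = "[]" and p = a and v = "sh a (ncup a) @ ncap a"])
      (auto simp: ok_ncap ok_sh[of 0] fin_sh[of 0])
  also have "eqv (Suc a) \<dots> []"
    using eqv_sh[OF Suc, of 0 "Suc a"] by simp
  finally show ?case .
qed

lemma unbend_bend:
  assumes "ok a w"
  shows "eqv a (unbend a (ncup a @ sh a w)) w"
proof -
  have "eqv a (unbend a (ncup a @ sh a w)) ((sh a (ncup a) @ ncap a) @ w)"
    by (rule eqv_sym, rule comm_ctx[where u = "ncap a" and k = "2 * a" and v = w and l = a
          and x = "sh a (ncup a)" and y = "[]" and p = 0])
      (use assms in \<open>auto simp: unbend_def mult_2 ok_ncap[simplified mult_2] ok_sh[of 0] fin_sh[of 0] fin_sh\<close>)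
  also have "eqv a \<dots> w" using eqv_app[OF zigzag, of a w] assms eqv_ok[OF zigzag[of a]] by simp
  finally show ?thesis .
qed

fun csum :: "(nat \<times> nat) list \<Rightarrow> nat" where
  "csum [] = 0"
| "csum ((j, m) # c) = m + csum c"

lemma dots_T: "dots (T c) = csum c"
proof -
  have "dots (mv j n) = 0" for j n by (auto simp: mv_def smap_def dots_def filter_map o_def)
  then show ?thesis by (induction c rule: csum.induct) (auto simp: U_def)
qed

lemma E_unbend: "E 0 e x y \<Longrightarrow> a \<le> fin 0 x \<Longrightarrow> E a e (unbend a x) (unbend a y)"
  unfolding unbend_def using E_ok[of 0 e x y]
  by (intro E_app E_sh) (auto simp: fin_sh[of 0] ok_ncap mult_2)

text \<open>Bending turns \<open>w\<close> into a word with source 0, to which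
  \<open>red_all\<close> applies. Unbending respects equivalences, including vanishing, and the
  zigzags give back \<open>w\<close>.\<close>

lemma reduce:
  assumes "ok a w" "fin a w = b"
  shows "E a (-1) w w \<or> (\<exists>c. vcode c \<and> 2 * length c = a + b \<and> csum c = dots w \<and> eqv a w (unbend a (T c)))"
proof -
  let ?x = "ncup a @ sh a w"
  have f: "fin 0 ?x = a + b" and ok: "ok 0 ?x" using assms by (auto simp: fin_sh mult_2 ok_sh)
  have "dots (ncup a) = 0" by (simp add: ncup_def dots_def filter_map o_def)
  then have d: "dots ?x = dots w" by simp
  consider "nul ?x" | c where "vcode c" "eqv 0 ?x (T c)" using red_all[OF ok] by (auto simp: red_def)
  then show ?thesis
  proof cases
    case 1
    then have "E a (-1) (unbend a ?x) (unbend a ?x)" using f by (intro E_unbend) (auto simp: nul_def)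
    moreover obtain e where e: "E a e (unbend a ?x) w" using unbend_bend[OF assms(1)] by (auto simp: eqv_def)
    ultimately have "E a (e * - 1 * e) w w" using E_trans[OF E_trans[OF E_sym[OF e]] e] by blast
    \<comment> \<open>The unknown sign of unbending enters twice and cancels, so vanishing is
      inherited exactly.\<close>
    moreover have "e * - 1 * e = -1" using E_ok[OF e] by auto
    ultimately show ?thesis by simp
  next
    case 2
    obtain e where "E 0 e ?x (T c)" using 2 by (auto simp: eqv_def)
    then have "eqv a (unbend a ?x) (unbend a (T c))" using E_unbend[of e ?x "T c" a] f by (intro eqvI[of a e]) simp
    then have "eqv a w (unbend a (T c))" using unbend_bend[OF assms(1)] eqv_sym eqv_trans by blast
    moreover have "2 * length c = a + b" "csum c = dots w" using eqv_ok[OF 2(2)] f d by (auto simp: dots_T)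
    ultimately show ?thesis using 2 by blast
  qed
qed

section \<open>Codes as dotted matchings\<close>

definition ins_at :: "nat \<Rightarrow> nat \<Rightarrow> nat" where "ins_at j i = (if i < j then i else Suc i)"
definition del_at :: "nat \<Rightarrow> nat \<Rightarrow> nat" where "del_at j i = (if i < j then i else i - 1)"

text \<open>The last cup joins \<open>j\<close> to the last point; the matching of the earlier cups
  is renumbered around \<open>j\<close>. This combinatorial description serves to count codes,
  through the injectivity of passing from a code to its matching and weights.\<close>

fun mt :: "(nat \<times> nat) list \<Rightarrow> nat \<Rightarrow> nat" where
  "mt [] i = i"
| "mt ((j, m) # c) i = (if i = j then Suc (2 * length c) else if i = Suc (2 * length c) then j
     else if i < Suc (2 * length c) then ins_at j (mt c (del_at j i)) else i)"

fun wt :: "(nat \<times> nat) list \<Rightarrow> nat \<Rightarrow> nat" where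
  "wt [] i = 0"
| "wt ((j, m) # c) i = (if i = j \<or> i = Suc (2 * length c) then m
     else if i < Suc (2 * length c) then wt c (del_at j i) else 0)"

lemma del_ins [simp]: "del_at j (ins_at j i) = i" "ins_at j i \<noteq> j" "j \<noteq> ins_at j i"
  by (auto simp: ins_at_def del_at_def)

lemma ins_del: "i \<noteq> j \<Longrightarrow> ins_at j (del_at j i) = i"
  by (auto simp: ins_at_def del_at_def)

lemma ins_less: "i < n \<Longrightarrow> ins_at j i < Suc n" "ins_at j i = ins_at j k \<longleftrightarrow> i = k"
  by (auto simp: ins_at_def)

lemma del_less: "i < Suc n \<Longrightarrow> i \<noteq> j \<Longrightarrow> j \<le> n \<Longrightarrow> del_at j i < n"
  by (auto simp: del_at_def)

text \<open>The default values beyond the last point (identity for \<open>mt\<close>, 0 for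
  \<open>wt\<close>) are included because codes are later compared by equality of these functions on
  all numbers.\<close>

lemma mt_involution:
  assumes "vcode c"
  shows "(i < 2 * length c \<longrightarrow> mt c i < 2 * length c \<and> mt c i \<noteq> i \<and> mt c (mt c i) = i \<and> wt c (mt c i) = wt c i) \<and>
    (2 * length c \<le> i \<longrightarrow> mt c i = i \<and> wt c i = 0)"
  using assms
proof (induction c arbitrary: i)
  case (Cons l c)
  obtain j m where l: "l = (j, m)" by force
  let ?n = "2 * length c"
  have j: "j \<le> ?n" and v: "vcode c" using Cons.prems l by auto
  consider "i = j" | "i = Suc ?n" | "i > Suc ?n" | "i < Suc ?n" "i \<noteq> j" by linarith
  then show ?case
  proof cases
    case 4
    let ?d = "del_at j i"
    have d: "?d < ?n" using del_less 4 j by simp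
    then have IH: "mt c ?d < ?n" "mt c ?d \<noteq> ?d" "mt c (mt c ?d) = ?d" "wt c (mt c ?d) = wt c ?d"
      using Cons.IH[OF v, of ?d] by auto
    have lt: "ins_at j (mt c ?d) < Suc ?n" using ins_less IH by simp
    have "ins_at j (mt c ?d) \<noteq> i" using IH(2) ins_del[OF 4(2)] ins_less(2) by metis
    then show ?thesis using 4 lt IH by (auto simp: l ins_del)
  qed (use j in \<open>auto simp: l\<close>)
qed simp

lemma wt_sum: "vcode c \<Longrightarrow> (\<Sum>i<2 * length c. wt c i) = 2 * csum c"
proof (induction c)
  case (Cons l c)
  obtain j m where l: "l = (j, m)" by force
  let ?n = "2 * length c"
  have j: "j \<le> ?n" and v: "vcode c" using Cons.prems l by auto
  \<comment> \<open>The points other than the last one are \<open>j\<close> and the renumbered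
    points of the earlier cups. The last point and \<open>j\<close> then each contribute
    \<open>m\<close>.\<close>
  have "{..<Suc ?n} = insert j (ins_at j ` {..<?n})"
  proof (intro set_eqI iffI)
    fix i assume "i \<in> {..<Suc ?n}"
    then show "i \<in> insert j (ins_at j ` {..<?n})"
      using del_less[of i ?n j] ins_del[of i j] j by (cases "i = j") (auto intro!: image_eqI[of _ _ "del_at j i"])
  qed (use j ins_less in auto)
  moreover have "j \<notin> ins_at j ` {..<?n}" by auto
  ultimately have "(\<Sum>i<Suc ?n. wt (l # c) i) = m + (\<Sum>i\<in>ins_at j ` {..<?n}. wt (l # c) i)"
    by (simp add: l)
  also have "(\<Sum>i\<in>ins_at j ` {..<?n}. wt (l # c) i) = (\<Sum>i<?n. wt (l # c) (ins_at j i))"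
    by (rule sum.reindex[unfolded o_def]) (auto simp: inj_on_def ins_less)
  also have "\<dots> = (\<Sum>i<?n. wt c i)"
    using ins_less(1) by (intro sum.cong) (auto simp: l dest!: ins_less(1)[of _ ?n j])
  finally show ?case using Cons.IH[OF v] by (simp add: l)
qed simp

lemma mt_inj:
  "vcode c \<Longrightarrow> vcode c' \<Longrightarrow> length c = length c' \<Longrightarrow> mt c = mt c' \<Longrightarrow> wt c = wt c' \<Longrightarrow> c = c'"
proof (induction c arbitrary: c')
  case (Cons l c)
  obtain j m where l: "l = (j, m)" by force
  obtain j' m' d where c': "c' = (j', m') # d" using Cons.prems by (cases c') auto
  let ?n = "2 * length c"
  have j: "j \<le> ?n" "j' \<le> ?n" and v: "vcode c" "vcode d" and len: "length c = length d"
    using Cons.prems l c' by auto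
  \<comment> \<open>The partner of the last point and its weight recover the head of the
    code.\<close>
  have "j = j'" using fun_cong[OF Cons.prems(4), of "Suc ?n"] j len by (auto simp: l c' split: if_splits)
  moreover have "m = m'" using fun_cong[OF Cons.prems(5), of "Suc ?n"] j len by (auto simp: l c' split: if_splits)
  moreover have "mt c i = mt d i \<and> wt c i = wt d i" for i
  proof (cases "i < ?n")
    case True
    then have "ins_at j i < Suc ?n" by (rule ins_less)
    then have "ins_at j (mt c i) = ins_at j (mt d i)" "wt c i = wt d i"
      using fun_cong[OF Cons.prems(4), of "ins_at j i"] fun_cong[OF Cons.prems(5), of "ins_at j i"] len \<open>j = j'\<close>
      by (auto simp: l c')
    then show ?thesis by (auto simp: ins_less)
  next
    case False
    then show ?thesis using mt_involution[OF v(1), of i] mt_involution[OF v(2), of i] len by auto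
  qed
  ultimately show ?case using Cons.IH[OF v(1,2) len] l c' by auto
qed auto

definition codes :: "nat \<Rightarrow> nat \<Rightarrow> (nat \<times> nat) list set" where
  "codes n k = {c. vcode c \<and> 2 * length c = n \<and> csum c = k}"

lemma finite_codes: "finite (codes n k)"
proof -
  have "vcode c \<Longrightarrow> (j, m) \<in> set c \<Longrightarrow> j \<le> 2 * length c \<and> m \<le> csum c" for j m c
    by (induction c) auto
  then have "codes n k \<subseteq> {c. set c \<subseteq> {..n} \<times> {..k} \<and> length c = n div 2}"
    by (fastforce simp: codes_def)
  then show ?thesis using finite_lists_length_eq[of "{..n} \<times> {..k}" "n div 2"] finite_subset by blast
qed

definition en :: "nat \<Rightarrow> nat \<Rightarrow> endpt" where "en a i = (if i < a then Bot i else Top (i - a))"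

fun de :: "nat \<Rightarrow> endpt \<Rightarrow> nat" where
  "de a (Bot i) = i"
| "de a (Top j) = a + j"

lemma en_endpts: "i < a + b \<Longrightarrow> en a i \<in> endpts a b" "de a (en a i) = i"
  by (auto simp: en_def endpts_def)

lemma de_endpts: "x \<in> endpts a b \<Longrightarrow> de a x < a + b \<and> en a (de a x) = x"
  by (auto simp: en_def endpts_def)

lemma finite_endpts [simp]: "finite (endpts a b)" by (simp add: endpts_def)

text \<open>The same number of dots is recorded at both ends of a string, whence the factor 2.\<close>

definition Ind :: "nat \<Rightarrow> nat \<Rightarrow> nat \<Rightarrow> ((endpt \<Rightarrow> endpt) \<times> (endpt \<Rightarrow> nat)) set" where
  "Ind a b k = {(c, f). c \<in> Conn a b \<and> (\<forall>x\<in>endpts a b. f (c x) = f x) \<and>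
     (\<forall>x. x \<notin> endpts a b \<longrightarrow> f x = 0) \<and> sum f (endpts a b) = 2 * k}"

definition code_ind :: "nat \<Rightarrow> nat \<Rightarrow> (nat \<times> nat) list \<Rightarrow> (endpt \<Rightarrow> endpt) \<times> (endpt \<Rightarrow> nat)" where
  "code_ind a b c = (\<lambda>x. if x \<in> endpts a b then en a (mt c (de a x)) else x,
     \<lambda>x. if x \<in> endpts a b then wt c (de a x) else 0)"

lemma code_ind_mem: "c \<in> codes (a + b) k \<Longrightarrow> code_ind a b c \<in> Ind a b k"
proof -
  assume c: "c \<in> codes (a + b) k"
  have i: "mt c i < a + b \<and> mt c i \<noteq> i \<and> mt c (mt c i) = i \<and> wt c (mt c i) = wt c i" if "i < a + b" for i
    using mt_involution[of c i] c that by (auto simp: codes_def)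
  have bij: "bij_betw (de a) (endpts a b) {..<a + b}"
    by (rule bij_betw_byWitness[where f' = "en a"]) (auto simp: de_endpts en_endpts)
  have "(\<Sum>x\<in>endpts a b. wt c (de a x)) = (\<Sum>i<a + b. wt c i)"
    using sum.reindex_bij_betw[OF bij] .
  also have "\<dots> = 2 * k" using wt_sum[of c] c by (auto simp: codes_def)
  finally have s: "(\<Sum>x\<in>endpts a b. wt c (de a x)) = 2 * k" .
  have "en a (mt c (de a x)) \<in> endpts a b \<and> en a (mt c (de a x)) \<noteq> x \<and> wt c (de a (en a (mt c (de a x)))) = wt c (de a x)
      \<and> en a (mt c (de a (en a (mt c (de a x))))) = x"
    if "x \<in> endpts a b" for x
    using i[of "de a x"] de_endpts[OF that] en_endpts by metis
  then show ?thesis using s by (auto simp: Ind_def code_ind_def Conn_def)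
qed

lemma code_ind_inj: "inj_on (code_ind a b) (codes (a + b) k)"
proof (rule inj_onI)
  fix c c' assume c: "c \<in> codes (a + b) k" "c' \<in> codes (a + b) k" and eq: "code_ind a b c = code_ind a b c'"
  have "mt c i = mt c' i \<and> wt c i = wt c' i" for i
  proof (cases "i < a + b")
    case True
    then have e: "en a i \<in> endpts a b" "de a (en a i) = i" using en_endpts by auto
    have "en a (mt c i) = en a (mt c' i)" "wt c i = wt c' i"
      using eq e by (auto simp: code_ind_def dest!: fun_cong[of _ _ "en a i"])
    then show ?thesis using en_endpts(2) by metis
  next
    case False
    then show ?thesis using mt_involution[of c i] mt_involution[of c' i] c by (auto simp: codes_def)
  qed
  then show "c = c'" using c by (intro mt_inj) (auto simp: codes_def)
qed

section \<open>A tensor representation\<close>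

text \<open>The representation lives on tensor powers of a superspace with basis labels \<open>z \<noteq> 0\<close>, where positive
  labels are even, negative labels are odd, and \<open>- z\<close> is dual to \<open>z\<close> for the odd bilinear form.
  Coefficient functions on infinite label sequences make the number of strands irrelevant.\<close>

type_synonym lseq = "nat \<Rightarrow> int"

text \<open>\<open>sn\<close> is the parity sign of a label, \<open>kap\<close> the Koszul sign of
  exchanging two labels, and \<open>sg p\<close> the Koszul sign of moving an odd map past the first
  \<open>p\<close> tensor factors.\<close>

definition sn :: "int \<Rightarrow> complex" where "sn z = (if z < 0 then -1 else 1)"
definition kap :: "int \<Rightarrow> int \<Rightarrow> complex" where "kap u v = (if u < 0 \<and> v < 0 then -1 else 1)"
definition sg :: "nat \<Rightarrow> lseq \<Rightarrow> complex" where "sg p x = (\<Prod>i<p. sn (x i))"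

definition tr :: "nat \<Rightarrow> lseq \<Rightarrow> lseq" where
  "tr p x = (\<lambda>i. if i = p then x (Suc p) else if i = Suc p then x p else x i)"
definition del :: "nat \<Rightarrow> lseq \<Rightarrow> lseq" where
  "del p x = (\<lambda>i. if i < p then x i else x (Suc (Suc i)))"
definition ins :: "nat \<Rightarrow> int \<Rightarrow> lseq \<Rightarrow> lseq" where
  "ins p z x = (\<lambda>i. if i < p then x i else if i = p then z else if i = Suc p then - z else x (i - 2))"

lemma sn_sq [simp]: "sn z * sn z = 1" "sn z * (sn z * c) = c"
  by (auto simp: sn_def)

lemma sn_minus: "z \<noteq> 0 \<Longrightarrow> sn (- z) = - sn z"
  by (auto simp: sn_def)

lemma sg_0 [simp]: "sg 0 x = 1" and sg_Suc: "sg (Suc p) x = sg p x * sn (x p)"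
  by (auto simp: sg_def)

lemma sg_sq [simp]: "sg p x * sg p x = 1" "sg p x * (sg p x * c) = c"
proof -
  show "sg p x * sg p x = 1" by (induction p) (auto simp: sg_Suc algebra_simps)
  then show "sg p x * (sg p x * c) = c" by (metis mult.assoc mult_1)
qed

lemma sg_cong: "(\<And>i. i < p \<Longrightarrow> x i = y i) \<Longrightarrow> sg p x = sg p y"
  by (auto simp: sg_def)

lemma sg_low [simp]:
  "q \<le> p \<Longrightarrow> sg q (tr p x) = sg q x" "q \<le> p \<Longrightarrow> sg q (del p x) = sg q x" "q \<le> p \<Longrightarrow> sg q (ins p z x) = sg q x"
  by (auto intro!: sg_cong simp: tr_def del_def ins_def)

text \<open>A dual pair \<open>z\<close>, \<open>- z\<close> contains exactly one odd label, so
  inserting or deleting it to the left of a position flips the sign there. This produces the minus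
  signs in exchanging two odd generators.\<close>

lemma sg_high:
  "Suc (Suc p) \<le> q \<Longrightarrow> sg q (tr p x) = sg q x"
  "p \<le> q \<Longrightarrow> z \<noteq> 0 \<Longrightarrow> sg (Suc (Suc q)) (ins p z x) = - sg q x"
  "p \<le> q \<Longrightarrow> x p \<noteq> 0 \<Longrightarrow> x (Suc p) = - x p \<Longrightarrow> sg q (del p x) = - sg (Suc (Suc q)) x"
proof -
  show "Suc (Suc p) \<le> q \<Longrightarrow> sg q (tr p x) = sg q x"
  proof (induction q rule: dec_induct)
    case base
    have "sg p (tr p x) = sg p x" by simp
    then show ?case by (simp add: sg_Suc tr_def)
  next
    case (step q)
    then show ?case by (simp add: sg_Suc) (simp add: tr_def)
  qed
  show "p \<le> q \<Longrightarrow> z \<noteq> 0 \<Longrightarrow> sg (Suc (Suc q)) (ins p z x) = - sg q x"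
  proof (induction q rule: dec_induct)
    case base
    then show ?case by (simp add: sg_Suc) (simp add: ins_def sn_minus)
  next
    case (step q)
    then show ?case by (simp add: sg_Suc[of "Suc (Suc q)"] sg_Suc[of q]) (simp add: ins_def)
  qed
  show "p \<le> q \<Longrightarrow> x p \<noteq> 0 \<Longrightarrow> x (Suc p) = - x p \<Longrightarrow> sg q (del p x) = - sg (Suc (Suc q)) x"
  proof (induction q rule: dec_induct)
    case base
    then show ?case by (simp add: sg_Suc sn_minus)
  next
    case (step q)
    then show ?case by (simp add: sg_Suc[of "Suc (Suc q)"] sg_Suc[of q]) (simp add: del_def)
  qed
qed

lemma SS_diff: "\<not> x < q \<Longrightarrow> x \<noteq> q \<Longrightarrow> x \<noteq> Suc q \<Longrightarrow> Suc (Suc (x - 2)) = x" "\<not> x < Suc (Suc q) \<Longrightarrow> Suc (Suc (x - 2)) = x"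
  by linarith+

lemma seq_comm:
  "tr p (tr p x) = x"
  "del p (ins p z x) = x"
  "tr p (ins p z x) = ins p (- z) x"
  "del p (tr p x) = del p x"
  "del (Suc p) (ins p z x) = x(p := z)"
  "del p (ins (Suc p) z x) = x(p := - z)"
  by (auto simp: tr_def del_def ins_def fun_eq_iff)

text \<open>A label 0 would be its own dual and could not have the parity opposite to its dual.
  Finiteness makes the sum that defines the cap meaningful.\<close>

locale labels =
  fixes I :: "int set"
  assumes finite_I: "finite I" and zero_I: "0 \<notin> I" and minus_I: "\<And>z. z \<in> I \<Longrightarrow> - z \<in> I"
begin

definition S :: "nat \<Rightarrow> (lseq \<Rightarrow> complex) \<Rightarrow> (lseq \<Rightarrow> complex)" where
  "S p v = (\<lambda>y. kap (y p) (y (Suc p)) * v (tr p y))"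
text \<open>The factor \<open>sn (y p)\<close> makes the cup antisymmetric under exchanging the two
  dual labels, whereas the plain sum in \<open>B\<close> is symmetric. The operators map coefficient
  functions: \<open>y\<close> is an output sequence and \<open>del p y\<close> the input it comes
  from.\<close>

definition Bs :: "nat \<Rightarrow> (lseq \<Rightarrow> complex) \<Rightarrow> (lseq \<Rightarrow> complex)" where
  "Bs p v = (\<lambda>y. if y p \<in> I \<and> y (Suc p) = - y p then sg p y * sn (y p) * v (del p y) else 0)"
definition B :: "nat \<Rightarrow> (lseq \<Rightarrow> complex) \<Rightarrow> (lseq \<Rightarrow> complex)" where
  "B p v = (\<lambda>y. sg p y * (\<Sum>z\<in>I. v (ins p z y)))"
text \<open>The snake relations hold only on coefficient functions supported on labels in \<open>I\<close>.\<close>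

definition van :: "(lseq \<Rightarrow> complex) \<Rightarrow> bool" where
  "van v \<longleftrightarrow> (\<forall>y i. y i \<notin> I \<longrightarrow> v y = 0)"

lemma I_nz: "z \<in> I \<Longrightarrow> z \<noteq> 0" using zero_I by auto
lemma minus_I_iff [simp]: "- z \<in> I \<longleftrightarrow> z \<in> I" using minus_I[of z] minus_I[of "-z"] by auto

lemma S_add [simp]: "S p (v + w) = S p v + S p w" "S p (- v) = - S p v" "S p 0 = 0"
  by (auto simp: S_def fun_eq_iff algebra_simps)
lemma Bs_add [simp]: "Bs p (v + w) = Bs p v + Bs p w" "Bs p (- v) = - Bs p v" "Bs p 0 = 0"
  by (auto simp: Bs_def fun_eq_iff algebra_simps)
lemma B_add [simp]: "B p (v + w) = B p v + B p w" "B p (- v) = - B p v" "B p 0 = 0"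
  by (auto simp: B_def fun_eq_iff algebra_simps sum.distrib sum_negf)

lemma S_S [simp]: "S p (S p v) = v"
proof
  fix y
  have "kap (y p) (y (Suc p)) * kap (y (Suc p)) (y p) = 1" by (auto simp: kap_def)
  moreover have "tr p y p = y (Suc p)" "tr p y (Suc p) = y p" by (auto simp: tr_def)
  ultimately show "S p (S p v) y = v y" by (simp add: S_def seq_comm mult.assoc[symmetric])
qed

lemma braid: "S p (S (Suc p) (S p v)) = S (Suc p) (S p (S (Suc p) v))"
proof
  fix y
  have 1: "tr p (tr (Suc p) (tr p y)) = tr (Suc p) (tr p (tr (Suc p) y))"
    by (auto simp: tr_def fun_eq_iff)
  show "S p (S (Suc p) (S p v)) y = S (Suc p) (S p (S (Suc p) v)) y"
    unfolding S_def 1 by (simp add: tr_def)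
qed

lemma snake1: "van v \<Longrightarrow> B p (Bs (Suc p) v) = - v"
proof
  fix y assume v: "van v"
  have *: "Bs (Suc p) v (ins p z y) = (if z = y p then - (sg p y * v y) else 0)" if "z \<in> I" for z
    using that I_nz[OF that]
    by (simp add: Bs_def seq_comm sg_Suc) (auto simp: ins_def sn_minus)
  have "B p (Bs (Suc p) v) y = sg p y * (\<Sum>z\<in>I. if z = y p then - (sg p y * v y) else 0)"
    unfolding B_def by (simp add: *)
  then show "B p (Bs (Suc p) v) y = (- v) y"
    using v by (auto simp: finite_I van_def)
qed

lemma snake2: "van v \<Longrightarrow> B (Suc p) (Bs p v) = v"
proof
  fix y assume v: "van v"
  have *: "Bs p v (ins (Suc p) z y) = (if z = - y p then sg p y * sn (y p) * v y else 0)" if "z \<in> I" for z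
    using that
    by (simp add: Bs_def seq_comm) (auto simp: ins_def)
  have "B (Suc p) (Bs p v) y = sg p y * sn (y p) * (\<Sum>z\<in>I. if z = - y p then sg p y * sn (y p) * v y else 0)"
    unfolding B_def by (simp add: * sg_Suc)
  then show "B (Suc p) (Bs p v) y = v y"
    using v by (auto simp: finite_I van_def algebra_simps)
qed

lemma cup_slide: "S (Suc p) (Bs p v) = S p (Bs (Suc p) v)"
proof
  fix y
  have 1: "del p (tr (Suc p) y) = del (Suc p) (tr p y)"
    by (auto simp: tr_def del_def fun_eq_iff)
  show "S (Suc p) (Bs p v) y = S p (Bs (Suc p) v) y"
    unfolding S_def Bs_def 1 by (simp add: sg_Suc) (auto simp: tr_def kap_def sn_def dest: I_nz)
qed

lemma S_Bs [simp]: "S p (Bs p v) = - Bs p v"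
proof
  fix y
  show "S p (Bs p v) y = (- Bs p v) y"
    unfolding S_def Bs_def by (simp add: seq_comm) (auto simp: tr_def kap_def sn_minus dest: I_nz)
qed

lemma B_S [simp]: "B p (S p v) = B p v"
proof
  fix y
  have "S p v (ins p z y) = v (ins p (- z) y)" for z
    unfolding S_def by (simp add: seq_comm) (auto simp: ins_def kap_def)
  then have "B p (S p v) y = sg p y * (\<Sum>z\<in>I. v (ins p (- z) y))"
    by (simp add: B_def)
  also have "(\<Sum>z\<in>I. v (ins p (- z) y)) = (\<Sum>z\<in>I. v (ins p z y))"
    by (rule sum.reindex_bij_witness[where i = uminus and j = uminus]) auto
  finally show "B p (S p v) y = B p v y" by (simp add: B_def)
qed

lemma cap_slide: "B p (S (Suc p) v) = B (Suc p) (S p v)"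
proof
  fix y
  have "S (Suc p) v (ins p z y) = sn (y p) * S p v (ins (Suc p) z y)" if "z \<in> I" for z
  proof -
    have "tr (Suc p) (ins p z y) = tr p (ins (Suc p) z y)" by (auto simp: tr_def ins_def fun_eq_iff)
    moreover have "kap (- z) (y p) = sn (y p) * kap (y p) z" using I_nz[OF that] by (auto simp: kap_def sn_def)
    ultimately show ?thesis by (simp add: S_def) (simp add: ins_def)
  qed
  then show "B p (S (Suc p) v) y = B (Suc p) (S p v) y"
    by (simp add: B_def sg_Suc sum_distrib_left mult.assoc)
qed

text \<open>Inserting a crossing between cup and cap costs 1 on one side and -1 on the other, as for
  diagrams.\<close>

lemma B_Bs [simp]: "B p (Bs p v) = 0"
proof -
  have "B p (Bs p v) = - B p (Bs p v)" using B_S[of p "Bs p v"] by simp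
  then show ?thesis by (auto simp: fun_eq_iff)
qed

section \<open>Super interchange for operators on distant strands\<close>

lemma S_S_far: "Suc (Suc p) \<le> q \<Longrightarrow> S q (S p v) = S p (S q v)"
proof
  fix y assume q: "Suc (Suc p) \<le> q"
  have "tr p (tr q y) = tr q (tr p y)" using q by (auto simp: tr_def fun_eq_iff)
  then show "S q (S p v) y = S p (S q v) y" using q by (simp add: S_def) (simp add: tr_def)
qed

lemma B_S_far: "Suc (Suc p) \<le> q \<Longrightarrow> B q (S p v) = S p (B q v)"
proof
  fix y assume q: "Suc (Suc p) \<le> q"
  have "tr p (ins q z y) = ins q z (tr p y)" for z using q by (auto simp: tr_def ins_def fun_eq_iff)
  then show "B q (S p v) y = S p (B q v) y" using q
    by (simp add: S_def B_def sg_high flip: sum_distrib_left)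
      (simp add: ins_def flip: sum_distrib_left)
qed

lemma Bs_S_far: "Suc (Suc p) \<le> q \<Longrightarrow> Bs q (S p v) = S p (Bs q v)"
proof
  fix y assume q: "Suc (Suc p) \<le> q"
  have "tr p (del q y) = del q (tr p y)" using q by (auto simp: tr_def del_def fun_eq_iff)
  moreover have "tr p y q = y q" "tr p y (Suc q) = y (Suc q)" "del q y p = y p" "del q y (Suc p) = y (Suc p)"
    using q by (auto simp: tr_def del_def)
  ultimately show "Bs q (S p v) y = S p (Bs q v) y" using q
    by (simp add: S_def Bs_def sg_high)
qed

lemma S_B_far: "p \<le> q \<Longrightarrow> S q (B p v) = B p (S (Suc (Suc q)) v)"
proof
  fix y assume q: "p \<le> q"
  have "tr (Suc (Suc q)) (ins p z y) = ins p z (tr q y)" for z using q by (auto simp: tr_def ins_def fun_eq_iff)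
  then show "S q (B p v) y = B p (S (Suc (Suc q)) v) y" using q
    by (simp add: S_def B_def) (simp add: ins_def flip: sum_distrib_left)
qed

lemma B_B_far: "p \<le> q \<Longrightarrow> B q (B p v) = - B p (B (Suc (Suc q)) v)"
proof
  fix y assume q: "p \<le> q"
  have 1: "ins p z (ins q w y) = ins (Suc (Suc q)) w (ins p z y)" for z w using q by (auto simp: ins_def fun_eq_iff)
  have 2: "sg (Suc (Suc q)) (ins p z y) = - sg q y" if "z \<in> I" for z using q I_nz[OF that] by (simp add: sg_high)
  have "B q (B p v) y = sg q y * sg p y * (\<Sum>w\<in>I. \<Sum>z\<in>I. v (ins p z (ins q w y)))"
    using q by (simp add: B_def mult.assoc flip: sum_distrib_left)
  also have "(\<Sum>w\<in>I. \<Sum>z\<in>I. v (ins p z (ins q w y))) = (\<Sum>z\<in>I. \<Sum>w\<in>I. v (ins p z (ins q w y)))"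
    by (rule sum.swap)
  finally show "B q (B p v) y = (- B p (B (Suc (Suc q)) v)) y" using q
    by (simp add: B_def 1 2 sum_negf mult.commute mult.left_commute flip: sum_distrib_left)
qed

lemma Bs_B_far: "p \<le> q \<Longrightarrow> Bs q (B p v) = - B p (Bs (Suc (Suc q)) v)"
proof
  fix y assume q: "p \<le> q"
  have 1: "del (Suc (Suc q)) (ins p z y) = ins p z (del q y)" for z
    using q by (auto simp: ins_def del_def fun_eq_iff SS_diff)
  have 2: "ins p z y (Suc (Suc q)) = y q" "ins p z y (Suc (Suc (Suc q))) = y (Suc q)" for z using q by (auto simp: ins_def)
  have "Bs (Suc (Suc q)) v (ins p z y) = (if y q \<in> I \<and> y (Suc q) = - y q then - (sg q y * sn (y q)) * v (ins p z (del q y)) else 0)"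
    if "z \<in> I" for z using q I_nz[OF that] by (simp add: Bs_def 1 2 sg_high)
  then have "B p (Bs (Suc (Suc q)) v) y = sg p y * (\<Sum>z\<in>I.
      (if y q \<in> I \<and> y (Suc q) = - y q then - (sg q y * sn (y q)) * v (ins p z (del q y)) else 0))"
    by (simp add: B_def)
  then have "B p (Bs (Suc (Suc q)) v) y = (if y q \<in> I \<and> y (Suc q) = - y q then
      - (sg q y * sn (y q)) * (sg p y * (\<Sum>z\<in>I. v (ins p z (del q y)))) else 0)"
    by (cases "y q \<in> I \<and> y (Suc q) = - y q")
      (simp_all only: simp_thms if_True if_False sum.neutral_const mult_zero_right sum_negf mult.left_commute mult.assoc mult_minus_left mult_minus_right flip: sum_distrib_left)
  then show "Bs q (B p v) y = (- B p (Bs (Suc (Suc q)) v)) y" using q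
    by (simp add: B_def[of p v] Bs_def[of q])
qed

lemma S_Bs_far: "p \<le> q \<Longrightarrow> S (Suc (Suc q)) (Bs p v) = Bs p (S q v)"
proof
  fix y assume q: "p \<le> q"
  have "del p (tr (Suc (Suc q)) y) = tr q (del p y)" using q by (auto simp: tr_def del_def fun_eq_iff)
  moreover have "tr (Suc (Suc q)) y p = y p" "tr (Suc (Suc q)) y (Suc p) = y (Suc p)"
      "del p y q = y (Suc (Suc q))" "del p y (Suc q) = y (Suc (Suc (Suc q)))"
    using q by (auto simp: tr_def del_def)
  ultimately show "S (Suc (Suc q)) (Bs p v) y = Bs p (S q v) y" using q
    by (simp add: S_def Bs_def)
qed

lemma B_Bs_far: "p \<le> q \<Longrightarrow> B (Suc (Suc q)) (Bs p v) = - Bs p (B q v)"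
proof
  fix y assume q: "p \<le> q"
  have 1: "del p (ins (Suc (Suc q)) z y) = ins q z (del p y)" for z
    using q by (auto simp: ins_def del_def fun_eq_iff SS_diff)
  have 2: "ins (Suc (Suc q)) z y p = y p" "ins (Suc (Suc q)) z y (Suc p) = y (Suc p)" for z using q by (auto simp: ins_def)
  show "B (Suc (Suc q)) (Bs p v) y = (- Bs p (B q v)) y"
  proof (cases "y p \<in> I \<and> y (Suc p) = - y p")
    case True
    then show ?thesis using q
      by (simp add: B_def Bs_def 1 2 sg_high I_nz mult.commute mult.left_commute flip: sum_distrib_left)
  next
    case False
    then have "Bs p v (ins (Suc (Suc q)) z y) = 0" for z by (simp only: Bs_def 2 if_False)
    moreover have "Bs p (B q v) y = 0" using False by (simp only: Bs_def if_False)
    ultimately show ?thesis by (simp add: B_def[of "Suc (Suc q)"])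
  qed
qed

lemma Bs_Bs_far: "p \<le> q \<Longrightarrow> Bs (Suc (Suc q)) (Bs p v) = - Bs p (Bs q v)"
proof
  fix y assume q: "p \<le> q"
  have 1: "del p (del (Suc (Suc q)) y) = del q (del p y)"
    using q by (auto simp: ins_def del_def fun_eq_iff SS_diff)
  have 2: "del (Suc (Suc q)) y p = y p" "del (Suc (Suc q)) y (Suc p) = y (Suc p)"
     "del p y q = y (Suc (Suc q))" "del p y (Suc q) = y (Suc (Suc (Suc q)))" using q by (auto simp: del_def)
  show "Bs (Suc (Suc q)) (Bs p v) y = (- Bs p (Bs q v)) y" using q
    by (simp add: Bs_def 1 2 sg_high I_nz mult.commute mult.left_commute)
qed

lemma van_ops [simp]:
  assumes "van v" shows "van (S p v)" "van (Bs p v)" "van (B p v)"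
proof -
  show "van (S p v)" unfolding van_def
  proof (intro allI impI)
    fix y :: lseq and i assume "y i \<notin> I"
    moreover have "tr p y (if i = p then Suc p else if i = Suc p then p else i) = y i" by (auto simp: tr_def)
    ultimately have "tr p y (if i = p then Suc p else if i = Suc p then p else i) \<notin> I" by simp
    then show "S p v y = 0" using assms by (auto simp: van_def S_def)
  qed
  show "van (B p v)" unfolding van_def
  proof (intro allI impI)
    fix y :: lseq and i assume "y i \<notin> I"
    then have "ins p z y (if i < p then i else Suc (Suc i)) \<notin> I" for z by (simp add: ins_def)
    then have "v (ins p z y) = 0" for z using assms unfolding van_def by blast
    then show "B p v y = 0" by (auto simp: B_def)
  qed
  show "van (Bs p v)" unfolding van_def
  proof (intro allI impI)
    fix y :: lseq and i assume y: "y i \<notin> I"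
    show "Bs p v y = 0"
    proof (cases "y p \<in> I \<and> y (Suc p) = - y p")
      case True
      then have "i \<noteq> p" "i \<noteq> Suc p" using y by auto
      then have "del p y (if i < p then i else i - 2) = y i"
        by (auto simp: del_def SS_diff)
      then have "v (del p y) = 0" using assms y unfolding van_def by metis
      then show ?thesis by (simp add: Bs_def)
    qed (auto simp: Bs_def)
  qed
qed

lemma van_add [simp]: "van v \<Longrightarrow> van w \<Longrightarrow> van (v + w)" "van 0" "van v \<Longrightarrow> van (- v)"
  by (auto simp: van_def)

section \<open>Jucys-Murphy elements satisfy the relations of dots\<close>

text \<open>The Jucys-Murphy elements: the recursion is relation R4, so that \<open>Y p\<close> acts as a dot on strand \<open>p\<close>
  once the strands to its left are regarded as part of the module.\<close>

primrec Y :: "nat \<Rightarrow> (lseq \<Rightarrow> complex) \<Rightarrow> (lseq \<Rightarrow> complex)" where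
  "Y 0 v = 0"
| "Y (Suc p) v = S p (Y p (S p v)) + S p v + Bs p (B p v)"

lemma Y_add [simp]: "Y p (v + w) = Y p v + Y p w" "Y p (- v) = - Y p v" "Y p 0 = 0"
  by (induction p arbitrary: v w) auto

lemma van_Y [simp]: "van v \<Longrightarrow> van (Y p v)"
  by (induction p arbitrary: v) auto

lemma Y_S_right: "p < q \<Longrightarrow> Y p (S q v) = S q (Y p v)"
proof (induction p arbitrary: v)
  case (Suc p)
  obtain r where r: "q = Suc (Suc r)" "p \<le> r" using Suc.prems by (cases q; cases "q - 1") auto
  have "S p (S q v) = S q (S p v)" "B p (S q v) = S r (B p v)" "Bs p (S r v) = S q (Bs p v)" for v
    using r by (simp_all add: S_S_far S_B_far S_Bs_far)
  moreover have "Y p (S q v) = S q (Y p v)" for v using Suc by simp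
  ultimately show ?case by (simp only: Y.simps(2) S_add)
qed simp

lemma Y_B_right: "p < q \<Longrightarrow> Y p (B q v) = B q (Y p v)"
proof (induction p arbitrary: v)
  case (Suc p)
  obtain r where r: "q = Suc (Suc r)" "p \<le> r" using Suc.prems by (cases q; cases "q - 1") auto
  have "S p (B q v) = B q (S p v)" "B p (B q v) = - B r (B p v)" "Bs p (B r v) = - B q (Bs p v)" for v
    using r by (simp_all add: B_S_far B_B_far B_Bs_far)
  moreover have "Y p (B q v) = B q (Y p v)" for v using Suc by simp
  ultimately show ?case by (simp only: Y.simps(2) B_add Bs_add minus_minus)
qed simp

lemma Y_Bs_right: "p < q \<Longrightarrow> Y p (Bs q v) = Bs q (Y p v)"
proof (induction p arbitrary: v)
  case (Suc p)
  obtain r where r: "q = Suc (Suc r)" "p \<le> r" using Suc.prems by (cases q; cases "q - 1") auto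
  have "S p (Bs q v) = Bs q (S p v)" "B p (Bs q v) = - Bs r (B p v)" "Bs p (Bs r v) = - Bs q (Bs p v)" for v
    using r by (simp_all add: Bs_S_far Bs_B_far Bs_Bs_far)
  moreover have "Y p (Bs q v) = Bs q (Y p v)" for v using Suc by simp
  ultimately show ?case by (simp only: Y.simps(2) Bs_add minus_minus)
qed simp

lemma Y_2: "Y (Suc (Suc p)) v = S (Suc p) (S p (Y p (S p (S (Suc p) v)))) + S (Suc p) (S p (S (Suc p) v)) +
   S (Suc p) (Bs p (B p (S (Suc p) v))) + S (Suc p) v + Bs (Suc p) (B (Suc p) v)"
  by simp

lemma cap_slide': "B (Suc p) (S p (S (Suc p) v)) = B p v"
  by (simp flip: cap_slide)

text \<open>In the base case \<open>Y_2\<close> has five terms. Passing \<open>S p\<close> through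
  them fixes the first, exchanges the two pure crossing terms, and exchanges the two cup-cap
  terms.\<close>

lemma Y_S_left: "Suc (Suc p) \<le> q \<Longrightarrow> Y q (S p v) = S p (Y q v)"
proof (induction q arbitrary: v rule: dec_induct)
  case base
  let ?S = "S p" and ?T = "S (Suc p)"
  have 1: "?T (?S (Y p (?S (?T (?S v))))) = ?S (?T (?S (Y p (?S (?T v)))))"
    by (simp add: braid Y_S_right)
  have 2: "?T (?S (?T (?S v))) = ?S (?T v)" by (simp flip: braid)
  have 3: "?T (Bs p (B p (?T (?S v)))) = ?S (Bs (Suc p) (B (Suc p) v))"
    by (simp add: cap_slide cup_slide)
  have 4: "?T (?S v) = ?S (?T (?S (?T v)))" by (simp add: braid)
  have 5: "Bs (Suc p) (B (Suc p) (?S v)) = ?S (?T (Bs p (B p (?T v))))"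
    by (simp add: cap_slide cup_slide)
  show ?case by (simp only: Y_2 S_add 1 2 3 5 4[symmetric] ac_simps)
next
  case (step q)
  have "S q (S p v) = S p (S q v)" "B q (S p v) = S p (B q v)" "Bs q (S p v) = S p (Bs q v)" for v
    using step by (simp_all add: S_S_far B_S_far Bs_S_far)
  then show ?case by (simp only: Y.simps(2) S_add step.IH)
qed

text \<open>Of the five terms in \<open>Y_2\<close> only the first survives the cap. The snakes turn
  the cup-cap terms into the negatives of the crossing terms: the inner one cancels the single
  crossing, the outer one cancels the triple product.\<close>

lemma Y_B_left: "p \<le> q \<Longrightarrow> van v \<Longrightarrow> B p (Y (Suc (Suc q)) v) = Y q (B p v)"
proof (induction q arbitrary: v rule: dec_induct)
  case base
  let ?S = "S p" and ?T = "S (Suc p)"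
  have 1: "B p (?T (?S (Y p (?S (?T v))))) = Y p (B p v)"
    by (simp add: cap_slide Y_B_right[symmetric] cap_slide')
  have 2: "B p (?T (?S (?T v))) = B (Suc p) v" by (simp add: braid[symmetric]) (simp add: cap_slide)
  have 3: "B p (?T (Bs p (B p (?T v)))) = - B p (?T v)" using base by (simp add: cap_slide snake2)
  have 5: "B p (Bs (Suc p) (B (Suc p) v)) = - B (Suc p) v" using base by (simp add: snake1)
  show ?case by (simp only: Y_2 B_add 1 2 3 5) simp
next
  case (step q)
  have 1: "B p (S (Suc (Suc q)) v) = S q (B p v)" "B p (B (Suc (Suc q)) v) = - B q (B p v)"
     "B p (Bs (Suc (Suc q)) v) = - Bs q (B p v)" for v
    using step by (simp_all add: S_B_far B_B_far Bs_B_far)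
  show ?case using step.IH[of "S (Suc (Suc q)) v"] step.prems
    by (simp only: Y.simps(2)[of "Suc (Suc q)"] Y.simps(2)[of q] B_add Bs_add 1 van_ops minus_minus)
qed

text \<open>The same cancellation as for \<open>Y_B_left\<close>, with the cup below the five terms
  instead of the cap above them.\<close>

lemma Y_Bs_left: "p \<le> q \<Longrightarrow> van v \<Longrightarrow> Y (Suc (Suc q)) (Bs p v) = Bs p (Y q v)"
proof (induction q arbitrary: v rule: dec_induct)
  case base
  let ?S = "S p" and ?T = "S (Suc p)"
  have 1: "?T (?S (Y p (?S (?T (Bs p v))))) = Bs p (Y p v)"
    by (simp add: cup_slide Y_Bs_right) (simp flip: cup_slide)
  have 2: "?T (?S (?T (Bs p v))) = - Bs (Suc p) v" by (simp add: braid[symmetric]) (simp add: cup_slide)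
  have 3: "?T (Bs p (B p (?T (Bs p v)))) = - ?T (Bs p v)" using base by (simp add: cup_slide snake1)
  have 5: "Bs (Suc p) (B (Suc p) (Bs p v)) = Bs (Suc p) v" using base by (simp add: snake2)
  show ?case by (simp only: Y_2 B_add 1 2 3 5) simp
next
  case (step q)
  have 1: "S (Suc (Suc q)) (Bs p v) = Bs p (S q v)" "B (Suc (Suc q)) (Bs p v) = - Bs p (B q v)"
     "Bs (Suc (Suc q)) (Bs p v) = - Bs p (Bs q v)" for v
    using step by (simp_all add: S_Bs_far B_Bs_far Bs_Bs_far)
  show ?case using step.IH[of "S q v"] step.prems
    by (simp only: Y.simps(2)[of "Suc (Suc q)"] Y.simps(2)[of q] S_add B_add Bs_add 1 van_ops minus_minus)
qed

text \<open>\<open>Y p\<close> is built from crossings, cups and caps at positions that lie to the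
  left of strand \<open>q\<close>, and the previous lemmas move \<open>Y q\<close> past each of
  them.\<close>

lemma Y_Y: "p < q \<Longrightarrow> van v \<Longrightarrow> Y p (Y q v) = Y q (Y p v)"
proof (induction p arbitrary: v)
  case (Suc p)
  obtain r where r: "q = Suc (Suc r)" "p \<le> r" using Suc.prems by (cases q; cases "q - 1") auto
  have "S p (Y q v) = Y q (S p v)" for v using Y_S_left[of p q v] r by simp
  moreover have "Y p (Y q (S p v)) = Y q (Y p (S p v))" by (rule Suc.IH) (use Suc.prems in auto)
  ultimately have 1: "S p (Y q v) = Y q (S p v)" "S p (Y p (Y q (S p v))) = Y q (S p (Y p (S p v)))"
    by (simp_all only:)
  have "B p (Y q v) = Y r (B p v)" using Y_B_left[of p r v] r Suc.prems by (simp only:)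
  then have 2: "Bs p (B p (Y q v)) = Y q (Bs p (B p v))"
    using Y_Bs_left[of p r "B p v"] r Suc.prems by (simp only: van_ops)
  show ?case by (simp only: Y.simps(2) 1 2 Y_add)
qed simp

text \<open>This says that the first term of the recursion for \<open>Y (Suc p)\<close> acts under a
  cap like a dot on the left leg. It is what remains to be proved for the cap relation in
  R4.\<close>

lemma B_S_Y: "van v \<Longrightarrow> B p (S p (Y p (S p v))) = B p (Y p v)"
proof (induction p arbitrary: v)
  case (Suc p)
  let ?S = "S p" and ?T = "S (Suc p)"
  have "B (Suc p) (?S (Y p (?S (?T v)))) = B p (?T (Y p (?S (?T v))))" by (simp add: cap_slide)
  also have "\<dots> = B p (Y p (?T (?S (?T v))))" by (simp add: Y_S_right)
  also have "\<dots> = B p (Y p (?S (?T (?S v))))" by (simp add: braid)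
  also have "\<dots> = B p (Y p (?T (?S v)))" using Suc.IH[of "?T (?S v)"] Suc.prems by simp
  also have "\<dots> = B (Suc p) (?S (Y p (?S v)))" by (simp add: Y_S_right cap_slide)
  finally have 1: "B (Suc p) (?S (Y p (?S (?T v)))) = B (Suc p) (?S (Y p (?S v)))" .
  show ?case using Suc.prems
    by (simp only: Y.simps(2) S_add B_add 1 cap_slide' snake2 van_ops B_S) (simp add: cap_slide fun_eq_iff)
qed simp

text \<open>The crossing term contributes \<open>B p v\<close>, because the cap absorbs a crossing,
  and the cup-cap term vanishes together with the loop.\<close>

lemma B_Y: "van v \<Longrightarrow> B p (Y (Suc p) v) = B p (Y p v) + B p v"
  using B_S_Y[of v p] by simp

end

text \<open>The values \<open>h\<close> on words define a linear functional on finitely supported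
  functions. Finiteness of the support is carried along since sums over infinite sets are 0 by
  convention.\<close>

lemma lspan_induct_finite:
  assumes "x \<in> lspan G" and fin: "\<And>g. g \<in> G \<Longrightarrow> finite {w. g w \<noteq> 0} \<and> (\<Sum>w | g w \<noteq> 0. g w * h w) = (0::complex)"
  shows "finite {w. x w \<noteq> 0} \<and> (\<Sum>w | x w \<noteq> 0. x w * h w) = 0"
  using assms(1)
proof (induction rule: lspan.induct)
  case (lspan_step g x c)
  let ?A = "{w. g w \<noteq> 0} \<union> {w. x w \<noteq> 0}"
  have A: "finite ?A" using fin[OF lspan_step(1)] lspan_step(3) by simp
  have ext: "(\<Sum>w | z w \<noteq> 0. z w * h w) = (\<Sum>w\<in>?A. z w * h w)" if "{w. z w \<noteq> 0} \<subseteq> ?A" for z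
    using A that by (intro sum.mono_neutral_left) auto
  have sub: "{w. c * g w + x w \<noteq> 0} \<subseteq> ?A" by auto
  have "(\<Sum>w\<in>?A. (c * g w + x w) * h w) = c * (\<Sum>w\<in>?A. g w * h w) + (\<Sum>w\<in>?A. x w * h w)"
    by (simp add: sum.distrib sum_distrib_left algebra_simps)
  then have "(\<Sum>w | c * g w + x w \<noteq> 0. (c * g w + x w) * h w) = 0"
    using ext[OF sub] ext[of g] ext[of x] fin[OF lspan_step(1)] lspan_step(3) by auto
  then show ?case using A sub finite_subset by blast
qed simp

lemma basis_comb:
  "finite {x. (\<Sum>(c, w)\<leftarrow>ts. c * basis_vec w x) \<noteq> 0} \<and>
   (\<Sum>x | (\<Sum>(c, w)\<leftarrow>ts. c * basis_vec w x) \<noteq> 0. (\<Sum>(c, w)\<leftarrow>ts. c * basis_vec w x) * h x) = (\<Sum>(c, w)\<leftarrow>ts. c * h w)"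
proof -
  let ?f = "\<lambda>x. (\<Sum>(c, w)\<leftarrow>ts. c * basis_vec w x)"
  have sub: "{x. ?f x \<noteq> 0} \<subseteq> snd ` set ts"
  proof
    fix x assume "x \<in> {x. ?f x \<noteq> 0}"
    moreover have "x \<notin> snd ` set ts \<Longrightarrow> ?f x = 0" by (induction ts) (auto simp: basis_vec_def)
    ultimately show "x \<in> snd ` set ts" by blast
  qed
  have "(\<Sum>x\<in>A. ?f x * h x) = (\<Sum>(c, w)\<leftarrow>ts. c * h w)" if "finite A" "snd ` set ts \<subseteq> A" for A
    using that(2)
  proof (induction ts)
    case (Cons t ts)
    obtain c w where t: "t = (c, w)" by (cases t)
    have "(\<Sum>x\<in>A. c * basis_vec w x * h x) = c * h w"
      using that(1) Cons.prems t by (simp add: basis_vec_def if_distrib if_distribR cong: if_cong)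
    then show ?case using Cons t by (simp add: algebra_simps sum.distrib)
  qed simp
  moreover have "(\<Sum>x | ?f x \<noteq> 0. ?f x * h x) = (\<Sum>x\<in>snd ` set ts. ?f x * h x)"
    using sub by (intro sum.mono_neutral_left) auto
  ultimately show ?thesis using sub finite_subset by (metis (no_types, lifting) List.finite_set finite_imageI order_refl)
qed

context labels
begin

text \<open>The diagram acts on the strands to the right of \<open>N\<close> auxiliary strands.\<close>

fun lop :: "nat \<Rightarrow> layer \<Rightarrow> (lseq \<Rightarrow> complex) \<Rightarrow> (lseq \<Rightarrow> complex)" where
  "lop N (p, GS, q) v = S (N + p) v"
| "lop N (p, GB, q) v = B (N + p) v"
| "lop N (p, GBs, q) v = Bs (N + p) v"
| "lop N (p, GY, q) v = Y (N + p) v"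

primrec F :: "nat \<Rightarrow> layer list \<Rightarrow> (lseq \<Rightarrow> complex) \<Rightarrow> (lseq \<Rightarrow> complex)" where
  "F N [] v = v"
| "F N (l # ls) v = F N ls (lop N l v)"

lemma F_append [simp]: "F N (ls @ ls') v = F N ls' (F N ls v)"
  by (induction ls arbitrary: v) auto

lemma lop_add: "lop N l (v + w) = lop N l v + lop N l w" "lop N l (- v) = - lop N l v" "lop N l 0 = 0"
  by (cases "(N, l, v)" rule: lop.cases; simp)+

lemma van_lop [simp]: "van v \<Longrightarrow> van (lop N l v)"
  by (cases "(N, l, v)" rule: lop.cases; simp)

lemma F_add: "F N ls (v + w) = F N ls v + F N ls w" "F N ls (- v) = - F N ls v" "F N ls 0 = 0"
  by (induction ls arbitrary: v w) (auto simp: lop_add)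

lemma van_F [simp]: "van v \<Longrightarrow> van (F N ls v)"
  by (induction ls arbitrary: v) auto

text \<open>The widths to the right of the generators are left free because \<open>lop\<close>
  ignores them; this is the benefit of infinite label sequences.\<close>

lemma lop_interchange:
  assumes "van v"
  shows "lop N (P + gtgt f + r, g, q) (lop N (P, f, q') v) =
    (if gpar f * gpar g = 1 then - lop N (P, f, s) (lop N (P + gsrc f + r, g, s') v)
     else lop N (P, f, s) (lop N (P + gsrc f + r, g, s') v))"
proof -
  have "Y (Suc (N + P + r)) (Y (N + P) v) = Y (N + P) (Y (Suc (N + P + r)) v)"
    using Y_Y[of "N + P" "Suc (N + P + r)" v, OF _ assms] by simp
  then show ?thesis using assms
    by (cases f; cases g; simp del: Y.simps add: S_S_far B_S_far Bs_S_far S_B_far B_B_far Bs_B_far S_Bs_far B_Bs_far Bs_Bs_far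
       Y_S_right Y_B_right Y_Bs_right Y_S_left Y_B_left Y_Bs_left add.assoc[symmetric])
qed

definition ev :: "nat \<Rightarrow> lseq \<Rightarrow> lseq \<Rightarrow> word \<Rightarrow> complex" where
  "ev N x y w = F N (snd w) (\<lambda>z. if z = x then 1 else 0) y"

lemma relation_ev:
  assumes ts: "ts \<in> set sVW_relations" and x: "range x \<subseteq> I"
  shows "(\<Sum>(c, l)\<leftarrow>ts. c * ev N x y (a, u @ shift_layers p q l @ v)) = 0"
proof -
  let ?w = "F N u (\<lambda>z. if z = x then 1 else 0)"
  have "van (\<lambda>z. if z = x then 1 else 0)" using x by (auto simp: van_def)
  then have w: "van ?w" by simp
  have B_Y': "F N v (B (N + p) (Y (Suc (N + p)) ?w)) y = F N v (B (N + p) (Y (N + p) ?w)) y + F N v (B (N + p) ?w) y"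
    by (simp only: B_Y[OF w] F_add plus_fun_apply)
  show ?thesis using ts w B_Y'
    by (auto simp: sVW_relations_def ev_def shift_layers_def braid snake1 snake2 cup_slide F_add simp del: Y.simps)
       (simp_all add: F_add)
qed

lemma rel_space_ev:
  assumes "z \<in> rel_space a b" "range x \<subseteq> I"
  shows "finite {w. z w \<noteq> 0} \<and> (\<Sum>w | z w \<noteq> 0. z w * ev N x y w) = 0"
  using assms(1) unfolding rel_space_def
proof (rule lspan_induct_finite)
  fix g assume "g \<in> relation_gens a b \<union> interchange_gens a b"
  then show "finite {w. g w \<noteq> 0} \<and> (\<Sum>w | g w \<noteq> 0. g w * ev N x y w) = 0"
  proof
    assume "g \<in> relation_gens a b"
    then obtain u p q ts v where g: "g = rel_instance a u p q ts v" and ts: "ts \<in> set sVW_relations"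
      unfolding relation_gens_def by blast
    let ?ts = "map (\<lambda>(c, l). (c, (a, u @ shift_layers p q l @ v))) ts"
    have "g = (\<lambda>x. \<Sum>(c, w)\<leftarrow>?ts. c * basis_vec w x)"
      unfolding g rel_instance_eq map_map by (intro ext arg_cong[of _ _ sum_list] map_cong) auto
    moreover have "(\<Sum>(c, w)\<leftarrow>?ts. c * ev N x y w) = 0"
      using relation_ev[OF ts assms(2), of N y a u p q v] by (simp add: o_def case_prod_unfold)
    ultimately show ?thesis using basis_comb[of ?ts "ev N x y"] by simp
  next
    assume "g \<in> interchange_gens a b"
    then obtain u v P Q r f h where g: "g = (\<lambda>x. basis_vec (a, u @ [(P, f, r + gsrc h + Q), (P + gtgt f + r, h, Q)] @ v) x
          - (-1::complex) ^ (gpar f * gpar h) *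
            basis_vec (a, u @ [(P + gsrc f + r, h, Q), (P, f, r + gtgt h + Q)] @ v) x)"
      unfolding interchange_gens_def by blast
    let ?ts = "[(1, (a, u @ [(P, f, r + gsrc h + Q), (P + gtgt f + r, h, Q)] @ v)),
      (- ((-1) ^ (gpar f * gpar h)), (a, u @ [(P + gsrc f + r, h, Q), (P, f, r + gtgt h + Q)] @ v))]"
    have "g = (\<lambda>x. \<Sum>(c, w)\<leftarrow>?ts. c * basis_vec w x)" unfolding g by auto
    moreover have "(\<Sum>(c, w)\<leftarrow>?ts. c * ev N x y w) = 0"
    proof -
      let ?w = "F N u (\<lambda>z. if z = x then 1 else 0)"
      have "van (\<lambda>z. if z = x then 1 else 0)" using assms(2) by (auto simp: van_def)
      then have w: "van ?w" by simp
      have "(- 1::complex) ^ (gpar f * gpar h) = (if gpar f * gpar h = 1 then -1 else 1)" by (cases f; cases h; simp)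
      then show ?thesis
        using lop_interchange[OF w, of N P f r h Q "r + gsrc h + Q" "r + gtgt h + Q" Q] by (auto simp: ev_def F_add)
    qed
    ultimately show ?thesis using basis_comb[of ?ts "ev N x y"] by (simp only:)
  qed
qed

end

section \<open>Dots acting on labels\<close>

text \<open>Unfolding its recursion, a Jucys-Murphy element is a signed sum over the strands
  \<open>j\<close> to the left of transpositions and cup-cap contractions. \<open>sw\<close> and
  \<open>pc\<close> turn an output sequence into the inputs of such terms.\<close>

definition sw :: "nat \<Rightarrow> nat \<Rightarrow> lseq \<Rightarrow> lseq" where "sw j p y = y(j := y p, p := y j)"
definition pc :: "nat \<Rightarrow> nat \<Rightarrow> int \<Rightarrow> lseq \<Rightarrow> lseq" where "pc j p z y = y(j := z, p := - z)"

definition unit :: "complex \<Rightarrow> bool" where "unit c \<longleftrightarrow> c = 1 \<or> c = -1"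

lemma unit_simps [simp]: "unit 1" "unit (-1)" "unit a \<Longrightarrow> unit b \<Longrightarrow> unit (a * b)" "unit (kap u v)" "unit (sn z)" "unit (sg p y)"
proof -
  show 1: "unit a \<Longrightarrow> unit b \<Longrightarrow> unit (a * b)" for a b by (auto simp: unit_def)
  show "unit (sn z)" for z by (simp add: unit_def sn_def)
  then show "unit (sg p y)" by (induction p) (auto simp: sg_Suc intro: 1, simp add: unit_def)
qed (auto simp: unit_def kap_def)

context labels
begin

text \<open>Conjugation by \<open>S p\<close> turns the terms for \<open>p\<close> into those for
  \<open>Suc p\<close> with the same \<open>j\<close>; the other two terms of the recursion supply
  \<open>j = p\<close>. For a fixed output \<open>y\<close> the coefficients do not depend on
  \<open>v\<close>.\<close>

lemma Y_coord:
  "\<exists>e h. (\<forall>j. unit (e j)) \<and> (\<forall>j z. unit (h j z)) \<and>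
    (\<forall>v. Y p v y = (\<Sum>j<p. e j * v (sw j p y) +
       (if y j \<in> I \<and> y j = - y p then \<Sum>z\<in>I. h j z * v (pc j p z y) else 0)))"
proof (induction p arbitrary: y)
  case (Suc p)
  let ?y = "tr p y"
  obtain e h where e: "\<forall>j. unit (e j)" and h: "\<forall>j z. unit (h j z)" and
    Y: "\<And>v. Y p v ?y = (\<Sum>j<p. e j * v (sw j p ?y) +
       (if ?y j \<in> I \<and> ?y j = - ?y p then \<Sum>z\<in>I. h j z * v (pc j p z ?y) else 0))"
    using Suc[of ?y] by blast
  let ?k = "kap (y p) (y (Suc p))"
  \<comment> \<open>The old coefficients acquire the Koszul signs of the two conjugating crossings;
    the new ones at \<open>j = p\<close> come from the single crossing and from the cup, where the
    two factors \<open>sg p y\<close> cancel.\<close>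
  define e' where "e' j = (if j = p then ?k else ?k * e j * kap (sw j p ?y p) (sw j p ?y (Suc p)))" for j
  define h' where "h' j z = (if j = p then sn (y p) else ?k * h j z * kap (pc j p z ?y p) (pc j p z ?y (Suc p)))" for j z
  have 1: "tr p (sw j p ?y) = sw j (Suc p) y" "tr p (pc j p z ?y) = pc j (Suc p) z y" "?y j = y j" if "j < p" for j z
    using that by (auto simp: tr_def sw_def pc_def fun_eq_iff)
  have 2: "?y p = y (Suc p)" "?y = sw p (Suc p) y" by (auto simp: tr_def sw_def fun_eq_iff)
  have 3: "ins p z (del p y) = pc p (Suc p) z y" for z
    by (auto simp: ins_def del_def pc_def fun_eq_iff SS_diff)
  have "Y (Suc p) v y = (\<Sum>j<Suc p. e' j * v (sw j (Suc p) y) +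
       (if y j \<in> I \<and> y j = - y (Suc p) then \<Sum>z\<in>I. h' j z * v (pc j (Suc p) z y) else 0))" for v
  proof -
    have a: "S p (Y p (S p v)) y = (\<Sum>j<p. e' j * v (sw j (Suc p) y) +
       (if y j \<in> I \<and> y j = - y (Suc p) then \<Sum>z\<in>I. h' j z * v (pc j (Suc p) z y) else 0))"
      unfolding S_def[of p "Y p _"] Y sum_distrib_left
      by (intro sum.cong refl)
        (auto simp: S_def 1 2(1) e'_def h'_def distrib_left sum_distrib_left mult.assoc)
    have b: "S p v y = e' p * v (sw p (Suc p) y)" by (simp add: S_def e'_def 2(2)[symmetric])
    have c: "Bs p (B p v) y = (if y p \<in> I \<and> y p = - y (Suc p) then \<Sum>z\<in>I. h' p z * v (pc p (Suc p) z y) else 0)"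
      by (auto simp: Bs_def B_def 3 h'_def sum_distrib_left mult.left_commute mult.assoc minus_equation_iff)
    show ?thesis unfolding Y.simps(2) plus_fun_apply a b c by (simp add: add.assoc)
  qed
  moreover have "\<forall>j. unit (e' j)" "\<forall>j z. unit (h' j z)" using e h by (auto simp: e'_def h'_def)
  ultimately show ?case by blast
qed (auto intro!: exI[of _ "\<lambda>_. 1"] exI[of _ "\<lambda>_ _. 1"])

text \<open>The pairs of an input \<open>x\<close> and an output \<open>y\<close> between which a
  layer may have a nonzero matrix entry. Signs are dropped, and for a dot distinct choices might
  still cancel.\<close>

fun step :: "nat \<Rightarrow> layer \<Rightarrow> lseq \<Rightarrow> lseq \<Rightarrow> bool" where
  "step N (p, GS, q) x y \<longleftrightarrow> x = tr (N + p) y"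
| "step N (p, GB, q) x y \<longleftrightarrow> (\<exists>z\<in>I. x = ins (N + p) z y)"
| "step N (p, GBs, q) x y \<longleftrightarrow> y (N + p) \<in> I \<and> y (Suc (N + p)) = - y (N + p) \<and> x = del (N + p) y"
| "step N (p, GY, q) x y \<longleftrightarrow> (\<exists>j < N + p. x = sw j (N + p) y \<or> (\<exists>z\<in>I. y j = - y (N + p) \<and> x = pc j (N + p) z y))"

lemma lop_nonzero:
  assumes "lop N l v y \<noteq> 0"
  shows "\<exists>x. step N l x y \<and> v x \<noteq> 0"
proof -
  obtain p g q where l: "l = (p, g, q)" by (cases l)
  show ?thesis
  proof (cases g)
    case GS
    then show ?thesis using assms l by (auto simp: S_def)
  next
    case GB
    then obtain z where "z \<in> I" "v (ins (N + p) z y) \<noteq> 0"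
      using assms l by (auto simp: B_def elim: sum.not_neutral_contains_not_neutral)
    then show ?thesis using GB l by auto
  next
    case GBs
    then show ?thesis using assms l by (auto simp: Bs_def split: if_splits)
  next
    case GY
    obtain e h where "Y (N + p) v y = (\<Sum>j<N + p. e j * v (sw j (N + p) y) +
       (if y j \<in> I \<and> y j = - y (N + p) then \<Sum>z\<in>I. h j z * v (pc j (N + p) z y) else 0))"
      using Y_coord[of "N + p" y] by blast
    then have "(\<Sum>j<N + p. e j * v (sw j (N + p) y) +
       (if y j \<in> I \<and> y j = - y (N + p) then \<Sum>z\<in>I. h j z * v (pc j (N + p) z y) else 0)) \<noteq> 0"
      using assms l GY by simp
    then obtain j where j: "j < N + p" "e j * v (sw j (N + p) y) +
       (if y j \<in> I \<and> y j = - y (N + p) then \<Sum>z\<in>I. h j z * v (pc j (N + p) z y) else 0) \<noteq> 0"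
      by (meson lessThan_iff sum.not_neutral_contains_not_neutral)
    show ?thesis
    proof (cases "v (sw j (N + p) y) = 0")
      case True
      then have "y j = - y (N + p)" "(\<Sum>z\<in>I. h j z * v (pc j (N + p) z y)) \<noteq> 0" using j by (auto split: if_splits)
      then obtain z where "z \<in> I" "v (pc j (N + p) z y) \<noteq> 0"
        by (metis (no_types, lifting) mult_zero_right sum.not_neutral_contains_not_neutral)
      then show ?thesis using j GY l \<open>y j = - y (N + p)\<close> by auto
    qed (use j GY l in auto)
  qed
qed

text \<open>Every entry of a dotless layer is 1 or -1, so if only one possible input lies in the
  support of \<open>v\<close>, nothing can cancel.\<close>

lemma lop_single:
  assumes "gen_of l \<noteq> GY" "step N l x y" "\<And>x'. step N l x' y \<Longrightarrow> v x' \<noteq> 0 \<Longrightarrow> x' = x"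
  shows "\<exists>e. unit e \<and> lop N l v y = e * v x"
proof -
  obtain p g q where l: "l = (p, g, q)" by (cases l)
  show ?thesis
  proof (cases g)
    case GS
    then show ?thesis using assms l by (intro exI[of _ "kap (y (N + p)) (y (Suc (N + p)))"]) (simp add: S_def)
  next
    case GB
    obtain z where z: "z \<in> I" "x = ins (N + p) z y" using assms(2) l GB by auto
    have "v (ins (N + p) w y) = 0" if "w \<in> I - {z}" for w
    proof -
      have "ins (N + p) w y (N + p) \<noteq> ins (N + p) z y (N + p)" using that by (simp add: ins_def)
      then have "ins (N + p) w y \<noteq> x" using z by metis
      moreover have "step N l (ins (N + p) w y) y" using that l GB by auto
      ultimately show ?thesis using assms(3) by blast
    qed
    then have "(\<Sum>w\<in>I. v (ins (N + p) w y)) = v x"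
      using z finite_I by (simp add: sum.remove[of I z])
    then show ?thesis using l GB by (intro exI[of _ "sg (N + p) y"]) (simp add: B_def)
  next
    case GBs
    then show ?thesis using assms l by (intro exI[of _ "sg (N + p) y * sn (y (N + p))"]) (simp add: Bs_def)
  qed (use assms l in auto)
qed

lemma dot_single:
  assumes "r < N + p"
    and "\<And>j. j < N + p \<Longrightarrow> v (sw j (N + p) y) \<noteq> 0 \<Longrightarrow> j = r"
    and "\<And>j z. j < N + p \<Longrightarrow> z \<in> I \<Longrightarrow> y j = - y (N + p) \<Longrightarrow> v (pc j (N + p) z y) = 0"
  shows "\<exists>e. unit e \<and> lop N (p, GY, q) v y = e * v (sw r (N + p) y)"
proof -
  obtain e h where e: "\<forall>j. unit (e j)" and Y: "Y (N + p) v y = (\<Sum>j<N + p. e j * v (sw j (N + p) y) +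
     (if y j \<in> I \<and> y j = - y (N + p) then \<Sum>z\<in>I. h j z * v (pc j (N + p) z y) else 0))"
    using Y_coord[of "N + p" y] by blast
  note Y
  also have "(\<Sum>j<N + p. e j * v (sw j (N + p) y) +
     (if y j \<in> I \<and> y j = - y (N + p) then \<Sum>z\<in>I. h j z * v (pc j (N + p) z y) else 0))
      = (\<Sum>j<N + p. if j = r then e r * v (sw r (N + p) y) else 0)"
    using assms(2,3) by (intro sum.cong) (auto intro!: sum.neutral)
  also have "\<dots> = e r * v (sw r (N + p) y)" using assms(1) by simp
  finally show ?thesis using e by auto
qed

primrec reach :: "nat \<Rightarrow> layer list \<Rightarrow> lseq \<Rightarrow> lseq \<Rightarrow> bool" where
  "reach N [] x y \<longleftrightarrow> x = y"
| "reach N (l # ls) x y \<longleftrightarrow> (\<exists>z. step N l x z \<and> reach N ls z y)"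

lemma reach_append: "reach N (ls @ ls') x y \<longleftrightarrow> (\<exists>z. reach N ls x z \<and> reach N ls' z y)"
  by (induction ls arbitrary: x) auto

lemma F_nonzero: "F N ls v y \<noteq> 0 \<Longrightarrow> \<exists>x. v x \<noteq> 0 \<and> reach N ls x y"
proof (induction ls arbitrary: v)
  case (Cons l ls)
  then obtain x where "lop N l v x \<noteq> 0" "reach N ls x y" by force
  then show ?case using lop_nonzero by fastforce
qed auto

lemma step_low: "step N l x y \<Longrightarrow> gen_of l \<noteq> GY \<Longrightarrow> r < N \<Longrightarrow> x r = y r"
  by (cases "(N, l, x, y)" rule: step.cases) (auto simp: tr_def ins_def del_def)

lemma reach_low: "reach N ls x y \<Longrightarrow> undotted ls \<Longrightarrow> r < N \<Longrightarrow> x r = y r"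
  by (induction ls arbitrary: x) (auto simp: undotted_def dest: step_low)

end

text \<open>\<open>chg\<close> counts the auxiliary labels in which two sequences differ,
  \<open>chgc\<close> only those whose class is \<open>c\<close>. The class of a label will name the
  string it belongs to.\<close>

definition chg :: "nat \<Rightarrow> lseq \<Rightarrow> lseq \<Rightarrow> nat" where
  "chg N x y = card {r. r < N \<and> x r \<noteq> y r}"
definition chgc :: "nat \<Rightarrow> (int \<Rightarrow> nat) \<Rightarrow> nat \<Rightarrow> lseq \<Rightarrow> lseq \<Rightarrow> nat" where
  "chgc N cl c x y = card {r. r < N \<and> x r \<noteq> y r \<and> cl (y r) = c}"
definition hcl :: "nat \<Rightarrow> (int \<Rightarrow> nat) \<Rightarrow> lseq \<Rightarrow> lseq \<Rightarrow> bool" where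
  "hcl N cl x y \<longleftrightarrow> (\<forall>r<N. cl (x r) = cl (y r))"
definition alldots :: "layer list \<Rightarrow> bool" where
  "alldots ls \<longleftrightarrow> (\<forall>l\<in>set ls. gen_of l = GY)"

context labels
begin

text \<open>A dot touches one strand besides its own, and the other layers touch no auxiliary strand
  at all.\<close>

lemma step_dot_le:
  assumes "step N l x z"
  shows "chg N x y \<le> Suc (chg N z y)"
proof -
  obtain p g q where l: "l = (p, g, q)" by (cases l)
  obtain j where j: "\<forall>r. r < N \<and> r \<noteq> j \<longrightarrow> x r = z r"
  proof (cases "g = GY")
    case True
    then obtain j where "x = sw j (N + p) z \<or> (\<exists>w. x = pc j (N + p) w z)" using assms l by auto
    then have "\<forall>r. r < N \<and> r \<noteq> j \<longrightarrow> x r = z r" by (auto simp: sw_def pc_def)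
    then show ?thesis by (rule that)
  next
    case False
    then show ?thesis using assms l that step_low[of N l x z] by auto
  qed
  have "{r. r < N \<and> x r \<noteq> y r} \<subseteq> insert j {r. r < N \<and> z r \<noteq> y r}" using j by auto
  then have "chg N x y \<le> card (insert j {r. r < N \<and> z r \<noteq> y r})"
    unfolding chg_def by (intro card_mono) auto
  also have "\<dots> \<le> Suc (chg N z y)" unfolding chg_def by (rule card_insert_le_m1) auto
  finally show ?thesis .
qed

lemma reach_chg_le: "reach N ls x z \<Longrightarrow> alldots ls \<Longrightarrow> chg N x y \<le> length ls + chg N z y"
proof (induction ls arbitrary: x)
  case (Cons l ls)
  then obtain w where w: "step N l x w" "reach N ls w z" by auto
  have "chg N x y \<le> Suc (chg N w y)" by (rule step_dot_le[OF w(1)])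
  also have "chg N w y \<le> length ls + chg N z y" using Cons w by (simp add: alldots_def)
  finally show ?case by simp
qed simp

lemma chg_low: "(\<And>r. r < N \<Longrightarrow> x r = z r) \<Longrightarrow> chg N x y = chg N z y"
  unfolding chg_def by (rule arg_cong[of _ _ card]) auto

lemma chgc_low: "(\<And>r. r < N \<Longrightarrow> x r = z r) \<Longrightarrow> chgc N cl c x y = chgc N cl c z y"
  unfolding chgc_def by (rule arg_cong[of _ _ card]) auto

text \<open>If a dot brings the auxiliary labels closer to the target, its partner must be an
  auxiliary strand which afterwards carries its target label. The two alternatives at the end are
  exchange and contraction.\<close>

lemma dot_step:
  assumes "step N (p, GY, q) x z" and lt: "chg N z y < chg N x y"
  shows "\<exists>r<N. x r \<noteq> y r \<and> z r = y r \<and> (\<forall>i. i \<noteq> r \<and> i \<noteq> N + p \<longrightarrow> x i = z i) \<and>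
    (x (N + p) = z r \<and> x r = z (N + p) \<or> z r = - z (N + p) \<and> x (N + p) = - x r)"
proof -
  obtain r where r: "r < N + p" and c: "x = sw r (N + p) z \<or> (\<exists>w\<in>I. z r = - z (N + p) \<and> x = pc r (N + p) w z)"
    using assms(1) by auto
  have i: "\<forall>i. i \<noteq> r \<and> i \<noteq> N + p \<longrightarrow> x i = z i" using c by (auto simp: sw_def pc_def)
  have "r < N"
  proof (rule ccontr)
    assume "\<not> r < N"
    then have "chg N x y = chg N z y" using i by (intro chg_low) auto
    then show False using lt by simp
  qed
  moreover have "x r \<noteq> y r \<and> z r = y r"
  proof (rule ccontr)
    assume "\<not> (x r \<noteq> y r \<and> z r = y r)"
    then have "{r. r < N \<and> x r \<noteq> y r} \<subseteq> {r. r < N \<and> z r \<noteq> y r}" using i by auto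
    then have "chg N x y \<le> chg N z y" unfolding chg_def by (intro card_mono) auto
    then show False using lt by simp
  qed
  moreover have "x (N + p) = z r \<and> x r = z (N + p) \<or> z r = - z (N + p) \<and> x (N + p) = - x r"
    using c \<open>r < N\<close> by (auto simp: sw_def pc_def)
  ultimately show ?thesis using i by blast
qed

text \<open>As there are no more dots than auxiliary labels to be changed, each dot changes exactly one of them,
  and this preserves the class of the label on the dotted strand.\<close>

lemma dots_reach:
  assumes "reach N ls x z" "alldots ls" "chg N x y = length ls + chg N z y" "hcl N cl x y"
    and cl: "\<And>u. cl (- u) = cl u"
  shows "hcl N cl z y \<and> (\<forall>i\<ge>N. cl (z i) = cl (x i)) \<and>
    chgc N cl c x y = chgc N cl c z y + length (filter (\<lambda>l. cl (x (N + lpos l)) = c) ls) \<and>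
    (\<forall>i\<ge>N. (\<forall>l\<in>set ls. N + lpos l \<noteq> i) \<longrightarrow> z i = x i)"
  using assms(1-4)
proof (induction ls arbitrary: x)
  case (Cons l ls)
  obtain p q where l: "l = (p, GY, q)" using Cons.prems(2) by (cases l) (auto simp: alldots_def)
  obtain w where w: "step N (p, GY, q) x w" "reach N ls w z" using Cons.prems l by auto
  have ad: "alldots ls" using Cons.prems by (simp add: alldots_def)
  have "chg N x y \<le> Suc (chg N w y)" by (rule step_dot_le[OF w(1)])
  moreover have "chg N w y \<le> length ls + chg N z y" by (rule reach_chg_le[OF w(2) ad])
  ultimately have t: "chg N w y < chg N x y" "chg N w y = length ls + chg N z y" using Cons.prems(3) by auto
  obtain r where r: "r < N" "x r \<noteq> y r" "w r = y r" and i: "\<And>i. i \<noteq> r \<Longrightarrow> i \<noteq> N + p \<Longrightarrow> x i = w i" and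
    d: "x (N + p) = w r \<and> x r = w (N + p) \<or> w r = - w (N + p) \<and> x (N + p) = - x r"
    using dot_step[OF w(1) t(1)] by blast
  have H: "cl (x r) = cl (y r)" if "r < N" for r using Cons.prems(4) that by (auto simp: hcl_def)
  have c: "cl (w (N + p)) = cl (x (N + p))" and cy: "cl (y r) = cl (x (N + p))"
    using d H[OF r(1)] r(3) cl by metis+
  have hw: "hcl N cl w y" unfolding hcl_def
  proof (intro allI impI)
    fix s assume "s < N"
    then show "cl (w s) = cl (y s)" using H[of s] i[of s] r by (cases "s = r") auto
  qed
  have clw: "cl (w j) = cl (x j)" if "N \<le> j" for j using i[of j] c r that by (cases "j = N + p") auto
  have "{s. s < N \<and> x s \<noteq> y s \<and> cl (y s) = c} =
      (if cl (x (N + p)) = c then insert r {s. s < N \<and> w s \<noteq> y s \<and> cl (y s) = c} else {s. s < N \<and> w s \<noteq> y s \<and> cl (y s) = c})"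
    using i r cy by (auto split: if_splits) (metis add_lessD1 less_irrefl not_add_less1)+
  then have "chgc N cl c x y = chgc N cl c w y + (if cl (x (N + p)) = c then 1 else 0)"
    using r by (auto simp: chgc_def)
  moreover have "hcl N cl z y \<and> (\<forall>i\<ge>N. cl (z i) = cl (w i)) \<and>
    chgc N cl c w y = chgc N cl c z y + length (filter (\<lambda>l. cl (w (N + lpos l)) = c) ls) \<and>
    (\<forall>i\<ge>N. (\<forall>l\<in>set ls. N + lpos l \<noteq> i) \<longrightarrow> z i = w i)"
    by (rule Cons.IH[OF w(2) ad t(2) hw])
  moreover have "filter (\<lambda>l. cl (w (N + lpos l)) = c) ls = filter (\<lambda>l. cl (x (N + lpos l)) = c) ls"
    using clw by (intro filter_cong) auto
  ultimately show ?case using l clw i r(1) by auto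
qed auto

end

section \<open>Labellings of loop-free diagrams\<close>

fun up :: "layer \<Rightarrow> nat \<Rightarrow> nat \<Rightarrow> bool" where
  "up (p, g, q) j k \<longleftrightarrow> (j < p \<and> k = j) \<or> (\<exists>t<q. j = p + gsrc g + t \<and> k = p + gtgt g + t) \<or>
     (g = GS \<and> (j = p \<and> k = Suc p \<or> j = Suc p \<and> k = p)) \<or> (g = GY \<and> j = p \<and> k = p)"
text \<open>Symmetric in the two legs, as is \<open>cupp\<close>, so that a string can be traversed
  through a cap or cup from either side.\<close>

fun capp :: "layer \<Rightarrow> nat \<Rightarrow> nat \<Rightarrow> bool" where
  "capp (p, g, q) j k \<longleftrightarrow> g = GB \<and> (j = p \<and> k = Suc p \<or> j = Suc p \<and> k = p)"
fun cupp :: "layer \<Rightarrow> nat \<Rightarrow> nat \<Rightarrow> bool" where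
  "cupp (p, g, q) j k \<longleftrightarrow> g = GBs \<and> (j = p \<and> k = Suc p \<or> j = Suc p \<and> k = p)"

lemma up_fun: "up l j k \<Longrightarrow> up l j k' \<Longrightarrow> k = k'" "up l j k \<Longrightarrow> up l j' k \<Longrightarrow> j = j'"
  by (cases l; cases "fst (snd l)"; force)+

lemma capp_fun: "capp l j k \<Longrightarrow> capp l j k' \<Longrightarrow> k = k'" "capp l j k \<Longrightarrow> capp l k j" "\<not> capp l j j"
   "up l j k \<Longrightarrow> \<not> capp l j k'"
  by (cases l; force)+

lemma cupp_fun: "cupp l j k \<Longrightarrow> cupp l j k' \<Longrightarrow> k = k'" "cupp l j k \<Longrightarrow> cupp l k j" "\<not> cupp l j j"
   "up l j k \<Longrightarrow> \<not> cupp l k k'"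
  by (cases l; force)+

lemma adj_iff: "adj ls (i, j) (i', k) \<or> adj ls (i', k) (i, j) \<longleftrightarrow>
   (i < length ls \<and> i' = Suc i \<and> up (ls ! i) j k) \<or> (i' < length ls \<and> i = Suc i' \<and> up (ls ! i') k j) \<or>
   (i < length ls \<and> i' = i \<and> capp (ls ! i) j k) \<or> (\<exists>m<length ls. i = Suc m \<and> i' = i \<and> cupp (ls ! m) j k)"
proof -
  have 1: "adj ls (i, j) (i', k) \<longleftrightarrow> (i < length ls \<and> i' = Suc i \<and> up (ls ! i) j k) \<or>
    (i < length ls \<and> i' = i \<and> (\<exists>p q. ls ! i = (p, GB, q) \<and> j = p \<and> k = Suc p)) \<or>
    (\<exists>m<length ls. i = Suc m \<and> i' = i \<and> (\<exists>p q. ls ! m = (p, GBs, q) \<and> j = p \<and> k = Suc p))" for i j i' k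
  proof -
    have "(\<exists>p g q. ls ! m = (p, g, q) \<and>
        ((\<exists>t. t < p \<and> (i, j) = (m, t) \<and> (i', k) = (Suc m, t)) \<or>
         (\<exists>t. t < q \<and> (i, j) = (m, p + gsrc g + t) \<and> (i', k) = (Suc m, p + gtgt g + t)) \<or>
         g = GS \<and> ((i, j) = (m, p) \<and> (i', k) = (Suc m, Suc p) \<or> (i, j) = (m, Suc p) \<and> (i', k) = (Suc m, p)) \<or>
         g = GY \<and> (i, j) = (m, p) \<and> (i', k) = (Suc m, p) \<or>
         g = GB \<and> (i, j) = (m, p) \<and> (i', k) = (m, Suc p) \<or>
         g = GBs \<and> (i, j) = (Suc m, p) \<and> (i', k) = (Suc m, Suc p))) \<longleftrightarrow>
      (i = m \<and> i' = Suc m \<and> up (ls ! m) j k) \<or>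
      (i = m \<and> i' = m \<and> (\<exists>p q. ls ! m = (p, GB, q) \<and> j = p \<and> k = Suc p)) \<or>
      (i = Suc m \<and> i' = Suc m \<and> (\<exists>p q. ls ! m = (p, GBs, q) \<and> j = p \<and> k = Suc p))" for m
    proof -
      obtain p g q where l: "ls ! m = (p, g, q)" by (cases "ls ! m")
      show ?thesis unfolding l by (cases g) (simp_all, blast+)
    qed
    then show ?thesis unfolding adj_def by (simp only:) blast
  qed
  have 2: "capp l j k \<longleftrightarrow> (\<exists>p q. l = (p, GB, q) \<and> j = p \<and> k = Suc p) \<or> (\<exists>p q. l = (p, GB, q) \<and> k = p \<and> j = Suc p)" for l
    by (cases l) auto
  have 3: "cupp l j k \<longleftrightarrow> (\<exists>p q. l = (p, GBs, q) \<and> j = p \<and> k = Suc p) \<or> (\<exists>p q. l = (p, GBs, q) \<and> k = p \<and> j = Suc p)" for l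
    by (cases l) auto
  show ?thesis unfolding 1 2 3 by blast
qed

section \<open>Strings traversed with a direction\<close>

text \<open>A dart is a point of a diagram together with a direction of travel (\<open>True\<close> is upwards).\<close>

type_synonym dart = "(nat \<times> nat) \<times> bool"

fun dstep :: "layer list \<Rightarrow> dart \<Rightarrow> dart \<Rightarrow> bool" where
  "dstep ls ((i, j), s) ((i', k), t) \<longleftrightarrow>
     (s \<and> t \<and> i < length ls \<and> i' = Suc i \<and> up (ls ! i) j k) \<or>
     (\<not> s \<and> \<not> t \<and> i' < length ls \<and> i = Suc i' \<and> up (ls ! i') k j) \<or>
     (s \<and> \<not> t \<and> i < length ls \<and> i' = i \<and> capp (ls ! i) j k) \<or>
     (\<not> s \<and> t \<and> (\<exists>m<length ls. i = Suc m \<and> i' = i \<and> cupp (ls ! m) j k))"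

fun rev_dart :: "dart \<Rightarrow> dart" where "rev_dart (v, s) = (v, \<not> s)"

lemma rev_rev_dart [simp]: "rev_dart (rev_dart d) = d" by (cases d) auto

lemma dstep_det: "dstep ls d e \<Longrightarrow> dstep ls d f \<Longrightarrow> e = f"
  by (cases d rule: rev_dart.cases; cases e rule: rev_dart.cases; cases f rule: rev_dart.cases)
    (auto dest: up_fun capp_fun(1,2,4) cupp_fun(1,2,4))

lemma dstep_rev: "dstep ls d e \<Longrightarrow> dstep ls (rev_dart e) (rev_dart d)"
proof -
  have s: "capp l j k \<longleftrightarrow> capp l k j" "cupp l j k \<longleftrightarrow> cupp l k j" for l j k
    using capp_fun(2) cupp_fun(2) by blast+
  assume d: "dstep ls d e"
  obtain i j u i' k t where "d = ((i, j), u)" "e = ((i', k), t)" by (metis prod.exhaust)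
  then show ?thesis using d s[of _ j k] by (cases u; cases t) auto
qed

lemma dstep_codet: "dstep ls d f \<Longrightarrow> dstep ls e f \<Longrightarrow> d = e"
  using dstep_det[of ls "rev_dart f" "rev_dart d" "rev_dart e"] dstep_rev by (metis rev_rev_dart)

lemma dstep_not_rev: "\<not> dstep ls d (rev_dart d)"
  by (cases d rule: rev_dart.cases) (auto simp: capp_fun cupp_fun)

text \<open>A string never runs through the same point in both directions: peel off the first and the last
  step, which reverse each other.\<close>
lemma dart_not_rev: "\<not> (dstep ls)\<^sup>*\<^sup>* d (rev_dart d)"
proof
  assume "(dstep ls)\<^sup>*\<^sup>* d (rev_dart d)"
  then obtain n where "(dstep ls ^^ n) d (rev_dart d)" using rtranclp_imp_relpowp by metis
  then show False
  proof (induction n arbitrary: d rule: less_induct)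
    case (less n)
    consider "n = 0" | "n = Suc 0" | m where "n = Suc (Suc m)" by (cases n; cases "n - 1") auto
    then show ?case
    proof cases
      case 1
      then show ?thesis using less.prems by (cases d) auto
    next
      case 2
      then show ?thesis using less.prems dstep_not_rev by auto
    next
      case 3
      then obtain e' where e': "(dstep ls ^^ Suc m) d e'" "dstep ls e' (rev_dart d)"
        using less.prems by (auto elim: relpowp_Suc_E)
      obtain e where e: "dstep ls d e" "(dstep ls ^^ m) e e'" using relpowp_Suc_D2[OF e'(1)] by blast
      have "e = rev_dart e'" using dstep_det[OF e(1)] dstep_rev[OF e'(2)] by simp
      then have "e' = rev_dart e" by simp
      then show ?thesis using less.IH[of m e] 3 e(2) by simp
    qed
  qed
qed

definition dconn :: "layer list \<Rightarrow> dart \<Rightarrow> dart \<Rightarrow> bool" where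
  "dconn ls = (\<lambda>d e. dstep ls d e \<or> dstep ls e d)\<^sup>*\<^sup>*"

text \<open>A step between darts is deterministic in both directions, so any turn back in an
  undirected connection retraces the step just made and can be cancelled.\<close>

lemma dconn_cases: "dconn ls d e \<Longrightarrow> (dstep ls)\<^sup>*\<^sup>* d e \<or> (dstep ls)\<^sup>*\<^sup>* e d"
  unfolding dconn_def
proof (induction rule: rtranclp_induct)
  case (step e f)
  then show ?case
  proof (elim disjE)
    assume 1: "(dstep ls)\<^sup>*\<^sup>* d e" "dstep ls f e"
    show ?thesis
    proof (cases "d = e")
      case False
      then obtain g where "(dstep ls)\<^sup>*\<^sup>* d g" "dstep ls g e" using 1 by (metis rtranclp.cases)
      then show ?thesis using dstep_codet[of ls g e f] 1 by auto
    qed (use 1 in auto)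
  next
    assume 1: "(dstep ls)\<^sup>*\<^sup>* e d" "dstep ls e f"
    show ?thesis
    proof (cases "d = e")
      case False
      then obtain g where "(dstep ls)\<^sup>*\<^sup>* g d" "dstep ls e g" using 1 by (metis converse_rtranclpE)
      then show ?thesis using dstep_det[of ls e g f] 1 by auto
    qed (use 1 in auto)
  qed (auto intro: converse_rtranclp_into_rtranclp rtranclp.rtrancl_into_rtrancl)
qed auto

lemma dconn_refl [simp]: "dconn ls d d" by (simp add: dconn_def)
lemma dconn_sym: "dconn ls d e \<Longrightarrow> dconn ls e d"
  unfolding dconn_def by (induction rule: rtranclp_induct) (auto intro: converse_rtranclp_into_rtranclp)
lemma dconn_trans: "dconn ls d e \<Longrightarrow> dconn ls e f \<Longrightarrow> dconn ls d f"
  unfolding dconn_def by (rule rtranclp_trans)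
lemma dconn_rev: "dconn ls d e \<Longrightarrow> dconn ls (rev_dart d) (rev_dart e)"
  unfolding dconn_def by (induction rule: rtranclp_induct) (auto dest: dstep_rev intro: rtranclp.rtrancl_into_rtrancl)
lemma dconn_step: "dstep ls d e \<Longrightarrow> dconn ls d e" by (auto simp: dconn_def)

lemma dconn_not_rev: "\<not> dconn ls (v, True) (v, False)"
  using dconn_cases[of ls "(v, True)" "(v, False)"] dart_not_rev[of ls "(v, True)"] dart_not_rev[of ls "(v, False)"]
  by auto

lemma str_conn_dconn: "str_conn ls v w \<Longrightarrow> \<exists>t. dconn ls (v, s) (w, t)"
  unfolding str_conn_def
proof (induction rule: rtranclp_induct)
  case (step w u)
  then obtain t where t: "dconn ls (v, s) (w, t)" by blast
  obtain i j i' k where wu: "w = (i, j)" "u = (i', k)" by (cases w; cases u)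
  have "\<exists>t'. dstep ls (w, t) (u, t') \<or> dstep ls (u, t') (w, t)"
    using step(2) unfolding wu adj_iff
  proof (elim disjE conjE exE)
    assume "i < length ls" "i' = Suc i" "up (ls ! i) j k"
    then show "\<exists>t'. dstep ls ((i, j), t) ((i', k), t') \<or> dstep ls ((i', k), t') ((i, j), t)"
      by (intro exI[of _ t], cases t) simp_all
  next
    assume "i' < length ls" "i = Suc i'" "up (ls ! i') k j"
    then show "\<exists>t'. dstep ls ((i, j), t) ((i', k), t') \<or> dstep ls ((i', k), t') ((i, j), t)"
      by (intro exI[of _ t], cases t) simp_all
  next
    assume "i < length ls" "i' = i" "capp (ls ! i) j k"
    moreover have "capp (ls ! i) k j" using calculation(3) by (rule capp_fun(2))
    ultimately show "\<exists>t'. dstep ls ((i, j), t) ((i', k), t') \<or> dstep ls ((i', k), t') ((i, j), t)"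
      by (intro exI[of _ "\<not> t"], cases t) simp_all
  next
    fix m assume "m < length ls" "i = Suc m" "i' = i" "cupp (ls ! m) j k"
    moreover have "cupp (ls ! m) k j" using calculation(4) by (rule cupp_fun(2))
    ultimately show "\<exists>t'. dstep ls ((i, j), t) ((i', k), t') \<or> dstep ls ((i', k), t') ((i, j), t)"
      by (intro exI[of _ "\<not> t"], cases t) simp_all
  qed
  then show ?case using t dconn_step dconn_sym dconn_trans by metis
qed (use dconn_refl in blast)

lemma dconn_str_conn: "dconn ls (v, s) (w, t) \<Longrightarrow> str_conn ls v w"
proof -
  have "dconn ls d e \<Longrightarrow> str_conn ls (fst d) (fst e)" for d e
    unfolding dconn_def
  proof (induction rule: rtranclp_induct)
    case (step e f)
    have "dstep ls d e \<Longrightarrow> adj ls (fst d) (fst e) \<or> adj ls (fst e) (fst d)" for d e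
    proof -
      assume s: "dstep ls d e"
      obtain i j s i' k t where "d = ((i, j), s)" "e = ((i', k), t)" by (metis prod.exhaust)
      then show ?thesis using s adj_iff[of ls i j i' k] by auto
    qed
    then have "adj ls (fst e) (fst f) \<or> adj ls (fst f) (fst e)" using step(2) by blast
    then show ?case using step(3) unfolding str_conn_def by (intro rtranclp.rtrancl_into_rtrancl[OF step(3)[unfolded str_conn_def]])
  qed (simp add: str_conn_def)
  then show "dconn ls (v, s) (w, t) \<Longrightarrow> ?thesis" by fastforce
qed

lemma str_conn_sym: "str_conn ls v w \<Longrightarrow> str_conn ls w v"
  unfolding str_conn_def by (induction rule: rtranclp_induct) (auto intro: converse_rtranclp_into_rtranclp)
lemma str_conn_trans: "str_conn ls v w \<Longrightarrow> str_conn ls w u \<Longrightarrow> str_conn ls v u"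
  unfolding str_conn_def by (rule rtranclp_trans)

fun opp_side :: "endpt \<Rightarrow> endpt \<Rightarrow> bool" where
  "opp_side (Bot i) (Top j) = True"
| "opp_side (Top i) (Bot j) = True"
| "opp_side _ _ = False"

lemma endpt_source:
  "\<not> dstep ls d ((0, j), True)" "\<not> dstep ls ((0, j), False) d"
  "\<not> dstep ls d ((length ls, j), False)" "\<not> dstep ls ((length ls, j), True) d"
  by (cases d rule: rev_dart.cases; auto)+

text \<open>An upward dart at the bottom can only start a traversal and an upward dart at the top
  can only end one, with the roles reversed for downward darts. As one of the two ends starts and
  the other finishes, the positions of the ends determine the direction.\<close>

lemma endpt_dconn:
  assumes "dconn ls (vert ls e, True) (vert ls e', t)" "e \<noteq> e'"
  shows "t \<longleftrightarrow> opp_side e e'"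
proof (cases "(vert ls e, True) = (vert ls e', t)")
  case True
  then show ?thesis using assms(2) by (cases e; cases e') auto
next
  case False
  have F: "(\<exists>g. dstep ls d g) \<and> (\<exists>g. dstep ls g f)" if "(dstep ls)\<^sup>*\<^sup>* d f" "d \<noteq> f" for d f
    using that by (metis converse_rtranclpE rtranclp.cases)
  have "(\<exists>g. dstep ls (vert ls e, True) g) \<and> (\<exists>g. dstep ls g (vert ls e', t)) \<or>
      (\<exists>g. dstep ls (vert ls e', t) g) \<and> (\<exists>g. dstep ls g (vert ls e, True))"
    using dconn_cases[OF assms(1)] F False by metis
  then show ?thesis
    by (cases e; cases e'; cases t) (auto simp: endpt_source simp del: dstep.simps)
qed

lemma width_at_simps:
  assumes "valid_from a ls"
  shows "i < length ls \<Longrightarrow> width_at a ls i = lsrc (ls ! i)" "i < length ls \<Longrightarrow> width_at a ls (Suc i) = ltgt (ls ! i)"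
    "width_at a ls (length ls) = end_obj a ls" "width_at a ls 0 = a"
proof -
  show "i < length ls \<Longrightarrow> width_at a ls i = lsrc (ls ! i)"
    using assms
  proof (induction ls arbitrary: a i)
    case (Cons l ls)
    show ?case
    proof (cases i)
      case (Suc m)
      then have "width_at (ltgt l) ls m = lsrc (ls ! m)" using Cons by auto
      then show ?thesis using Suc by (cases m) (auto simp: width_at_def)
    qed (use Cons.prems in \<open>auto simp: width_at_def\<close>)
  qed simp
  show "width_at a ls (length ls) = end_obj a ls" using assms
  proof (induction ls arbitrary: a)
    case (Cons l ls)
    then have "width_at (ltgt l) ls (length ls) = end_obj (ltgt l) ls" by simp
    then show ?case by (cases ls) (auto simp: width_at_def)
  qed (simp add: width_at_def)
qed (auto simp: width_at_def)

lemma adj_vertices: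
  assumes "valid_from a ls" "adj ls (i, j) (i', k) \<or> adj ls (i', k) (i, j)"
  shows "(i, j) \<in> vertices a ls"
proof -
  have u: "up l j k \<Longrightarrow> j < lsrc l \<and> k < ltgt l" "capp l j k \<Longrightarrow> j < lsrc l" "cupp l j k \<Longrightarrow> j < ltgt l" for l j k
    by (cases l; auto)+
  show ?thesis using assms(2) unfolding adj_iff vertices_def
    by (auto simp: width_at_simps(1,2)[OF assms(1)] dest: u)
qed

text \<open>Labels are transported along strings from the boundary and negated on darts pointing
  downwards. Loop-freeness ensures that every point is reached; consistency holds because no string
  passes a point in both directions.\<close>

lemma labelling_exists:
  fixes bl :: "endpt \<Rightarrow> int"
  assumes valid: "valid_from a ls" and lf: "loop_free a b ls" and hc: "has_connector a b ls c" and c: "c \<in> Conn a b"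
    and bl: "\<And>e. e \<in> endpts a b \<Longrightarrow> bl (c e) = (if opp_side e (c e) then bl e else - bl e)"
  shows "\<exists>L. (\<forall>e\<in>endpts a b. L (vert ls e) = bl e) \<and>
    (\<forall>v\<in>vertices a ls. \<exists>e\<in>endpts a b. L v = bl e \<or> L v = - bl e) \<and>
    (\<forall>i<length ls. \<forall>j k. (up (ls ! i) j k \<longrightarrow> L (i, j) = L (Suc i, k)) \<and>
       (capp (ls ! i) j k \<longrightarrow> L (i, k) = - L (i, j)) \<and> (cupp (ls ! i) j k \<longrightarrow> L (Suc i, k) = - L (Suc i, j)))"
proof -
  define R where "R v l \<longleftrightarrow> (\<exists>e\<in>endpts a b. \<exists>s. dconn ls (vert ls e, True) (v, s) \<and> l = (if s then bl e else - bl e))" for v l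
  have conn: "c e = e'" if "e \<in> endpts a b" "e' \<in> endpts a b" "e \<noteq> e'" "str_conn ls (vert ls e) (vert ls e')" for e e'
    using hc that by (auto simp: has_connector_def)
  have key: "bl e' = (if t then bl e else - bl e)"
    if e: "e \<in> endpts a b" "e' \<in> endpts a b" and d: "dconn ls (vert ls e, True) (vert ls e', t)" for e e' t
  proof (cases "e = e'")
    case True
    then have t using d dconn_not_rev by (cases t) auto
    then show ?thesis using True by simp
  next
    case False
    then have "c e = e'" using conn e dconn_str_conn[OF d] by blast
    then show ?thesis using bl[OF e(1)] endpt_dconn[OF d False] by simp
  qed
  have rev': "dconn ls (v, s) (w, t) \<Longrightarrow> dconn ls (v, \<not> s) (w, \<not> t)" for v s w t
    using dconn_rev[of ls "(v, s)" "(w, t)"] by simp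
  have uniq: "l = l'" if l: "R v l" "R v l'" for v l l'
  proof -
    obtain e s where e: "e \<in> endpts a b" "dconn ls (vert ls e, True) (v, s)" "l = (if s then bl e else - bl e)"
      using l(1) unfolding R_def by blast
    obtain e' s' where e': "e' \<in> endpts a b" "dconn ls (vert ls e', True) (v, s')" "l' = (if s' then bl e' else - bl e')"
      using l(2) unfolding R_def by blast
    \<comment> \<open>If the two traversals meet at \<open>v\<close> with opposite directions, the
      second one is reversed before they are joined.\<close>
    have "dconn ls (vert ls e, True) (vert ls e', s = s')"
    proof (cases "s = s'")
      case True
      then show ?thesis using dconn_trans[OF e(2) dconn_sym] e'(2) by simp
    next
      case False
      then have "dconn ls (vert ls e', False) (v, s)" using rev'[OF e'(2)] by (cases s; cases s') auto
      then show ?thesis using dconn_trans[OF e(2) dconn_sym] False by simp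
    qed
    from key[OF e(1) e'(1) this] show ?thesis unfolding e(3) e'(3) by (cases s; cases s'; simp)
  qed
  have ex: "\<exists>l. R v l" if v: "v \<in> vertices a ls" for v
  proof -
    obtain e where e: "e \<in> endpts a b" "str_conn ls v (vert ls e)" using lf v unfolding loop_free_def by blast
    then obtain t where "dconn ls (vert ls e, True) (v, t)" using str_conn_dconn[OF str_conn_sym[OF e(2)]] by blast
    then show ?thesis using e(1) unfolding R_def by blast
  qed
  define L where "L v = (THE l. R v l)" for v
  have L: "L v = l" if "R v l" for v l
    unfolding L_def by (rule the_equality[of "R v", OF that]) (rule uniq[OF _ that])
  have R_step: "R w (if s = t then l else - l)" if R: "R v l" and d: "dconn ls (v, s) (w, t)" for v w s t l
  proof -
    obtain e u where e: "e \<in> endpts a b" "dconn ls (vert ls e, True) (v, u)" "l = (if u then bl e else - bl e)"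
      using R unfolding R_def by blast
    have "dconn ls (v, u) (w, if s = t then u else \<not> u)"
      using d rev'[OF d] by (cases s; cases t; cases u; simp)
    then have "dconn ls (vert ls e, True) (w, if s = t then u else \<not> u)" by (rule dconn_trans[OF e(2)])
    moreover have "(if s = t then l else - l) = (if (if s = t then u else \<not> u) then bl e else - bl e)"
      unfolding e(3) by simp
    ultimately show ?thesis unfolding R_def using e(1) by blast
  qed
  have step: "L w = (if s = t then L v else - L v)" if "dstep ls (v, s) (w, t)" for v w s t
  proof -
    obtain i j i' k where vw: "v = (i, j)" "w = (i', k)" by (cases v; cases w)
    have "adj ls v w \<or> adj ls w v" using that unfolding vw adj_iff by auto
    then have "v \<in> vertices a ls" using adj_vertices[OF valid] unfolding vw by blast
    then obtain l where l: "R v l" using ex by blast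
    show ?thesis using L[OF l] L[OF R_step[OF l dconn_step[OF that]]] by simp
  qed
  have "L (vert ls e) = bl e" if "e \<in> endpts a b" for e
    using that by (intro L) (unfold R_def, intro bexI[of _ e] exI[of _ True], auto)
  moreover have "\<exists>e\<in>endpts a b. L v = bl e \<or> L v = - bl e" if v: "v \<in> vertices a ls" for v
  proof -
    obtain l where l: "R v l" using ex[OF v] by blast
    obtain e s where "e \<in> endpts a b" "l = (if s then bl e else - bl e)" using l unfolding R_def by blast
    then show ?thesis using L[OF l] by (intro bexI[of _ e]) auto
  qed
  moreover have "L (i, j) = L (Suc i, k)" if "i < length ls" "up (ls ! i) j k" for i j k
    using step[of "(i, j)" True "(Suc i, k)" True] that by simp
  moreover have "L (i, k) = - L (i, j)" if "i < length ls" "capp (ls ! i) j k" for i j k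
    using step[of "(i, j)" True "(i, k)" False] that by simp
  moreover have "L (Suc i, k) = - L (Suc i, j)" if "i < length ls" "cupp (ls ! i) j k" for i j k
    using step[of "(Suc i, j)" False "(Suc i, k)" True] that by simp
  ultimately show ?thesis by blast
qed

context labels
begin

section \<open>Label histories through an undotted diagram\<close>

definition path :: "nat \<Rightarrow> layer list \<Rightarrow> (nat \<Rightarrow> lseq) \<Rightarrow> bool" where
  "path N ls xs \<longleftrightarrow> (\<forall>i<length ls. step N (ls ! i) (xs i) (xs (Suc i)))"

lemma path_snoc: "path N (ls @ [l]) xs \<longleftrightarrow> path N ls xs \<and> step N l (xs (length ls)) (xs (Suc (length ls)))"
  unfolding path_def by (auto simp: nth_append less_Suc_eq)

lemma path_cong: "(\<And>i. i \<le> length ls \<Longrightarrow> xs i = zs i) \<Longrightarrow> path N ls xs \<longleftrightarrow> path N ls zs"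
  unfolding path_def by auto

lemma reach_path: "reach N ls x y \<Longrightarrow> \<exists>xs. path N ls xs \<and> xs 0 = x \<and> xs (length ls) = y"
proof (induction ls arbitrary: y rule: rev_induct)
  case (snoc l ls)
  then obtain z where "reach N ls x z" and z: "step N l z y" by (auto simp: reach_append)
  then obtain xs where xs: "path N ls xs" "xs 0 = x" "xs (length ls) = z" using snoc.IH by blast
  let ?zs = "xs(Suc (length ls) := y)"
  have "path N ls ?zs" using xs(1) by (subst path_cong[of ls ?zs xs]) simp_all
  then have "path N (ls @ [l]) ?zs" using z xs by (simp add: path_snoc)
  moreover have "?zs 0 = x" "?zs (length (ls @ [l])) = y" using xs by simp_all
  ultimately show ?case by (intro exI[of _ ?zs] conjI)
next
  case Nil
  then show ?case by (intro exI[of _ "\<lambda>_. x"]) (simp add: path_def)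
qed

text \<open>A matrix coefficient is a sum over histories of signed terms. If a single history ends
  in the given output and starts in the support of \<open>v\<close>, then one term is left.\<close>

lemma F_unique_path:
  assumes "undotted ls" "path N ls xs"
    and "\<And>zs. path N ls zs \<Longrightarrow> zs (length ls) = xs (length ls) \<Longrightarrow> v (zs 0) \<noteq> 0 \<Longrightarrow> \<forall>i\<le>length ls. zs i = xs i"
  shows "\<exists>e. unit e \<and> F N ls v (xs (length ls)) = e * v (xs 0)"
  using assms
proof (induction ls rule: rev_induct)
  case Nil
  show ?case by (intro exI[of _ 1]) simp
next
  case (snoc l ls)
  let ?n = "length ls"
  have p: "path N ls xs" "step N l (xs ?n) (xs (Suc ?n))" using snoc.prems(2) by (auto simp: path_snoc)
  have u: "undotted ls" "gen_of l \<noteq> GY" using snoc.prems(1) by (auto simp: undotted_def)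
  have lift: "\<forall>i\<le>?n. zs i = xs i" if zs: "path N ls zs" "v (zs 0) \<noteq> 0" "step N l (zs ?n) (xs (Suc ?n))" for zs
  proof -
    let ?zs = "zs(Suc ?n := xs (Suc ?n))"
    have "path N ls ?zs" using zs(1) by (subst path_cong[of ls ?zs zs]) simp_all
    then have "path N (ls @ [l]) ?zs" using zs by (simp add: path_snoc)
    moreover have "?zs (length (ls @ [l])) = xs (length (ls @ [l]))" "v (?zs 0) \<noteq> 0" using zs by simp_all
    ultimately have "\<forall>i\<le>length (ls @ [l]). ?zs i = xs i" by (rule snoc.prems(3))
    then show ?thesis
    proof (intro allI impI)
      fix i assume "\<forall>i\<le>length (ls @ [l]). ?zs i = xs i" "i \<le> ?n"
      then have "i \<le> length (ls @ [l])" "i \<noteq> Suc ?n" by simp_all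
      then show "zs i = xs i" using \<open>\<forall>i\<le>length (ls @ [l]). ?zs i = xs i\<close> by (metis fun_upd_other)
    qed
  qed
  have "\<exists>e. unit e \<and> lop N l (F N ls v) (xs (Suc ?n)) = e * F N ls v (xs ?n)"
  proof (rule lop_single[OF u(2) p(2)])
    fix x' assume x': "step N l x' (xs (Suc ?n))" "F N ls v x' \<noteq> 0"
    obtain x where x: "v x \<noteq> 0" "reach N ls x x'" using F_nonzero[OF x'(2)] by blast
    obtain zs where zs: "path N ls zs" "zs 0 = x" "zs ?n = x'" using reach_path[OF x(2)] by blast
    have "v (zs 0) \<noteq> 0" unfolding zs(2) by (rule x(1))
    moreover have "step N l (zs ?n) (xs (Suc ?n))" unfolding zs(3) by (rule x'(1))
    ultimately have "\<forall>i\<le>?n. zs i = xs i" by (rule lift[OF zs(1)])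
    then have "zs ?n = xs ?n" by blast
    then show "x' = xs ?n" unfolding zs(3) .
  qed
  then obtain e where e: "unit e" "lop N l (F N ls v) (xs (Suc ?n)) = e * F N ls v (xs ?n)" by (elim exE conjE)
  have "\<exists>e. unit e \<and> F N ls v (xs ?n) = e * v (xs 0)"
  proof (rule snoc.IH[OF u(1) p(1)])
    fix zs assume zs: "path N ls zs" "zs ?n = xs ?n" "v (zs 0) \<noteq> 0"
    have "step N l (zs ?n) (xs (Suc ?n))" unfolding zs(2) by (rule p(2))
    then show "\<forall>i\<le>?n. zs i = xs i" by (rule lift[OF zs(1,3)])
  qed
  then obtain e' where "unit e'" "F N ls v (xs ?n) = e' * v (xs 0)" by (elim exE conjE)
  then show ?case using e by (intro exI[of _ "e * e'"]) simp
qed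

lemma step_rel:
  assumes "step N l x z" "gen_of l \<noteq> GY"
  shows "r < N \<Longrightarrow> x r = z r" "up l j k \<Longrightarrow> x (N + j) = z (N + k)" "capp l j k \<Longrightarrow> x (N + k) = - x (N + j)"
    "cupp l j k \<Longrightarrow> z (N + k) = - z (N + j)" "x (N + lsrc l + t) = z (N + ltgt l + t)"
proof -
  obtain p g q where l: "l = (p, g, q)" by (cases l)
  show "r < N \<Longrightarrow> x r = z r" using step_low[OF assms] .
  show "up l j k \<Longrightarrow> x (N + j) = z (N + k)" using assms l by (cases g) (auto simp: tr_def ins_def del_def)
  show "capp l j k \<Longrightarrow> x (N + k) = - x (N + j)" using assms l by (cases g) (auto simp: ins_def)
  show "cupp l j k \<Longrightarrow> z (N + k) = - z (N + j)" using assms l by (cases g) auto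
  show "x (N + lsrc l + t) = z (N + ltgt l + t)" using assms l by (cases g) (auto simp: tr_def ins_def del_def)
qed

lemma path_adj:
  assumes "path N ls xs" "undotted ls" "adj ls (i, j) (i', k) \<or> adj ls (i', k) (i, j)"
  shows "xs i' (N + k) = (if i = i' then - xs i (N + j) else xs i (N + j))"
proof -
  have s: "step N (ls ! m) (xs m) (xs (Suc m))" "gen_of (ls ! m) \<noteq> GY" if "m < length ls" for m
    using assms(1,2) that by (auto simp: path_def undotted_def)
  from assms(3) show ?thesis unfolding adj_iff
  proof (elim disjE conjE exE)
    assume "i < length ls" "i' = Suc i" "up (ls ! i) j k"
    then show ?thesis using step_rel(2)[OF s, of i j k] by simp
  next
    assume "i' < length ls" "i = Suc i'" "up (ls ! i') k j"
    then show ?thesis using step_rel(2)[OF s, of i' k j] by simp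
  next
    assume "i < length ls" "i' = i" "capp (ls ! i) j k"
    then show ?thesis using step_rel(3)[OF s, of i j k] by simp
  next
    fix m assume "m < length ls" "i = Suc m" "i' = i" "cupp (ls ! m) j k"
    then show ?thesis using step_rel(4)[OF s, of m j k] by simp
  qed
qed

text \<open>Labels change sign exactly at caps and cups. Two histories change sign at the same
  places, so agreement at one point of a string spreads over the whole string.\<close>

lemma path_str_conn:
  assumes "path N ls xs" "undotted ls" "str_conn ls (i, j) (i', k)"
  shows "xs i' (N + k) = xs i (N + j) \<or> xs i' (N + k) = - xs i (N + j)"
    and "path N ls zs \<Longrightarrow> xs i (N + j) = zs i (N + j) \<longleftrightarrow> xs i' (N + k) = zs i' (N + k)"
proof -
  have "str_conn ls v w \<Longrightarrow> xs (fst w) (N + snd w) = xs (fst v) (N + snd v) \<or> xs (fst w) (N + snd w) = - xs (fst v) (N + snd v)" for v w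
    unfolding str_conn_def
  proof (induction rule: rtranclp_induct)
    case (step w u)
    then show ?case using path_adj[OF assms(1,2), of "fst w" "snd w" "fst u" "snd u"] by (auto split: if_splits)
  qed simp
  then show "xs i' (N + k) = xs i (N + j) \<or> xs i' (N + k) = - xs i (N + j)" using assms(3) by fastforce
  have "path N ls zs \<Longrightarrow> str_conn ls v w \<Longrightarrow> xs (fst v) (N + snd v) = zs (fst v) (N + snd v) \<longleftrightarrow> xs (fst w) (N + snd w) = zs (fst w) (N + snd w)" for v w
    unfolding str_conn_def
  proof (rotate_tac, induction rule: rtranclp_induct)
    case (step w u)
    then show ?case using path_adj[OF assms(1,2), of "fst w" "snd w" "fst u" "snd u"]
       path_adj[of N ls zs, OF _ assms(2), of "fst w" "snd w" "fst u" "snd u"] by (auto split: if_splits)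
  qed simp
  then show "path N ls zs \<Longrightarrow> xs i (N + j) = zs i (N + j) \<longleftrightarrow> xs i' (N + k) = zs i' (N + k)"
    using assms(3) by fastforce
qed

lemma path_agree:
  assumes ls: "valid_from a ls" "undotted ls" and p: "path N ls xs" "path N ls zs"
    and top: "xs (length ls) = zs (length ls)"
    and v: "\<And>i j. (i, j) \<in> vertices a ls \<Longrightarrow> \<exists>i' k. str_conn ls (i, j) (i', k) \<and> xs i' (N + k) = zs i' (N + k)"
  shows "i \<le> length ls \<Longrightarrow> xs i = zs i"
proof (induction i rule: inc_induct)
  case (step i)
  have s: "step N (ls ! i) (xs i) (xs (Suc i))" "step N (ls ! i) (zs i) (zs (Suc i))" "gen_of (ls ! i) \<noteq> GY"
    using p ls(2) step by (auto simp: path_def undotted_def)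
  note w = width_at_simps(1)[OF ls(1) step(2)]
  show ?case
  proof
    fix r
    consider "r < N" | j where "r = N + j" "j < width_at a ls i" | t where "r = N + lsrc (ls ! i) + t"
      using w by (metis le_iff_add add.assoc linorder_not_less)
    then show "xs i r = zs i r"
    proof cases
      case 1
      then show ?thesis using step_rel(1)[OF s(1,3)] step_rel(1)[OF s(2,3)] step.IH by simp
    next
      case 2
      then have "(i, j) \<in> vertices a ls" using step by (auto simp: vertices_def)
      then show ?thesis using v path_str_conn(2)[OF p(1) ls(2) _ p(2)] 2 by metis
    next
      case 3
      then show ?thesis using step_rel(5)[OF s(1,3)] step_rel(5)[OF s(2,3)] step.IH by simp
    qed
  qed
qed (rule top)

lemma seq_at:
  "ins q w z (q + 2 + t) = z (q + t)" "ins q w z q = w" "ins q w z (Suc q) = - w" "r < q \<Longrightarrow> ins q w z r = z r"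
  "tr q z (q + 2 + t) = z (q + 2 + t)" "tr q z q = z (Suc q)" "tr q z (Suc q) = z q" "r < q \<Longrightarrow> tr q z r = z r"
  "del q z (q + t) = z (q + 2 + t)" "r < q \<Longrightarrow> del q z r = z r"
  by (auto simp: ins_def tr_def del_def)

text \<open>A converse to \<open>step_rel\<close>: the local conditions along strings already
  determine a legal step, provided that the labels on caps and cups lie in \<open>I\<close>.\<close>

lemma step_from_labels:
  assumes l: "l = (p, g, q)" "g \<noteq> GY"
    and low: "\<And>r. r < N \<Longrightarrow> x r = z r"
    and up: "\<And>j k. up l j k \<Longrightarrow> x (N + j) = z (N + k)"
    and cap: "\<And>j k. capp l j k \<Longrightarrow> x (N + k) = - x (N + j) \<and> x (N + j) \<in> I"
    and cup: "\<And>j k. cupp l j k \<Longrightarrow> z (N + k) = - z (N + j) \<and> z (N + j) \<in> I"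
    and tail: "\<And>t. x (N + lsrc l + t) = z (N + ltgt l + t)"
  shows "step N l x z"
proof -
  have left: "x r = z r" if "r < N + p" for r
  proof (cases "r < N")
    case False
    then have "r - N < p" "N + (r - N) = r" using that by auto
    then show ?thesis using up[of "r - N" "r - N"] l by simp
  qed (use low in auto)
  have right: "x (N + p + gsrc g + t) = z (N + p + gtgt g + t)" for t
  proof (cases "t < q")
    case True
    then show ?thesis using up[of "p + gsrc g + t" "p + gtgt g + t"] l by (simp add: add.assoc)
  next
    case False
    then obtain u where "t = q + u" by (metis le_iff_add not_less)
    then show ?thesis using tail[of u] l by (simp add: algebra_simps)
  qed
  show ?thesis
  proof (cases g)
    case GS
    have "x r = tr (N + p) z r" for r
    proof -
      have "r < N + p \<or> r = N + p \<or> r = Suc (N + p) \<or> r = N + p + 2 + (r - (N + p + 2))" by linarith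
      then consider "r < N + p" | "r = N + p" | "r = Suc (N + p)" | t where "r = N + p + 2 + t" by blast
      moreover have "x (N + p + 2 + t) = z (N + p + 2 + t)" for t using right[of t] GS by simp
      moreover have "x (N + p) = z (Suc (N + p))" "x (Suc (N + p)) = z (N + p)"
        using up[of p "Suc p"] up[of "Suc p" p] l GS by simp_all
      ultimately show ?thesis using left[of r] by cases (simp_all only: seq_at)
    qed
    then have "x = tr (N + p) z" by blast
    then show ?thesis using l GS by simp
  next
    case GB
    have "x r = ins (N + p) (x (N + p)) z r" for r
    proof -
      have "r < N + p \<or> r = N + p \<or> r = Suc (N + p) \<or> r = N + p + 2 + (r - (N + p + 2))" by linarith
      then consider "r < N + p" | "r = N + p" | "r = Suc (N + p)" | t where "r = N + p + 2 + t" by blast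
      moreover have "x (N + p + 2 + t) = z (N + p + t)" for t using right[of t] GB by simp
      moreover have "x (Suc (N + p)) = - x (N + p)" using cap[of p "Suc p"] l GB by simp
      ultimately show ?thesis using left[of r] by cases (simp_all only: seq_at)
    qed
    then have "x = ins (N + p) (x (N + p)) z" by blast
    moreover have "x (N + p) \<in> I" using cap[of p "Suc p"] l GB by simp
    ultimately have "\<exists>w\<in>I. x = ins (N + p) w z" by blast
    then show ?thesis using l GB by simp
  next
    case GBs
    have "x r = del (N + p) z r" for r
    proof -
      have "r < N + p \<or> r = N + p + (r - (N + p))" by linarith
      then consider "r < N + p" | t where "r = N + p + t" by blast
      moreover have "x (N + p + t) = z (N + p + 2 + t)" for t using right[of t] GBs by simp
      ultimately show ?thesis using left[of r] by cases (simp_all only: seq_at)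
    qed
    then have "x = del (N + p) z" by blast
    then show ?thesis using cup[of p "Suc p"] l GBs by simp
  qed (use l in auto)
qed

text \<open>The labelling of the strings gives one history. Any competing history shares the top
  labels and, by the assumption on \<open>v\<close>, those bottom labels which are not dot sites;
  every string has an endpoint of one of these kinds.\<close>

lemma mid_eval:
  assumes ls: "(a, ls) \<in> hom_words a b" "undotted ls" "loop_free a b ls" "has_connector a b ls c" "c \<in> Conn a b"
    and bl: "\<And>e. e \<in> endpts a b \<Longrightarrow> bl (c e) = (if opp_side e (c e) then bl e else - bl e)"
    and blI: "\<And>e. e \<in> endpts a b \<Longrightarrow> bl e \<in> I"
    and x: "\<And>r. r < N \<Longrightarrow> x r = y r" "\<And>j. j < a \<Longrightarrow> x (N + j) = bl (Bot j)" "\<And>t. x (N + a + t) = y (N + b + t)"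
    and y: "\<And>j. j < b \<Longrightarrow> y (N + j) = bl (Top j)"
    and v: "\<And>z j. v z \<noteq> 0 \<Longrightarrow> (\<And>r. r < N \<Longrightarrow> z r = y r) \<Longrightarrow> j < a \<Longrightarrow> \<not> dot_site c a b (Bot j) \<Longrightarrow> z (N + j) = bl (Bot j)"
  shows "\<exists>e. unit e \<and> F N ls v y = e * v x"
proof -
  have valid: "valid_from a ls" and end_b: "end_obj a ls = b" using ls(1) by (auto simp: hom_words_def)
  note w = width_at_simps[OF valid]
  obtain L where L1: "\<forall>e\<in>endpts a b. L (vert ls e) = bl e"
    and L2: "\<forall>u\<in>vertices a ls. \<exists>e\<in>endpts a b. L u = bl e \<or> L u = - bl e"
    and L3: "\<forall>i<length ls. \<forall>j k. (up (ls ! i) j k \<longrightarrow> L (i, j) = L (Suc i, k)) \<and>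
       (capp (ls ! i) j k \<longrightarrow> L (i, k) = - L (i, j)) \<and> (cupp (ls ! i) j k \<longrightarrow> L (Suc i, k) = - L (Suc i, j))"
  proof -
    have "\<exists>L. (\<forall>e\<in>endpts a b. L (vert ls e) = bl e) \<and>
      (\<forall>v\<in>vertices a ls. \<exists>e\<in>endpts a b. L v = bl e \<or> L v = - bl e) \<and>
      (\<forall>i<length ls. \<forall>j k. (up (ls ! i) j k \<longrightarrow> L (i, j) = L (Suc i, k)) \<and>
       (capp (ls ! i) j k \<longrightarrow> L (i, k) = - L (i, j)) \<and> (cupp (ls ! i) j k \<longrightarrow> L (Suc i, k) = - L (Suc i, j)))"
      by (rule labelling_exists[OF valid ls(3-5)]) (rule bl)
    then show thesis using that by (elim exE conjE)
  qed
  have Le: "L (vert ls e) = bl e" if "e \<in> endpts a b" for e using L1 that by blast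
  have L: "up (ls ! i) j k \<Longrightarrow> L (i, j) = L (Suc i, k)" "capp (ls ! i) j k \<Longrightarrow> L (i, k) = - L (i, j)"
    "cupp (ls ! i) j k \<Longrightarrow> L (Suc i, k) = - L (Suc i, j)" if "i < length ls" for i j k
    using L3 that by blast+
  have LI': "L u \<in> I" if u: "u \<in> vertices a ls" for u
  proof -
    obtain e where "e \<in> endpts a b" "L u = bl e \<or> L u = - bl e" using L2 u by blast
    then show ?thesis using blI[of e] by (elim disjE) simp_all
  qed
  define xs where "xs i r = (if r < N then y r else if r - N < width_at a ls i then L (i, r - N)
     else y (N + b + (r - N - width_at a ls i)))" for i r
  have len: "xs (length ls) = y"
  proof
    fix r
    show "xs (length ls) r = y r"
      using y[of "r - N"] Le[of "Top (r - N)"] w(3) end_b by (auto simp: xs_def endpts_def)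
  qed
  have xs0: "xs 0 = x"
  proof
    fix r
    have "r = N + a + (r - N - a)" if "\<not> r < N" "\<not> r - N < a" using that by linarith
    then show "xs 0 r = x r"
      using x(1)[of r] x(2)[of "r - N"] x(3)[of "r - N - a"] Le[of "Bot (r - N)"] w(4)
      by (auto simp: xs_def endpts_def)
  qed
  have path: "path N ls xs" unfolding path_def
  proof (intro allI impI)
    fix i assume i: "i < length ls"
    obtain p g q where l: "ls ! i = (p, g, q)" by (cases "ls ! i")
    have g: "g \<noteq> GY" using ls(2) i l nth_mem[OF i] by (auto simp: undotted_def)
    have lt: "up (ls ! i) j k \<Longrightarrow> j < width_at a ls i \<and> k < width_at a ls (Suc i)"
      "capp (ls ! i) j k \<Longrightarrow> j < width_at a ls i \<and> k < width_at a ls i"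
      "cupp (ls ! i) j k \<Longrightarrow> j < width_at a ls (Suc i) \<and> k < width_at a ls (Suc i)" for j k
      using w(1,2)[OF i] l by auto
    have vert: "j < width_at a ls m \<Longrightarrow> m \<le> length ls \<Longrightarrow> L (m, j) \<in> I" for m j
      by (rule LI') (auto simp: vertices_def)
    show "step N (ls ! i) (xs i) (xs (Suc i))"
    proof (rule step_from_labels[OF l g])
      show "\<And>j k. up (ls ! i) j k \<Longrightarrow> xs i (N + j) = xs (Suc i) (N + k)"
        using L(1)[OF i] lt(1) by (simp add: xs_def)
      show "\<And>j k. capp (ls ! i) j k \<Longrightarrow> xs i (N + k) = - xs i (N + j) \<and> xs i (N + j) \<in> I"
        using L(2)[OF i] lt(2) vert[of _ i] i by (simp add: xs_def)
      show "\<And>j k. cupp (ls ! i) j k \<Longrightarrow> xs (Suc i) (N + k) = - xs (Suc i) (N + j) \<and> xs (Suc i) (N + j) \<in> I"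
        using L(3)[OF i] lt(3) vert[of _ "Suc i"] i by (simp add: xs_def)
      show "\<And>t. xs i (N + lsrc (ls ! i) + t) = xs (Suc i) (N + ltgt (ls ! i) + t)"
        using w(1,2)[OF i] by (simp add: xs_def)
    qed (simp add: xs_def)
  qed
  have "\<exists>e. unit e \<and> F N ls v (xs (length ls)) = e * v (xs 0)"
  proof (rule F_unique_path[OF ls(2) path])
    fix zs assume zs: "path N ls zs" "zs (length ls) = xs (length ls)" "v (zs 0) \<noteq> 0"
    have low: "zs i r = zs (length ls) r" if "r < N" "i \<le> length ls" for i r
      using that(2)
    proof (induction i rule: inc_induct)
      case (step i)
      then have "step N (ls ! i) (zs i) (zs (Suc i))" "gen_of (ls ! i) \<noteq> GY"
        using zs(1) ls(2) by (auto simp: path_def undotted_def)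
      then show ?case using step_low that(1) step.IH by metis
    qed simp
    have A: "zs (fst (vert ls e)) (N + snd (vert ls e)) = xs (fst (vert ls e)) (N + snd (vert ls e))"
      if "e \<in> endpts a b" "\<not> dot_site c a b e \<or> (\<exists>j. e = Top j)" for e
    proof (cases e)
      case (Bot j)
      then have "zs 0 (N + j) = bl (Bot j)" using that zs len low
        by (intro v) (auto simp: endpts_def)
      then show ?thesis using Bot that xs0 x(2) by (auto simp: endpts_def)
    qed (use zs in auto)
    have "xs i = zs i" if "i \<le> length ls" for i
    proof (rule path_agree[OF valid ls(2) path zs(1) zs(2)[symmetric] _ that])
      fix i j assume "(i, j) \<in> vertices a ls"
      then obtain e where e: "e \<in> endpts a b" "str_conn ls (i, j) (vert ls e)" using ls(3) by (auto simp: loop_free_def)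
      have ce: "c e \<in> endpts a b" "c e \<noteq> e" "c (c e) = e" using ls(5) e by (auto simp: Conn_def)
      have sc: "str_conn ls (vert ls e) (vert ls (c e))" using ls(4) e(1) ce by (auto simp: has_connector_def)
      show "\<exists>i' k. str_conn ls (i, j) (i', k) \<and> xs i' (N + k) = zs i' (N + k)"
      proof (cases "\<not> dot_site c a b e \<or> (\<exists>j. e = Top j)")
        case True
        then show ?thesis using A[OF e(1) True] e(2) by (metis prod.collapse)
      next
        case False
        \<comment> \<open>The remaining case is a bottom site. Its partner is either at the top or
          the right end of a cap, and the label is known there.\<close>
        then have "\<not> dot_site c a b (c e) \<or> (\<exists>j. c e = Top j)" using ce
          by (auto simp: dot_site_def split: endpt.splits)
        then show ?thesis using A[OF ce(1)] str_conn_trans[OF e(2) sc] by (metis prod.collapse)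
      qed
    qed
    then show "\<forall>i\<le>length ls. zs i = xs i" by simp
  qed
  then show ?thesis using len xs0 by simp
qed

end

section \<open>Separating functionals\<close>

definition ndots :: "layer list \<Rightarrow> nat" where
  "ndots ls = length (filter (\<lambda>l. gen_of l = GY) ls)"

lemma ndots_simps [simp]: "ndots [] = 0" "ndots (l # ls) = (if gen_of l = GY then 1 else 0) + ndots ls"
  "ndots (ls @ ls') = ndots ls + ndots ls'"
  by (auto simp: ndots_def)

lemma ndots_undotted: "undotted ls \<Longrightarrow> ndots ls = 0"
  by (auto simp: undotted_def ndots_def filter_empty_conv)

definition dot_list :: "(endpt \<Rightarrow> endpt) \<Rightarrow> nat \<Rightarrow> nat \<Rightarrow> (nat \<Rightarrow> endpt) \<Rightarrow> (endpt \<Rightarrow> nat) \<Rightarrow> nat \<Rightarrow> nat \<Rightarrow> layer list" where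
  "dot_list c a b mk f m n = concat (map (\<lambda>j. if dot_site c a b (mk j) then replicate (f (mk j)) (j, GY, m - Suc j) else []) [0..<n])"

lemma dotted_word_eq:
  "dotted_word a b c ls f = (a, dot_list c a b Bot f a a @ ls @ dot_list c a b Top f b b)"
  by (simp add: dotted_word_def dot_list_def)

lemma dot_list_0 [simp]: "dot_list c a b mk f m 0 = []"
  and dot_list_Suc: "dot_list c a b mk f m (Suc n) = dot_list c a b mk f m n @
     (if dot_site c a b (mk n) then replicate (f (mk n)) (n, GY, m - Suc n) else [])"
  by (auto simp: dot_list_def)

lemma dot_list_count: "length (filter (\<lambda>l. P (lpos l)) (dot_list c a b mk f m n)) =
   (\<Sum>j<n. if dot_site c a b (mk j) \<and> P j then f (mk j) else 0)"
  by (induction n) (auto simp: dot_list_Suc filter_replicate)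

lemma dot_list_alldots: "alldots (dot_list c a b mk f m n)"
  by (induction n) (auto simp: dot_list_Suc alldots_def)

lemma alldots_ndots: "alldots ls \<Longrightarrow> ndots ls = length ls"
  by (induction ls) (auto simp: alldots_def)

lemma dot_list_length: "length (dot_list c a b mk f m n) = (\<Sum>j<n. if dot_site c a b (mk j) then f (mk j) else 0)"
  using dot_list_count[of "\<lambda>_. True" c a b mk f m n] by simp

lemma dot_list_sites: "l \<in> set (dot_list c a b mk f m n) \<Longrightarrow> dot_site c a b (mk (lpos l)) \<and> lpos l < n"
  by (auto simp: dot_list_def split: if_splits)

lemma dot_list_cong: "(\<And>j. dot_site c a b (mk j) \<Longrightarrow> f (mk j) = g (mk j)) \<Longrightarrow> dot_list c a b mk f m n = dot_list c a b mk g m n"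
  by (induction n) (auto simp: dot_list_Suc)

lemma dot_site_endpts: "dot_site c a b x \<Longrightarrow> x \<in> endpts a b"
  by (simp add: dot_site_def)

lemma ConnD: "c \<in> Conn a b \<Longrightarrow> x \<in> endpts a b \<Longrightarrow> c x \<in> endpts a b \<and> c x \<noteq> x \<and> c (c x) = x"
  by (auto simp: Conn_def)

lemma dot_site_partner:
  assumes "c \<in> Conn a b" "x \<in> endpts a b"
  shows "dot_site c a b (c x) \<longleftrightarrow> \<not> dot_site c a b x"
  using ConnD[OF assms] assms(2) unfolding dot_site_def
  by (cases x; cases "c x") auto

lemma sites_sum:
  "(\<Sum>x | dot_site c a b x. g x) = (\<Sum>i<a. if dot_site c a b (Bot i) then g (Bot i) else (0::nat)) +
     (\<Sum>j<b. if dot_site c a b (Top j) then g (Top j) else 0)"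
proof -
  have "(\<Sum>x | dot_site c a b x. g x) = (\<Sum>x\<in>endpts a b. if dot_site c a b x then g x else 0)"
    using dot_site_endpts[of c a b] by (intro sum.mono_neutral_cong_left) auto
  also have "\<dots> = (\<Sum>x\<in>Bot ` {..<a}. if dot_site c a b x then g x else 0) + (\<Sum>x\<in>Top ` {..<b}. if dot_site c a b x then g x else 0)"
    unfolding endpts_def by (rule sum.union_disjoint) auto
  also have "\<dots> = (\<Sum>i<a. if dot_site c a b (Bot i) then g (Bot i) else 0) + (\<Sum>j<b. if dot_site c a b (Top j) then g (Top j) else 0)"
    by (simp add: sum.reindex inj_on_def)
  finally show ?thesis .
qed

context labels
begin

text \<open>Only dots can alter auxiliary labels, so the number of dots in a word bounds the number
  of labels that it changes.\<close>

lemma reach_chg: "reach N ls x z \<Longrightarrow> chg N x y \<le> ndots ls + chg N z y"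
proof (induction ls arbitrary: x)
  case (Cons l ls)
  then obtain w where w: "step N l x w" "reach N ls w z" by auto
  have IH: "chg N w y \<le> ndots ls + chg N z y" by (rule Cons.IH[OF w(2)])
  show ?case
  proof (cases "gen_of l = GY")
    case True
    then show ?thesis using step_dot_le[OF w(1), of y] IH by simp
  next
    case False
    have "chg N x y = chg N w y" by (rule chg_low) (rule step_low[OF w(1) False])
    then show ?thesis using IH False by simp
  qed
qed simp

end

section \<open>Labels adapted to one marked basis diagram\<close>

fun cd :: "endpt \<Rightarrow> nat" where "cd (Bot i) = 2 * i" | "cd (Top j) = Suc (2 * j)"

lemma cd_inj: "cd x = cd y \<longleftrightarrow> x = y"
  by (cases x; cases y) (auto, presburger+)

text \<open>A positive label that encodes the site of a string and a level along it;
  \<open>Suc\<close> avoids the forbidden label 0. The class \<open>cl\<close> ignores the sign, so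
  it is constant along a string.\<close>

definition lam :: "endpt \<Rightarrow> nat \<Rightarrow> int" where "lam x t = int (Suc (prod_encode (cd x, t)))"
definition cl :: "int \<Rightarrow> nat" where "cl z = fst (prod_decode (nat \<bar>z\<bar> - 1))"

lemma cl_minus [simp]: "cl (- z) = cl z" by (simp add: cl_def)
lemma cl_lam [simp]: "cl (lam x t) = cd x"
proof -
  have "nat \<bar>lam x t\<bar> - 1 = prod_encode (cd x, t)" by (simp add: lam_def)
  then show ?thesis by (simp only: cl_def prod_encode_inverse fst_conv)
qed
lemma lam_inj: "lam x t = lam y s \<longleftrightarrow> x = y \<and> t = s"
  by (simp add: lam_def cd_inj)
lemma lam_pos: "0 < lam x t" by (simp add: lam_def)

locale marked =
  fixes a b :: nat and c :: "endpt \<Rightarrow> endpt" and f :: "endpt \<Rightarrow> nat"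
  assumes c: "c \<in> Conn a b"
begin

abbreviation site where "site \<equiv> dot_site c a b"
definition sites where "sites = {x. site x}"
definition k where "k = sum f sites"
definition h where "h = (SOME h. bij_betw h {..<k} (SIGMA x:sites. {..<f x}))"
text \<open>A string with site \<open>x\<close> and \<open>t\<close> dots below the current level carries the label \<open>lam x t\<close>; \<open>bl\<close> gives the labels
  between the bottom and the top dots.\<close>

definition bl :: "endpt \<Rightarrow> int" where
  "bl e = (let s = (if site e then e else c e); l = lam s (case s of Bot _ \<Rightarrow> f s | Top _ \<Rightarrow> 0) in
     if site e \<or> opp_side e (c e) then l else - l)"
text \<open>The label 1 is added because it fills all positions beyond the strands in
  \<open>St\<close>.\<close>

definition Lset where "Lset = insert 1 ((\<lambda>(x, t). lam x t) ` (SIGMA x:sites. {..f x}))"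
definition I where "I = Lset \<union> uminus ` Lset"

text \<open>The auxiliary strand \<open>h r = (x, t)\<close> interacts with dot number \<open>t\<close> of the string \<open>x\<close> and exchanges
  \<open>lam x (Suc t)\<close> with \<open>lam x t\<close>; \<open>g\<close> counts the dots that are still below.\<close>

definition Mp :: "(endpt \<Rightarrow> nat) \<Rightarrow> nat \<Rightarrow> int" where
  "Mp g r = (if snd (h r) < g (fst (h r)) then lam (fst (h r)) (snd (h r)) else lam (fst (h r)) (Suc (snd (h r))))"
text \<open>The label sequence at a level whose strands end at \<open>mk 0\<close>,
  \<open>mk 1\<close>, ...: first the auxiliary labels, then the strands, then the filler 1. A
  strand that is no dot site carries its fixed label \<open>bl\<close>.\<close>

definition St :: "(nat \<Rightarrow> endpt) \<Rightarrow> nat \<Rightarrow> (endpt \<Rightarrow> nat) \<Rightarrow> nat \<Rightarrow> int" where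
  "St mk n g i = (if i < k then Mp g i else if i - k < n then
     (if site (mk (i - k)) then lam (mk (i - k)) (g (mk (i - k))) else bl (mk (i - k))) else 1)"

lemma finite_sites: "finite sites"
  unfolding sites_def by (rule finite_subset[OF _ finite_endpts[of a b]]) (use dot_site_endpts in auto)

lemma h: "bij_betw h {..<k} (SIGMA x:sites. {..<f x})"
proof -
  have "card (SIGMA x:sites. {..<f x}) = k" using finite_sites by (simp add: k_def)
  then have "\<exists>h. bij_betw h {..<k} (SIGMA x:sites. {..<f x})"
    using finite_sites ex_bij_betw_nat_finite[of "SIGMA x:sites. {..<f x}"] by (simp add: lessThan_atLeast0)
  then show ?thesis unfolding h_def by (rule someI_ex)
qed

lemma h_mem: "r < k \<Longrightarrow> fst (h r) \<in> sites \<and> snd (h r) < f (fst (h r))"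
proof -
  assume "r < k"
  then have "h r \<in> (SIGMA x:sites. {..<f x})" using bij_betwE[OF h] by blast
  then show ?thesis by auto
qed

lemma h_inj: "r < k \<Longrightarrow> s < k \<Longrightarrow> h r = h s \<Longrightarrow> r = s"
  using bij_betw_imp_inj_on[OF h] by (auto dest: inj_onD)

lemma h_surj: "x \<in> sites \<Longrightarrow> t < f x \<Longrightarrow> \<exists>r<k. h r = (x, t)"
proof -
  assume "x \<in> sites" "t < f x"
  then have "(x, t) \<in> h ` {..<k}" using bij_betw_imp_surj_on[OF h] by auto
  then show ?thesis by (metis imageE lessThan_iff)
qed

sublocale labels I
proof
  show "finite I" using finite_sites by (auto simp: I_def Lset_def)
  show "0 \<notin> I" using lam_pos by (auto simp: I_def Lset_def) (metis less_irrefl)+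
  show "- z \<in> I" if "z \<in> I" for z using that by (auto simp: I_def)
qed

lemma lam_I: "x \<in> sites \<Longrightarrow> t \<le> f x \<Longrightarrow> lam x t \<in> I"
  by (force simp: I_def Lset_def)

lemma partner_site: "e \<in> endpts a b \<Longrightarrow> \<not> site e \<Longrightarrow> c e \<in> sites"
  using dot_site_partner[OF c] by (simp add: sites_def)

lemma bl_I: "e \<in> endpts a b \<Longrightarrow> bl e \<in> I"
  using partner_site[of e] lam_I[of e] lam_I[of "c e"]
  by (auto simp: bl_def Let_def sites_def split: endpt.splits)

lemma bl_partner: "e \<in> endpts a b \<Longrightarrow> bl (c e) = (if opp_side e (c e) then bl e else - bl e)"
proof -
  assume e: "e \<in> endpts a b"
  have "opp_side (c e) e = opp_side e (c e)" by (cases e; cases "c e") auto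
  then show ?thesis
    using dot_site_partner[OF c e] ConnD[OF c e] by (cases "site e") (auto simp: bl_def Let_def)
qed

lemma bl_class: "cl (bl e) = cd (if site e then e else c e)"
  by (auto simp: bl_def Let_def)

lemma Mp_I: "r < k \<Longrightarrow> Mp g r \<in> I"
proof -
  assume "r < k"
  then show ?thesis using h_mem[of r] lam_I[of "fst (h r)"] by (simp add: Mp_def)
qed

lemma Mp_pos: "0 < Mp g r"
  using lam_pos by (auto simp: Mp_def)

lemma Mp_class: "cl (Mp g r) = cd (fst (h r))"
  by (auto simp: Mp_def)

lemma St_I:
  assumes "mk = Bot \<and> n = a \<or> mk = Top \<and> n = b" "\<And>x. x \<in> sites \<Longrightarrow> g x \<le> f x"
  shows "range (St mk n g) \<subseteq> I"
proof
  fix z assume "z \<in> range (St mk n g)"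
  then obtain i where z: "z = St mk n g i" by blast
  have "1 \<in> I" by (simp add: I_def Lset_def)
  moreover have "mk (i - k) \<in> endpts a b" if "i - k < n" using assms(1) that by (auto simp: endpts_def)
  ultimately show "z \<in> I" unfolding z using Mp_I assms(2) lam_I bl_I by (auto simp: St_def sites_def)
qed

abbreviation X where "X \<equiv> St Bot a (\<lambda>_. 0)"
abbreviation Yt where "Yt \<equiv> St Top b f"
abbreviation dX :: "(nat \<Rightarrow> int) \<Rightarrow> complex" where "dX \<equiv> (\<lambda>z. if z = X then 1 else 0)"

lemma St_cong: "(\<And>x. x \<in> sites \<Longrightarrow> g x = g' x) \<Longrightarrow> St mk n g = St mk n g'"
proof
  fix i assume eq: "\<And>x. x \<in> sites \<Longrightarrow> g x = g' x"
  have "Mp g i = Mp g' i" if "i < k" using h_mem[OF that] eq by (auto simp: Mp_def)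
  then show "St mk n g i = St mk n g' i" using eq by (simp add: St_def sites_def)
qed

text \<open>Auxiliary strand \<open>h r = (x, t)\<close> differs from its initial label precisely
  when more than \<open>t\<close> dots of the string \<open>x\<close> lie below. In the end state
  all \<open>k\<close> labels have changed.\<close>

lemma chg_St:
  assumes "\<And>x. x \<in> sites \<Longrightarrow> g x \<le> f x"
  shows "chg k X (St mk n g) = sum g sites"
proof -
  have e: "{r. r < k \<and> X r \<noteq> St mk n g r} = {r. r < k \<and> snd (h r) < g (fst (h r))}"
    by (auto simp: St_def Mp_def lam_inj split: if_splits)
  have "bij_betw h {r. r < k \<and> snd (h r) < g (fst (h r))} (SIGMA x:sites. {..<g x})"
  proof (rule bij_betwI')
    show "\<And>x y. x \<in> {r. r < k \<and> snd (h r) < g (fst (h r))} \<Longrightarrow> y \<in> {r. r < k \<and> snd (h r) < g (fst (h r))} \<Longrightarrow> (h x = h y) = (x = y)"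
      using h_inj by auto
    show "\<And>x. x \<in> {r. r < k \<and> snd (h r) < g (fst (h r))} \<Longrightarrow> h x \<in> (SIGMA x:sites. {..<g x})"
      using h_mem by (metis (mono_tags, lifting) SigmaI lessThan_iff mem_Collect_eq prod.collapse)
    fix p assume p: "p \<in> (SIGMA x:sites. {..<g x})"
    obtain x t where xt: "p = (x, t)" by (cases p)
    have "x \<in> sites" "t < g x" "t < f x" using p xt assms[of x] by auto
    then show "\<exists>r\<in>{r. r < k \<and> snd (h r) < g (fst (h r))}. p = h r"
      using h_surj[of x t] xt by auto
  qed
  then have "card {r. r < k \<and> snd (h r) < g (fst (h r))} = card (SIGMA x:sites. {..<g x})"
    by (rule bij_betw_same_card)
  then show ?thesis unfolding chg_def e using finite_sites by simp
qed

text \<open>The topmost dot has to undo one of the label changes, and the label on its strand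
  permits only the auxiliary strand reserved for dot number \<open>m\<close> of this string.\<close>

lemma dot_move:
  assumes mk: "inj mk" "site (mk p)" "p < n" and gx: "g (mk p) = Suc m"
    and gf: "\<And>x. x \<in> sites \<Longrightarrow> g x \<le> f x" and nd: "Suc (ndots ls) = sum g sites"
  shows "\<exists>e. unit e \<and> F k (ls @ [(p, GY, q)]) dX (St mk n g) = e * F k ls dX (St mk n (g(mk p := m)))"
proof -
  let ?x = "mk p" and ?y = "St mk n g" and ?v = "F k ls dX"
  have xs: "?x \<in> sites" using mk by (simp add: sites_def)
  then have "m < f ?x" using gf gx by fastforce
  then obtain r where r: "r < k" "h r = (?x, m)" using h_surj[OF xs] by blast
  have yp: "?y (k + p) = lam ?x (Suc m)" using mk gx by (simp add: St_def)
  have ylow: "?y i = Mp g i" if "i < k" for i using that by (simp add: St_def)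
  have Xlow: "X i = lam (fst (h i)) (Suc (snd (h i)))" if "i < k" for i
    using that by (simp add: St_def Mp_def)
  \<comment> \<open>The layers of \<open>ls\<close> contain one dot less than the number of labels
    changed in \<open>?y\<close>, so states in the support of \<open>?v\<close> have fewer changed
    labels.\<close>
  have less: "chg k X z < chg k X ?y" if nz: "?v z \<noteq> 0" for z
  proof -
    obtain x where "dX x \<noteq> 0" "reach k ls x z" using F_nonzero[OF nz] by blast
    then have "reach k ls X z" by (auto split: if_splits)
    then have "chg k X z \<le> ndots ls + chg k z z" by (rule reach_chg)
    moreover have "chg k z z = 0" by (simp add: chg_def)
    ultimately show ?thesis using chg_St[OF gf, of mk n] nd by simp
  qed
  \<comment> \<open>If only strand \<open>j\<close> and the dotted strand are altered, the number of
    changed labels can decrease only when \<open>j\<close> is auxiliary and returns to its initial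
    label.\<close>
  have upd: "j < k \<and> z j = X j" if "\<And>i. i \<noteq> j \<Longrightarrow> i \<noteq> k + p \<Longrightarrow> z i = ?y i" "?v z \<noteq> 0" for z j
  proof (rule ccontr)
    assume n: "\<not> (j < k \<and> z j = X j)"
    have "{r. r < k \<and> X r \<noteq> ?y r} \<subseteq> {r. r < k \<and> X r \<noteq> z r}"
    proof
      fix i assume i: "i \<in> {r. r < k \<and> X r \<noteq> ?y r}"
      show "i \<in> {r. r < k \<and> X r \<noteq> z r}"
      proof (cases "i = j")
        case True
        then show ?thesis using i n by auto
      next
        case False
        then show ?thesis using i that(1)[OF False] by auto
      qed
    qed
    then have "chg k X ?y \<le> chg k X z" unfolding chg_def by (intro card_mono) auto
    then show False using less[OF that(2)] by simp
  qed
  have "\<exists>e. unit e \<and> lop k (p, GY, q) ?v ?y = e * ?v (sw r (k + p) ?y)"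
  proof (rule dot_single)
    show "r < k + p" using r by simp
    fix j assume j: "j < k + p"
    { assume "?v (sw j (k + p) ?y) \<noteq> 0"
      then have "j < k \<and> sw j (k + p) ?y j = X j" by (rule upd[rotated]) (simp add: sw_def)
      then have jk: "j < k" and sj: "sw j (k + p) ?y j = X j" by blast+
      have "sw j (k + p) z j = z (k + p)" for z using jk by (simp add: sw_def)
      then have "?y (k + p) = X j" unfolding sj[symmetric] by (rule sym)
      then have "lam ?x (Suc m) = lam (fst (h j)) (Suc (snd (h j)))" using yp Xlow[OF jk] by simp
      then have "h j = (?x, m)" by (simp add: lam_inj prod_eq_iff)
      then show "j = r" using h_inj[of j r] r jk by simp }
    fix z assume z: "z \<in> I" "?y j = - ?y (k + p)"
    \<comment> \<open>By \<open>upd\<close>, \<open>j\<close> would be auxiliary. A contraction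
      needs opposite labels on \<open>j\<close> and the dotted strand, but both labels are
      positive.\<close>
    show "?v (pc j (k + p) z ?y) = 0"
    proof (rule ccontr)
      assume "?v (pc j (k + p) z ?y) \<noteq> 0"
      then have "j < k \<and> pc j (k + p) z ?y j = X j" by (rule upd[rotated]) (simp add: pc_def)
      then have "?y j = Mp g j" using ylow by blast
      then show False using z(2) yp Mp_pos[of g j] lam_pos[of ?x "Suc m"] by simp
    qed
  qed
  moreover have "sw r (k + p) ?y = St mk n (g(?x := m))"
  proof
    fix i
    have Mp: "Mp (g(?x := m)) i = Mp g i" if "i < k" "i \<noteq> r" for i
    proof -
      obtain x t where xt: "h i = (x, t)" by (cases "h i")
      have "x \<noteq> ?x \<or> t \<noteq> m" using h_inj[of i r] that r xt by auto
      then show ?thesis using gx by (auto simp: Mp_def xt)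
    qed
    have "Mp g r = lam ?x m" "Mp (g(?x := m)) r = lam ?x (Suc m)" using r gx by (auto simp: Mp_def)
    moreover have "mk (i - k) = ?x \<longleftrightarrow> i - k = p" using mk(1) by (auto dest: injD)
    ultimately show "sw r (k + p) ?y i = St mk n (g(?x := m)) i"
      using r Mp[of i] mk yp by (auto simp: sw_def St_def)
  qed
  ultimately show ?thesis by simp
qed

lemma dots_move:
  assumes mk: "inj mk" "site (mk p)" "p < n"
  shows "g (mk p) = m \<Longrightarrow> (\<And>x. x \<in> sites \<Longrightarrow> g x \<le> f x) \<Longrightarrow> ndots ls + m = sum g sites \<Longrightarrow>
   \<exists>e. unit e \<and> F k (ls @ replicate m (p, GY, q)) dX (St mk n g) = e * F k ls dX (St mk n (g(mk p := 0)))"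
proof (induction m arbitrary: g)
  case 0
  then have "g(mk p := 0) = g" by auto
  then show ?case by (intro exI[of _ 1]) simp
next
  case (Suc m)
  let ?g = "g(mk p := m)"
  have xs: "mk p \<in> sites" using mk by (simp add: sites_def)
  have nd: "ndots (replicate m (p, GY, q)) = m" by (induction m) auto
  obtain e where e: "unit e" "F k ((ls @ replicate m (p, GY, q)) @ [(p, GY, q)]) dX (St mk n g) = e * F k (ls @ replicate m (p, GY, q)) dX (St mk n ?g)"
    using dot_move[OF mk Suc.prems(1,2), of "ls @ replicate m (p, GY, q)" q] Suc.prems(3) nd by auto
  have s: "sum g sites = Suc m + sum g (sites - {mk p})" "sum ?g sites = m + sum g (sites - {mk p})"
    using sum.remove[OF finite_sites xs, of g] sum.remove[OF finite_sites xs, of ?g] Suc.prems(1) by simp_all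
  have "\<exists>e. unit e \<and> F k (ls @ replicate m (p, GY, q)) dX (St mk n ?g) = e * F k ls dX (St mk n (?g(mk p := 0)))"
  proof (rule Suc.IH)
    show "?g x \<le> f x" if "x \<in> sites" for x using Suc.prems(2)[OF that] Suc.prems(1) by auto
    show "ndots ls + m = sum ?g sites" using s Suc.prems(3) by simp
  qed simp
  then obtain e' where "unit e'" "F k (ls @ replicate m (p, GY, q)) dX (St mk n ?g) = e' * F k ls dX (St mk n (g(mk p := 0)))"
    by (metis fun_upd_upd)
  moreover have "ls @ replicate (Suc m) (p, GY, q) = (ls @ replicate m (p, GY, q)) @ [(p, GY, q)]"
    by (simp add: replicate_append_same)
  ultimately show ?case using e by (intro exI[of _ "e * e'"]) (simp only: unit_simps mult.assoc)
qed

definition clear :: "(nat \<Rightarrow> endpt) \<Rightarrow> nat \<Rightarrow> (endpt \<Rightarrow> nat) \<Rightarrow> endpt \<Rightarrow> nat" where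
  "clear mk n g x = (if site x \<and> x \<in> mk ` {..<n} then 0 else g x)"

text \<open>The list is consumed from the end, that is, from the topmost dots down; each replicated
  block resets the counter of its site. The equation for \<open>ndots\<close> keeps the dot count
  tight at every stage.\<close>

lemma dot_list_move:
  assumes mk: "inj mk" "n \<le> N"
  shows "(\<And>j. j < n \<Longrightarrow> site (mk j) \<Longrightarrow> g (mk j) = f (mk j)) \<Longrightarrow> (\<And>x. x \<in> sites \<Longrightarrow> g x \<le> f x) \<Longrightarrow>
    ndots ls + ndots (dot_list c a b mk f m n) = sum g sites \<Longrightarrow>
   \<exists>e. unit e \<and> F k (ls @ dot_list c a b mk f m n) dX (St mk N g) = e * F k ls dX (St mk N (clear mk n g))"
  using mk(2)
proof (induction n arbitrary: g)
  case 0
  have "clear mk 0 g = g" by (auto simp: clear_def)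
  then show ?case by (intro exI[of _ 1]) simp
next
  case (Suc n)
  let ?d = "dot_list c a b mk f m n"
  show ?case
  proof (cases "site (mk n)")
    case False
    then have "clear mk (Suc n) g = clear mk n g" by (auto simp: clear_def fun_eq_iff less_Suc_eq)
    then show ?thesis using Suc.IH[of g] Suc.prems False by (simp add: dot_list_Suc)
  next
    case True
    let ?x = "mk n" and ?g = "g(mk n := 0)"
    have xs: "?x \<in> sites" using True by (simp add: sites_def)
    have gx: "g ?x = f ?x" using Suc.prems(1)[of n] True by simp
    have nd: "ndots (replicate (f ?x) (n, GY, q)) = f ?x" for q
      using alldots_ndots[of "replicate (f ?x) (n, GY, q)"] by (simp add: alldots_def)
    have tot: "ndots (ls @ ?d) + f ?x = sum g sites" using Suc.prems(3) True nd by (simp add: dot_list_Suc)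
    obtain e where e: "unit e" "F k ((ls @ ?d) @ replicate (f ?x) (n, GY, m - Suc n)) dX (St mk N g) = e * F k (ls @ ?d) dX (St mk N ?g)"
      using dots_move[OF mk(1) True _ gx Suc.prems(2) tot, of N] Suc.prems(4) by auto
    have s: "sum g sites = f ?x + sum g (sites - {?x})" "sum ?g sites = sum g (sites - {?x})"
      using sum.remove[OF finite_sites xs, of g] sum.remove[OF finite_sites xs, of ?g] gx by simp_all
    have "\<exists>e. unit e \<and> F k (ls @ ?d) dX (St mk N ?g) = e * F k ls dX (St mk N (clear mk n ?g))"
    proof (rule Suc.IH)
      show "?g (mk j) = f (mk j)" if "j < n" "site (mk j)" for j
        using Suc.prems(1)[of j] that mk(1) by (auto dest: injD)
      show "?g x \<le> f x" if "x \<in> sites" for x using Suc.prems(2)[OF that] by auto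
      show "ndots ls + ndots ?d = sum ?g sites" using s tot by simp
    qed (use Suc.prems(4) in simp)
    moreover have "clear mk n ?g = clear mk (Suc n) g" using True by (auto simp: clear_def fun_eq_iff less_Suc_eq)
    ultimately obtain e' where "unit e'" "F k (ls @ ?d) dX (St mk N ?g) = e' * F k ls dX (St mk N (clear mk (Suc n) g))"
      by metis
    then show ?thesis using e True by (intro exI[of _ "e * e'"]) (simp add: dot_list_Suc)
  qed
qed

text \<open>The coefficient is evaluated from the top: top dots by \<open>dot_list_move\<close>, the
  undotted diagram by \<open>mid_eval\<close>, then the bottom dots. Each stage contributes only a
  factor 1 or -1.\<close>

lemma ev_self:
  assumes ls: "normal_diagram a b ls" "has_connector a b ls c"
  shows "ev k X Yt (dotted_word a b c ls f) \<noteq> 0"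
proof -
  have n: "(a, ls) \<in> hom_words a b" "undotted ls" "loop_free a b ls" using ls(1) by (auto simp: normal_diagram_def)
  let ?B = "dot_list c a b Bot f a a" and ?T = "dot_list c a b Top f b b"
  let ?g = "clear Top b f"
  have lenB: "ndots ?B = (\<Sum>i<a. if site (Bot i) then f (Bot i) else 0)"
    and lenT: "ndots ?T = (\<Sum>j<b. if site (Top j) then f (Top j) else 0)"
    using alldots_ndots[OF dot_list_alldots] dot_list_length by simp_all
  have gf: "?g x \<le> f x" for x by (simp add: clear_def)
  have gsum: "sum ?g sites = ndots ?B"
  proof -
    have "sum ?g sites = (\<Sum>i<a. if site (Bot i) then ?g (Bot i) else 0) + (\<Sum>j<b. if site (Top j) then ?g (Top j) else 0)"
      unfolding sites_def by (rule sites_sum)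
    also have "(\<Sum>j<b. if site (Top j) then ?g (Top j) else 0) = 0" by (simp add: clear_def)
    also have "(\<Sum>i<a. if site (Bot i) then ?g (Bot i) else 0) = ndots ?B"
      unfolding lenB by (intro sum.cong) (auto simp: clear_def)
    finally show ?thesis by simp
  qed
  have "\<exists>e. unit e \<and> F k ((?B @ ls) @ ?T) dX (St Top b f) = e * F k (?B @ ls) dX (St Top b ?g)"
  proof (rule dot_list_move)
    show "ndots (?B @ ls) + ndots ?T = sum f sites"
      using sites_sum[where c = c and a = a and b = b and g = f] lenB lenT ndots_undotted[OF n(2)] by (simp add: sites_def)
  qed (auto simp: inj_def)
  then obtain e1 where e1: "unit e1" "F k ((?B @ ls) @ ?T) dX (St Top b f) = e1 * F k (?B @ ls) dX (St Top b ?g)" by (elim exE conjE)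
  have low: "St Bot a ?g r = St Top b ?g r" if "r < k" for r using that by (simp add: St_def)
  have blB: "St Bot a ?g (k + j) = bl (Bot j)" if "j < a" for j
    using that by (auto simp: St_def bl_def clear_def Let_def)
  have blT: "St Top b ?g (k + j) = bl (Top j)" if "j < b" for j
    using that by (auto simp: St_def bl_def clear_def Let_def)
  have "\<exists>e. unit e \<and> F k ls (F k ?B dX) (St Top b ?g) = e * F k ?B dX (St Bot a ?g)"
  proof (rule mid_eval[OF n ls(2) c, where bl = bl])
    fix z j assume z: "F k ?B dX z \<noteq> 0" "\<And>r. r < k \<Longrightarrow> z r = St Top b ?g r" "j < a" "\<not> site (Bot j)"
    obtain x where "dX x \<noteq> 0" "reach k ?B x z" using F_nonzero[OF z(1)] by blast
    then have "reach k ?B X z" by (auto split: if_splits)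
    have "chg k X z = chg k X (St Top b ?g)" unfolding chg_def using z(2) by (intro arg_cong[of _ _ card]) auto
    \<comment> \<open>All bottom dots are needed to reach the auxiliary labels of \<open>z\<close>.
      Hence \<open>dots_reach\<close> applies with \<open>z\<close> itself as target and shows that
      strands without dots keep their labels.\<close>
    then have ch: "chg k X z = length ?B + chg k z z"
      using chg_St[of ?g Top b] gf gsum alldots_ndots[OF dot_list_alldots, of c a b Bot f a a] by (simp add: chg_def[of k z z])
    have hz: "hcl k cl X z" unfolding hcl_def
    proof (intro allI impI)
      fix r assume "r < k"
      then show "cl (X r) = cl (z r)" using z(2)[of r] Mp_class by (simp add: St_def)
    qed
    have "\<forall>i\<ge>k. (\<forall>l\<in>set ?B. k + lpos l \<noteq> i) \<longrightarrow> z i = X i"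
      using dots_reach[OF \<open>reach k ?B X z\<close> dot_list_alldots ch hz] by simp
    moreover have "\<forall>l\<in>set ?B. k + lpos l \<noteq> k + j" using dot_list_sites z(4) by fastforce
    ultimately have "z (k + j) = X (k + j)" by simp
    then show "z (k + j) = bl (Bot j)" using z(3,4) by (simp add: St_def)
  next
    show "St Bot a ?g (k + a + t) = St Top b ?g (k + b + t)" for t by (simp add: St_def)
  qed (use bl_partner bl_I low blB blT in auto)
  then obtain e2 where e2: "unit e2" "F k ls (F k ?B dX) (St Top b ?g) = e2 * F k ?B dX (St Bot a ?g)" by (elim exE conjE)
  have "\<exists>e. unit e \<and> F k ([] @ ?B) dX (St Bot a ?g) = e * F k [] dX (St Bot a (clear Bot a ?g))"
    by (rule dot_list_move) (use gf gsum in \<open>auto simp: inj_def clear_def\<close>)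
  then obtain e3 where e3: "unit e3" "F k ?B dX (St Bot a ?g) = e3 * dX (St Bot a (clear Bot a ?g))" by auto
  have "St Bot a (clear Bot a ?g) = X"
  proof (rule St_cong)
    fix x assume "x \<in> sites"
    then have "site x" "x \<in> endpts a b" using dot_site_endpts by (auto simp: sites_def)
    then show "clear Bot a ?g x = 0" by (auto simp: clear_def endpts_def)
  qed
  then have "ev k X Yt (dotted_word a b c ls f) = e1 * (e2 * e3)"
    using e1 e2 e3 by (simp add: ev_def dotted_word_eq)
  then show ?thesis using e1 e2 e3 by (auto simp: unit_def)
qed

definition st where "st e = (if site e then e else c e)"

lemma st_eq: "e \<in> endpts a b \<Longrightarrow> e' \<in> endpts a b \<Longrightarrow> st e = st e' \<Longrightarrow> e' = e \<or> e' = c e"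
  using ConnD[OF c] by (metis st_def)

text \<open>With at most \<open>k\<close> dots available and \<open>k\<close> labels to change, no
  dot can be wasted. Each dot then changes a label of the class of its own strand, so comparing
  classes along strings recovers the connector, and counting changes in each class recovers the
  dots.\<close>

lemma ev_other:
  assumes ls: "normal_diagram a b ls" "has_connector a b ls c'" and c': "c' \<in> Conn a b"
    and nd: "num_dots (dotted_word a b c' ls f') \<le> k"
    and nz: "ev k X Yt (dotted_word a b c' ls f') \<noteq> 0"
  shows "c' = c \<and> (\<forall>x\<in>sites. f' x = f x)"
proof -
  have n: "(a, ls) \<in> hom_words a b" "undotted ls" using ls(1) by (auto simp: normal_diagram_def)
  let ?B = "dot_list c' a b Bot f' a a" and ?T = "dot_list c' a b Top f' b b"
  obtain x where "dX x \<noteq> 0" "reach k (?B @ ls @ ?T) x Yt"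
    using nz F_nonzero unfolding ev_def dotted_word_eq snd_conv by blast
  then have "reach k (?B @ ls @ ?T) X Yt" by (auto split: if_splits)
  then obtain x1 x2 where r: "reach k ?B X x1" "reach k ls x1 x2" "reach k ?T x2 Yt"
    by (auto simp: reach_append)
  have len: "length ?B + length ?T \<le> k"
    using nd alldots_ndots[OF dot_list_alldots] ndots_undotted[OF n(2)]
    unfolding dotted_word_eq num_dots_def ndots_def[symmetric] by simp
  have XY: "chg k X Yt = k" using chg_St[of f Top b] by (simp add: k_def)
  have le1: "chg k X Yt \<le> length ?B + chg k x1 Yt" by (rule reach_chg_le[OF r(1) dot_list_alldots])
  have eq12: "x1 i = x2 i" if "i < k" for i using reach_low[OF r(2) n(2) that] .
  have c12: "chg k x1 Yt = chg k x2 Yt" by (rule chg_low) (rule eq12)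
  have le2: "chg k x2 Yt \<le> length ?T + chg k Yt Yt" by (rule reach_chg_le[OF r(3) dot_list_alldots])
  have YY: "chg k Yt Yt = 0" by (simp add: chg_def)
  \<comment> \<open>The estimates for bottom and top dots add up to \<open>k\<close>, the most that
    the word allows, so each of them is an equality.\<close>
  have t1: "chg k X Yt = length ?B + chg k x1 Yt" and t2: "chg k x2 Yt = length ?T + chg k Yt Yt"
    using le1 le2 c12 YY len XY by linarith+
  have hX: "hcl k cl X Yt" by (simp add: hcl_def St_def Mp_class)
  note d1 = dots_reach[OF r(1) dot_list_alldots t1 hX, OF cl_minus]
  have h1: "hcl k cl x1 Yt" using d1[of 0] by simp
  have h2: "hcl k cl x2 Yt" using h1 eq12 by (simp add: hcl_def)
  note d2 = dots_reach[OF r(3) dot_list_alldots t2 h2, OF cl_minus]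
  have cl1: "cl (x1 (k + j)) = cd (st (Bot j))" if "j < a" for j
    using d1[of 0] that bl_class[of "Bot j"] by (auto simp: St_def st_def)
  have cl2: "cl (x2 (k + j)) = cd (st (Top j))" if "j < b" for j
  proof -
    have "cl (Yt (k + j)) = cl (x2 (k + j))" using d2[of 0] by simp
    then show ?thesis using that bl_class[of "Top j"] by (auto simp: St_def st_def split: if_splits)
  qed
  obtain xs where xs: "path k ls xs" "xs 0 = x1" "xs (length ls) = x2" using reach_path[OF r(2)] by blast
  have clv: "cl (xs (fst (vert ls e)) (k + snd (vert ls e))) = cd (st e)" if "e \<in> endpts a b" for e
    using that cl1 cl2 xs by (cases e) (auto simp: endpts_def)
  \<comment> \<open>A string of \<open>ls\<close> preserves the class of its label. Its two ends
    therefore name the same site, so they are partners under \<open>c\<close>.\<close>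
  have cc: "c' e = c e" for e
  proof (cases "e \<in> endpts a b")
    case True
    note ce = ConnD[OF c' True]
    have "str_conn ls (vert ls e) (vert ls (c' e))" using ls(2) True ce by (auto simp: has_connector_def)
    then have "str_conn ls (fst (vert ls e), snd (vert ls e)) (fst (vert ls (c' e)), snd (vert ls (c' e)))" by simp
    from path_str_conn(1)[OF xs(1) n(2) this]
    have "cl (xs (fst (vert ls (c' e))) (k + snd (vert ls (c' e)))) = cl (xs (fst (vert ls e)) (k + snd (vert ls e)))"
      by (elim disjE) simp_all
    then have "st e = st (c' e)" using clv[OF True] clv[of "c' e"] ce cd_inj by simp
    then show ?thesis using st_eq[of e "c' e"] True ce by simp
  next
    case False
    then show ?thesis using c c' by (simp add: Conn_def)
  qed
  then have cc': "c' = c" by auto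
  have "f' s = f s" if s: "s \<in> sites" for s
  proof -
    have ss: "site s" "s \<in> endpts a b" using s dot_site_endpts by (auto simp: sites_def)
    have X: "cl (X (k + j)) = cd s \<longleftrightarrow> Bot j = s" if "j < a" "site (Bot j)" for j
      using that cd_inj[of "Bot j" s] by (simp add: St_def)
    have x2: "cl (x2 (k + j)) = cd s \<longleftrightarrow> Top j = s" if "j < b" "site (Top j)" for j
      using cl2[OF that(1)] that(2) cd_inj[of "Top j" s] by (simp add: st_def)
    have "chgc k cl (cd s) X Yt = card {r. r < k \<and> fst (h r) = s}"
    proof -
      have "{r. r < k \<and> X r \<noteq> Yt r \<and> cl (Yt r) = cd s} = {r. r < k \<and> fst (h r) = s}"
        using h_mem by (auto simp: St_def Mp_def lam_inj cd_inj split: if_splits)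
      then show ?thesis by (simp add: chgc_def)
    qed
    also have "\<dots> = card {..<f s}"
    proof (rule bij_betw_same_card[of "\<lambda>r. snd (h r)"], rule bij_betwI')
      show "\<And>x y. x \<in> {r. r < k \<and> fst (h r) = s} \<Longrightarrow> y \<in> {r. r < k \<and> fst (h r) = s} \<Longrightarrow> (snd (h x) = snd (h y)) = (x = y)"
        using h_inj by (metis (mono_tags, lifting) mem_Collect_eq prod_eq_iff)
      show "\<And>x. x \<in> {r. r < k \<and> fst (h r) = s} \<Longrightarrow> snd (h x) \<in> {..<f s}" using h_mem by auto
      show "\<And>t. t \<in> {..<f s} \<Longrightarrow> \<exists>x\<in>{r. r < k \<and> fst (h r) = s}. t = snd (h x)" using h_surj[OF s] by force
    qed
    finally have 1: "chgc k cl (cd s) X Yt = f s" by simp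
    have "chgc k cl (cd s) X Yt = chgc k cl (cd s) x1 Yt + length (filter (\<lambda>l. cl (X (k + lpos l)) = cd s) ?B)"
      using d1[of "cd s"] by simp
    moreover have "chgc k cl (cd s) x1 Yt = chgc k cl (cd s) x2 Yt" by (rule chgc_low) (rule eq12)
    moreover have "chgc k cl (cd s) x2 Yt = length (filter (\<lambda>l. cl (x2 (k + lpos l)) = cd s) ?T)"
      using d2[of "cd s"] by (simp add: chgc_def[of k cl _ Yt Yt])
    \<comment> \<open>The marked diagram prescribes \<open>f s\<close> changes of class
      \<open>cd s\<close>, and each is made by a dot on a strand of that class. Among the dotted
      ends there is only \<open>s\<close> itself.\<close>
    ultimately have 2: "f s = (\<Sum>j<a. if site (Bot j) \<and> cl (X (k + j)) = cd s then f' (Bot j) else 0) +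
        (\<Sum>j<b. if site (Top j) \<and> cl (x2 (k + j)) = cd s then f' (Top j) else 0)"
      using 1 dot_list_count[of "\<lambda>j. cl (X (k + j)) = cd s"] dot_list_count[of "\<lambda>j. cl (x2 (k + j)) = cd s"] cc' by simp
    have "(\<Sum>j<a. if site (Bot j) \<and> cl (X (k + j)) = cd s then f' (Bot j) else 0) = (\<Sum>j<a. if Bot j = s then f' s else 0)"
      using X ss(1) by (intro sum.cong) auto
    moreover have "(\<Sum>j<b. if site (Top j) \<and> cl (x2 (k + j)) = cd s then f' (Top j) else 0) = (\<Sum>j<b. if Top j = s then f' s else 0)"
      using x2 ss(1) by (intro sum.cong) auto
    ultimately show ?thesis using 2 ss(2) by (cases s) (auto simp: endpts_def)
  qed
  then show ?thesis using cc' by blast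
qed

end

section \<open>The basis theorem\<close>

lemma valid_from_append [simp]: "valid_from n (u @ v) = (valid_from n u \<and> valid_from (end_obj n u) v)"
  by (induction n u rule: valid_from.induct) auto

lemma end_obj_append [simp]: "end_obj n (u @ v) = end_obj (end_obj n u) v"
  by (induction n u rule: end_obj.induct) auto

lemma dot_list_valid:
  assumes "\<And>j. mk j \<in> endpts a b \<Longrightarrow> j < m"
  shows "valid_from m (dot_list c a b mk f m n) \<and> end_obj m (dot_list c a b mk f m n) = m"
proof -
  have "j < m \<Longrightarrow> valid_from m (replicate r (j, GY, m - Suc j)) \<and> end_obj m (replicate r (j, GY, m - Suc j)) = m" for j r
    by (induction r) auto
  then show ?thesis using assms dot_site_endpts by (induction n) (auto simp: dot_list_Suc)
qed

lemma dotted_word_hom: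
  assumes "(a, ls) \<in> hom_words a b"
  shows "dotted_word a b c ls f \<in> hom_words a b"
proof -
  have "valid_from a (dot_list c a b Bot f a a) \<and> end_obj a (dot_list c a b Bot f a a) = a"
    by (rule dot_list_valid) (auto simp: endpts_def)
  moreover have "valid_from b (dot_list c a b Top f b b) \<and> end_obj b (dot_list c a b Top f b b) = b"
    by (rule dot_list_valid) (auto simp: endpts_def)
  ultimately show ?thesis using assms by (simp add: dotted_word_eq hom_words_def)
qed

lemma num_dots_dotted_word:
  assumes "undotted ls"
  shows "num_dots (dotted_word a b c ls f) = (\<Sum>x | dot_site c a b x. f x)"
  unfolding sites_sum dotted_word_eq num_dots_def snd_conv ndots_def[symmetric]
  using ndots_undotted[OF assms] alldots_ndots[OF dot_list_alldots] by (simp add: dot_list_length)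

lemma dotted_word_cong:
  "(\<And>x. dot_site c a b x \<Longrightarrow> f x = g x) \<Longrightarrow> dotted_word a b c ls f = dotted_word a b c ls g"
  using dot_list_cong[of c a b _ f g] by (simp add: dotted_word_eq)

lemma Ind_sites_sum:
  assumes "(c, f) \<in> Ind a b k"
  shows "(\<Sum>x | dot_site c a b x. f x) = k"
proof -
  have c: "c \<in> Conn a b" and fc: "\<And>x. x \<in> endpts a b \<Longrightarrow> f (c x) = f x" and s: "sum f (endpts a b) = 2 * k"
    using assms by (auto simp: Ind_def)
  let ?S = "{x. dot_site c a b x}"
  have S: "?S \<subseteq> endpts a b" using dot_site_endpts by auto
  have "(\<Sum>x\<in>endpts a b - ?S. f x) = sum f ?S"
  proof (rule sum.reindex_bij_witness[where i = c and j = c])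
    show "c (c x) = x" "c x \<in> ?S" "f (c x) = f x" if "x \<in> endpts a b - ?S" for x
      using that ConnD[OF c, of x] dot_site_partner[OF c, of x] fc by auto
    show "c (c x) = x" "c x \<in> endpts a b - ?S" if "x \<in> ?S" for x
      using that S ConnD[OF c, of x] dot_site_partner[OF c, of x] by auto
  qed
  then have "2 * k = sum f ?S + sum f ?S" using sum.subset_diff[OF S, of f] s by simp
  then show ?thesis by simp
qed

lemma Ind_ext:
  assumes "(c, f) \<in> Ind a b k" "(c, g) \<in> Ind a b k" "\<And>x. dot_site c a b x \<Longrightarrow> f x = g x"
  shows "f = g"
proof
  fix x
  have c: "c \<in> Conn a b" using assms by (auto simp: Ind_def)
  show "f x = g x"
  proof (cases "x \<in> endpts a b")
    case True
    then have "dot_site c a b x \<or> dot_site c a b (c x)" using dot_site_partner[OF c] by blast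
    then have "f x = g x \<or> f (c x) = g (c x)" using assms(3) by blast
    then show ?thesis using assms(1,2) True by (auto simp: Ind_def)
  qed (use assms in \<open>auto simp: Ind_def\<close>)
qed

text \<open>The functional also kills words with fewer than \<open>k\<close> dots, since these
  cannot change all \<open>k\<close> auxiliary labels.\<close>

lemma (in marked) lower_ev:
  assumes "z \<in> lower a b k"
  shows "finite {w. z w \<noteq> 0} \<and> (\<Sum>w | z w \<noteq> 0. z w * ev k X Yt w) = 0"
  using assms unfolding lower_def
proof (rule lspan_induct_finite)
  fix g assume "g \<in> rel_space a b \<union> basis_vec ` {w \<in> hom_words a b. num_dots w < k}"
  then show "finite {w. g w \<noteq> 0} \<and> (\<Sum>w | g w \<noteq> 0. g w * ev k X Yt w) = 0"
  proof
    assume "g \<in> rel_space a b"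
    then show ?thesis by (rule rel_space_ev) (rule St_I, auto)
  next
    assume "g \<in> basis_vec ` {w \<in> hom_words a b. num_dots w < k}"
    then obtain w where w: "g = basis_vec w" "num_dots w < k" by auto
    have "ev k X Yt w = 0"
    proof (rule ccontr)
      assume "ev k X Yt w \<noteq> 0"
      then obtain x where "dX x \<noteq> 0" "reach k (snd w) x Yt" using F_nonzero unfolding ev_def by blast
      then have "reach k (snd w) X Yt" by (auto split: if_splits)
      then have "chg k X Yt \<le> ndots (snd w) + chg k Yt Yt" by (rule reach_chg)
      moreover have "chg k X Yt = k" using chg_St[of f Top b] by (simp add: k_def)
      ultimately show False using w(2) by (simp add: chg_def num_dots_def ndots_def)
    qed
    moreover have "{x. basis_vec w x \<noteq> 0} = {w}" by (auto simp: basis_vec_def)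
    ultimately show ?thesis using w(1) by simp
  qed
qed

lemma lower_mono_span:
  assumes "\<And>w. w \<in> hom_words a b \<Longrightarrow> num_dots w < k \<Longrightarrow> basis_vec w \<in> lspan (basis_vec ` S \<union> rel_space a b)"
    and "z \<in> lower a b k"
  shows "z \<in> lspan (basis_vec ` S \<union> rel_space a b)"
  using assms(2) unfolding lower_def by (rule lspan_subset) (use assms(1) in \<open>auto intro: lspan_base\<close>)

locale diagram_choice =
  fixes a b :: nat and d :: "(endpt \<Rightarrow> endpt) \<Rightarrow> layer list"
  assumes d: "\<And>c. c \<in> Conn a b \<Longrightarrow> normal_diagram a b (d c) \<and> has_connector a b (d c) c"
begin

abbreviation basis_word where "basis_word c f \<equiv> dotted_word a b c (d c) f"

lemma d_props: "c \<in> Conn a b \<Longrightarrow> (a, d c) \<in> hom_words a b \<and> undotted (d c)"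
  using d by (auto simp: normal_diagram_def)

lemma marked_k: "c \<in> Conn a b \<Longrightarrow> marked.k a b c f = num_dots (basis_word c f)"
proof -
  assume c: "c \<in> Conn a b"
  then interpret marked a b c f by unfold_locales
  show ?thesis using d_props[OF c] num_dots_dotted_word by (simp add: k_def sites_def)
qed

lemma S_bullet_hom: "S_bullet d a b \<subseteq> hom_words a b"
  using dotted_word_hom d_props by (fastforce simp: S_bullet_def)

lemma S_independent: "lin_indep_mod (rel_space a b) (S_bullet d a b)"
  unfolding lin_indep_mod_def
proof (intro allI impI, elim conjE, rule ccontr)
  fix FF u assume FF: "finite FF" "FF \<subseteq> S_bullet d a b" and R: "(\<lambda>x. \<Sum>w\<in>FF. u w * basis_vec w x) \<in> rel_space a b"
    and n: "\<not> (\<forall>w\<in>FF. u w = 0)"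
  let ?W = "{w \<in> FF. u w \<noteq> 0}" and ?z = "\<lambda>x. \<Sum>w\<in>FF. u w * basis_vec w x"
  have z: "?z x = (if x \<in> FF then u x else 0)" for x
    using FF(1) by (simp add: basis_vec_def if_distrib cong: if_cong)
  have supp: "{x. ?z x \<noteq> 0} = ?W" unfolding z by auto
  have W: "finite ?W" "?W \<noteq> {}" using FF n by auto
  \<comment> \<open>A word with the most dots in the support is marked: all other words then satisfy
    the dot bound of \<open>ev_other\<close>, and the functional isolates the coefficient of the
    marked word.\<close>
  then have "Max (num_dots ` ?W) \<in> num_dots ` ?W" by (intro Max_in) simp_all
  then obtain w where w1: "w \<in> ?W" and w': "Max (num_dots ` ?W) = num_dots w" by (rule imageE)
  have w2: "num_dots x \<le> num_dots w" if "x \<in> ?W" for x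
    unfolding w'[symmetric] using W(1) that by (intro Max_ge) simp_all
  obtain c f where c: "c \<in> Conn a b" and wd: "w = basis_word c f" using w1 FF(2) by (auto simp: S_bullet_def)
  interpret m: marked a b c f using c by unfold_locales
  have k: "m.k = num_dots w" using marked_k[OF c] wd by simp
  have dc: "normal_diagram a b (d c)" "has_connector a b (d c) c" using d[OF c] by auto
  have X: "range m.X \<subseteq> m.I" by (rule m.St_I) auto
  have zero: "m.ev m.k m.X m.Yt x = 0" if x: "x \<in> ?W" "x \<noteq> w" for x
  proof (rule ccontr)
    assume nz: "m.ev m.k m.X m.Yt x \<noteq> 0"
    have "x \<in> S_bullet d a b" using x FF(2) by blast
    then obtain c' f' where c': "c' \<in> Conn a b" and xd: "x = basis_word c' f'" by (auto simp: S_bullet_def)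
    have dc': "normal_diagram a b (d c')" "has_connector a b (d c') c'" using d[OF c'] by auto
    have "c' = c \<and> (\<forall>x\<in>m.sites. f' x = f x)"
      using m.ev_other[OF dc' c', of f'] w2[OF x(1)] nz k xd by simp
    then have "x = w" unfolding xd wd using dotted_word_cong[of c a b f' f "d c"] by (simp add: m.sites_def)
    then show False using x(2) by simp
  qed
  have "0 = (\<Sum>x | ?z x \<noteq> 0. ?z x * m.ev m.k m.X m.Yt x)" using m.rel_space_ev[OF R X] by simp
  also have "\<dots> = (\<Sum>x\<in>?W. u x * m.ev m.k m.X m.Yt x)" unfolding supp by (intro sum.cong refl) (simp add: z)
  also have "\<dots> = (\<Sum>x\<in>{w}. u x * m.ev m.k m.X m.Yt x)"
    using W(1) w1 zero by (intro sum.mono_neutral_right) auto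
  finally show False using m.ev_self[OF dc] w1 wd by simp
qed

text \<open>The functional of the first word is nonzero on it and vanishes on \<open>lower\<close>,
  so it must detect the second word. Allowing \<open>e = 0\<close> covers the statement that a basis
  word does not itself lie in \<open>lower\<close>.\<close>

lemma Ind_eqv_inj:
  assumes i: "(c, f) \<in> Ind a b k" "(c', f') \<in> Ind a b k"
    and z: "(\<lambda>x. basis_vec (basis_word c f) x - e * basis_vec (basis_word c' f') x) \<in> lower a b k"
  shows "e \<noteq> 0 \<and> (c, f) = (c', f')"
proof -
  have c: "c \<in> Conn a b" "c' \<in> Conn a b" using i by (auto simp: Ind_def)
  interpret m: marked a b c f using c by unfold_locales
  have dc: "normal_diagram a b (d c)" "has_connector a b (d c) c" using d[OF c(1)] by auto
  have dc': "normal_diagram a b (d c')" "has_connector a b (d c') c'" using d[OF c(2)] by auto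
  have nd: "num_dots (basis_word c f) = k" "num_dots (basis_word c' f') = k"
    using num_dots_dotted_word d_props[OF c(1)] d_props[OF c(2)] Ind_sites_sum[OF i(1)] Ind_sites_sum[OF i(2)] by simp_all
  have k: "m.k = k" using marked_k[OF c(1)] nd by simp
  let ?e = "m.ev m.k m.X m.Yt" and ?ts = "[(1, basis_word c f), (- e, basis_word c' f')]"
  have "(\<lambda>x. basis_vec (basis_word c f) x - e * basis_vec (basis_word c' f') x) = (\<lambda>x. \<Sum>(c, w)\<leftarrow>?ts. c * basis_vec w x)" by auto
  then have "(\<lambda>x. \<Sum>(c, w)\<leftarrow>?ts. c * basis_vec w x) \<in> lower a b m.k" using z k by (simp only:)
  from m.lower_ev[OF this] have "(\<Sum>(c, w)\<leftarrow>?ts. c * ?e w) = 0"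
    using basis_comb[of ?ts ?e] by (simp only:)
  then have "?e (basis_word c f) = e * ?e (basis_word c' f')" by simp
  then have nz: "e \<noteq> 0" "?e (basis_word c' f') \<noteq> 0" using m.ev_self[OF dc] by auto
  have "c' = c \<and> (\<forall>x\<in>m.sites. f' x = f x)"
    by (rule m.ev_other[OF dc' c(2) _ nz(2)]) (use nd k in simp)
  then show ?thesis using Ind_ext[of c f a b k f'] i nz by (auto simp: m.sites_def)
qed

text \<open>By independence, the basis words of degree \<open>k\<close> inject into the normal forms, and there are equally many
  of both, so every normal form is equivalent to a basis word.\<close>

lemma code_equiv:
  assumes "q \<in> codes (a + b) k"
  shows "\<exists>c f e. (c, f) \<in> Ind a b k \<and> (e = 1 \<or> e = -1) \<and>
    (\<lambda>x. basis_vec (a, lay a (unbend a (T q))) x - e * basis_vec (basis_word c f) x) \<in> lower a b k"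
proof -
  have Q: "\<exists>q. q \<in> codes (a + b) k \<and> (\<exists>e. (e = 1 \<or> e = -1) \<and>
      (\<lambda>x. basis_vec (a, lay a (unbend a (T q))) x - e * basis_vec (basis_word (fst i) (snd i)) x) \<in> lower a b k)"
    if i: "i \<in> Ind a b k" for i
  proof -
    obtain c f where cf: "i = (c, f)" by (cases i)
    have c: "c \<in> Conn a b" using i cf by (auto simp: Ind_def)
    have nd: "num_dots (basis_word c f) = k"
      using num_dots_dotted_word d_props[OF c] Ind_sites_sum i cf by simp
    obtain u where u: "ok a u" "fin a u = b" "basis_word c f = (a, lay a u)"
      using hom_words_lay[OF dotted_word_hom[OF conjunct1[OF d_props[OF c]], of c f]] by blast
    have du: "dots u = k" using nd u(3) num_dots_lay by simp
    consider "E a (-1) u u" | q where "vcode q" "2 * length q = a + b" "csum q = dots u" "eqv a u (unbend a (T q))"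
      using reduce[OF u(1,2)] by blast
    then show ?thesis
    proof cases
      case 1
      \<comment> \<open>A word equivalent to its negative has its double in \<open>lower\<close>;
        halving gives the word itself, contrary to \<open>Ind_eqv_inj\<close> with coefficient
        0.\<close>
      have "(\<lambda>x. (1 / 2) * (basis_vec (a, lay a u) x - of_int (-1) * basis_vec (a, lay a u) x)) \<in> lower a b k"
        using E_sound[OF 1] u du unfolding lower_def by (intro lspan_scale) simp
      then have "(\<lambda>x. basis_vec (basis_word c f) x - 0 * basis_vec (basis_word c f) x) \<in> lower a b k"
        using u(3) by simp
      then have False using Ind_eqv_inj[of c f k c f 0] i cf by simp
      then show ?thesis ..
    next
      case 2
      then obtain e where e: "E a e (unbend a (T q)) u" by (auto simp: eqv_def dest: E_sym)
      have "fin a (unbend a (T q)) = b" "dots (unbend a (T q)) = k" "e = 1 \<or> e = -1"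
        using E_ok[OF e] u du by auto
      then have "(\<lambda>x. basis_vec (a, lay a (unbend a (T q))) x - of_int e * basis_vec (basis_word c f) x) \<in> lower a b k"
        using E_sound[OF e] u(3) by simp
      moreover have "q \<in> codes (a + b) k" using 2 du by (simp add: codes_def)
      ultimately show ?thesis using \<open>e = 1 \<or> e = -1\<close> cf by (intro exI[of _ q] conjI exI[of _ "of_int e"]) auto
    qed
  qed
  define p where "p i = (SOME q. q \<in> codes (a + b) k \<and> (\<exists>e. (e = 1 \<or> e = -1) \<and>
      (\<lambda>x. basis_vec (a, lay a (unbend a (T q))) x - e * basis_vec (basis_word (fst i) (snd i)) x) \<in> lower a b k))" for i
  have p: "p i \<in> codes (a + b) k \<and> (\<exists>e. (e = 1 \<or> e = -1) \<and>
      (\<lambda>x. basis_vec (a, lay a (unbend a (T (p i)))) x - e * basis_vec (basis_word (fst i) (snd i)) x) \<in> lower a b k)"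
    if "i \<in> Ind a b k" for i
    unfolding p_def by (rule someI_ex[OF Q[OF that]])
  have inj: "inj_on p (Ind a b k)"
  proof (rule inj_onI)
    fix i j assume ij: "i \<in> Ind a b k" "j \<in> Ind a b k" and eq: "p i = p j"
    let ?t = "basis_vec (a, lay a (unbend a (T (p i))))"
    obtain e e' where e: "e = 1 \<or> e = -1" "(\<lambda>x. ?t x - e * basis_vec (basis_word (fst i) (snd i)) x) \<in> lower a b k"
      and e': "(\<lambda>x. ?t x - e' * basis_vec (basis_word (fst j) (snd j)) x) \<in> lower a b k"
      using p[OF ij(1)] p[OF ij(2)] unfolding eq by blast
    \<comment> \<open>Eliminating the common normal form leaves a combination of the two basis
      words; the factor \<open>e\<close> normalises the first coefficient to 1.\<close>
    have "(\<lambda>x. e * ((?t x - e' * basis_vec (basis_word (fst j) (snd j)) x) - (?t x - e * basis_vec (basis_word (fst i) (snd i)) x))) \<in> lower a b k"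
      using lspan_scale[OF lspan_diff[OF e'[unfolded lower_def] e(2)[unfolded lower_def]]] unfolding lower_def .
    moreover have "(\<lambda>x. e * ((?t x - e' * basis_vec (basis_word (fst j) (snd j)) x) - (?t x - e * basis_vec (basis_word (fst i) (snd i)) x))) =
       (\<lambda>x. basis_vec (basis_word (fst i) (snd i)) x - (e * e') * basis_vec (basis_word (fst j) (snd j)) x)"
      using e(1) by (intro ext) (auto simp: algebra_simps)
    ultimately have "(\<lambda>x. basis_vec (basis_word (fst i) (snd i)) x - (e * e') * basis_vec (basis_word (fst j) (snd j)) x) \<in> lower a b k"
      by (simp only:)
    then show "i = j" using Ind_eqv_inj[of "fst i" "snd i" k "fst j" "snd j"] ij by simp
  qed
  have sub: "p ` Ind a b k \<subseteq> codes (a + b) k" using p by auto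
  have fin: "finite (Ind a b k)" using inj_on_finite[OF inj sub finite_codes] .
  \<comment> \<open>Finiteness of \<open>Ind\<close> comes from the injection \<open>p\<close>; the
    reverse injection of codes into matchings then makes \<open>p\<close> surjective.\<close>
  have "code_ind a b ` codes (a + b) k \<subseteq> Ind a b k" using code_ind_mem by blast
  then have "card (codes (a + b) k) \<le> card (Ind a b k)"
    using card_inj_on_le[OF code_ind_inj _ fin] by blast
  then have "p ` Ind a b k = codes (a + b) k"
    using card_image[OF inj] by (intro card_seteq[OF finite_codes sub]) simp
  then have "q \<in> p ` Ind a b k" using assms by (simp only:)
  then obtain i where i: "q = p i" "i \<in> Ind a b k" by (rule imageE)
  obtain e where "e = 1 \<or> e = -1"
    "(\<lambda>x. basis_vec (a, lay a (unbend a (T q))) x - e * basis_vec (basis_word (fst i) (snd i)) x) \<in> lower a b k"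
    using p[OF i(2)] unfolding i(1)[symmetric] by (elim conjE exE)
  moreover have "(fst i, snd i) \<in> Ind a b k" using i(2) by simp
  ultimately show ?thesis by (intro exI[of _ "fst i"] exI[of _ "snd i"] exI[of _ e] conjI)
qed

lemma S_le_mono: "j \<le> k \<Longrightarrow> S_le d a b j \<subseteq> S_le d a b k"
  by (auto simp: S_le_def)

lemma span_mono: "x \<in> lspan (basis_vec ` A \<union> R) \<Longrightarrow> A \<subseteq> A' \<Longrightarrow> x \<in> lspan (basis_vec ` A' \<union> R)"
  by (erule lspan_subset) (auto intro!: lspan_base)

text \<open>Induction on the number of dots: equivalences hold up to \<open>lower\<close>, whose
  words with fewer dots are spanned by the induction hypothesis. Recording the dot bound gives the
  filtered and the unfiltered claim together.\<close>

lemma S_le_spans: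
  "w \<in> hom_words a b \<Longrightarrow> basis_vec w \<in> lspan (basis_vec ` S_le d a b (num_dots w) \<union> rel_space a b)"
proof (induction "num_dots w" arbitrary: w rule: less_induct)
  case less
  let ?k = "num_dots w" and ?V = "lspan (basis_vec ` S_le d a b (num_dots w) \<union> rel_space a b)"
  have low: "z \<in> ?V" if "z \<in> lower a b ?k" for z
  proof (rule lower_mono_span[OF _ that])
    fix x assume x: "x \<in> hom_words a b" "num_dots x < ?k"
    show "basis_vec x \<in> ?V"
      by (rule span_mono[OF less.hyps[OF x(2,1)]]) (use x S_le_mono in auto)
  qed
  obtain u where u: "ok a u" "fin a u = b" "w = (a, lay a u)" using hom_words_lay[OF less.prems] by blast
  have du: "dots u = ?k" using u(3) by simp
  consider "E a (-1) u u" | q where "vcode q" "2 * length q = a + b" "csum q = dots u" "eqv a u (unbend a (T q))"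
    using reduce[OF u(1,2)] by blast
  then show ?case
  proof cases
    case 1
    have "(\<lambda>x. (1 / 2) * (basis_vec w x - of_int (-1) * basis_vec w x)) \<in> lower a b ?k"
      using lspan_scale[OF E_sound[OF 1, unfolded u(2) du, folded u(3), unfolded lower_def]] unfolding lower_def .
    then show ?thesis using low by simp
  next
    case 2
    then obtain e where e: "E a e u (unbend a (T q))" by (auto simp: eqv_def)
    let ?t = "basis_vec (a, lay a (unbend a (T q)))"
    have 1: "(\<lambda>x. basis_vec w x - of_int e * ?t x) \<in> ?V"
      by (rule low) (rule E_sound[OF e, unfolded u(2) du, folded u(3)])
    have "q \<in> codes (a + b) ?k" using 2 du by (simp add: codes_def)
    then obtain c f e' where cf: "(c, f) \<in> Ind a b ?k" and t: "(\<lambda>x. ?t x - e' * basis_vec (basis_word c f) x) \<in> lower a b ?k"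
      using code_equiv by blast
    have c: "c \<in> Conn a b" using cf by (auto simp: Ind_def)
    have "num_dots (basis_word c f) = ?k" using num_dots_dotted_word d_props[OF c] Ind_sites_sum[OF cf] by simp
    then have "basis_word c f \<in> S_le d a b ?k" using c by (auto simp: S_le_def S_bullet_def)
    then have s: "basis_vec (basis_word c f) \<in> ?V" by (intro lspan_base) auto
    have "(\<lambda>x. (basis_vec w x - of_int e * ?t x) + of_int e * ((?t x - e' * basis_vec (basis_word c f) x) + e' * basis_vec (basis_word c f) x)) \<in> ?V"
      by (intro lspan_add lspan_scale 1 s low[OF t])
    then show ?thesis by simp
  qed
qed

end

theorem theorem2:
  fixes a b k :: nat and d :: "(endpt \<Rightarrow> endpt) \<Rightarrow> layer list"
  assumes "\<forall>c\<in>Conn a b. normal_diagram a b (d c) \<and> has_connector a b (d c) c"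
  shows "quotient_basis (rel_space a b) (S_le d a b k) (Hom_le_words a b k) \<and>
         quotient_basis (rel_space a b) (S_bullet d a b) (hom_words a b)"
proof -
  interpret diagram_choice a b d using assms by unfold_locales blast
  have "lin_indep_mod (rel_space a b) (S_le d a b k)"
    using S_independent unfolding lin_indep_mod_def S_le_def by blast
  moreover have "S_le d a b k \<subseteq> Hom_le_words a b k"
    using S_bullet_hom by (auto simp: S_le_def Hom_le_words_def)
  moreover have "basis_vec w \<in> lspan (basis_vec ` S_le d a b k \<union> rel_space a b)" if "w \<in> Hom_le_words a b k" for w
    using that by (intro span_mono[OF S_le_spans S_le_mono]) (auto simp: Hom_le_words_def)
  moreover have "basis_vec w \<in> lspan (basis_vec ` S_bullet d a b \<union> rel_space a b)" if "w \<in> hom_words a b" for w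
    using that by (intro span_mono[OF S_le_spans]) (auto simp: S_le_def)
  ultimately show ?thesis using S_independent S_bullet_hom by (simp add: quotient_basis_def)
qed

end
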